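(* Let $K\ge 2$, $M\ge 2$ with $K$ an integer multiple of $M$ (so $K\ge M$), and let $x\ge 1$. Define $$L_{\mathrm{P1}}(x)= \frac{\pi^{2}}{16}\frac{\underline{C}^{2}}{\overline{C}_{\mathrm{SN}}^{2}}\frac{K}{M^{3}}\; \frac{\max\left[0,\,1-\frac{8}{\underline{C}\pi}\frac{M}{\sqrt{K}}x\right]^{2}}{\frac{\overline{C}^{2}}{\overline{C}_{\mathrm{SN}}^{2}}+\frac{3}{\overline{C}_{\mathrm{SN}}^{2}}\frac{x}{\sqrt{M}}+\frac{\sigma^{2}}{\overline{C}_{\mathrm{SN}}^{2}}\left(\overline{c}^{2}+\frac{x}{\sqrt{K}}\right)+\frac{\sigma^{2}}{\overline{C}^{2}_{\mathrm{SN}}}},$$ $$U_{\mathrm{P1}}(x)= \frac{\pi^{2}}{16}\frac{\overline{C}^{2}}{\underline{C}_{\mathrm{SN}}^{2}}\frac{K}{M^{3}}\; \frac{\left(1+\frac{8}{\overline{C}\pi}\frac{M}{\sqrt{K}}x\right)^{2}}{\max\left[0,\,\frac{\underline{C}^{2}}{\underline{C}_{\mathrm{SN}}^{2}}\frac{M-1}{M}-\frac{3}{\underline{C}_{\mathrm{SN}}^{2}}\frac{x}{\sqrt{M}}\right]+\max\left[0,\,\frac{\sigma^{2}}{\underline{C}_{\mathrm{SN}}^{2}}\left(\underline{c}^{2}-\frac{x}{\sqrt{K}}\right)\right]+\frac{\sigma^{2}}{\underline{C}^{2}_{\mathrm{SN}}}}.$$ Then for every $m\in\{1,\dots,M\}$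 the probability $P_{\mathrm{P1}}(x)$ of the event $\mathrm{SINR}^{\mathrm{P1}}_{m}\notin[L_{\mathrm{P1}}(x),U_{\mathrm{P1}}(x)]$ satisfies $$P_{\mathrm{P1}}(x)\le 302\,K^{2}M\,e^{-\Delta_{\mathrm{P1}}\,x^{2/7}},\qquad \Delta_{\mathrm{P1}}=\min\left[2^{-10/21},\ \frac{1}{2^{31/21}\,\overline{C}^{2}},\ \frac{1}{8\,\overline{C}^{4}},\ \frac{1}{4\,\overline{c}^{4}}\right].$$
   Context: Fix constants $0<\underline{E}\le\overline{E}<\infty$, $0<\underline{P}\le\overline{P}<\infty$, $P_{\mathrm{rel}}>0$, $\sigma^2>0$ (independent of $M,K$). For $k\in\{1,\dots,K\}$ (relays) and $m\in\{1,\dots,M\}$ (source-destination pairs) let $E_{k,m}\in[\underline{E},\overline{E}]$ and $P_{m,k}\in[\underline{P},\overline{P}]$ be deterministic. Let $h_{k,m}$, $f_{m,k}$ ($1\le k\le K$, $1\le m\le M$) be jointly independent circularly symmetric complex Gaussian $\mathcal{CN}(0,1)$ random variables (backward and forward channel gains). Put $\tilde h_{k,m}=\exp(j\arg h_{k,m})$, $\tilde f_{m,k}=\exp(j\arg f_{m,k})$. Protocol P1: the relays are partitioned into $M$ groups of equal size $K/M$; $p:\{1,\dots,K\}\to\{1,\dots,M\}$ is the partitioning function, so $|p^{-1}(m)|=K/M$ for each $m$. Let $$d_{\mathrm{P1},k}=\sqrt{P_{\mathrm{rel}}}\Big[\tfrac{K}{M}\sum_{m=1}^M E_{k,m}+K\sigma^2\Big]^{-1/2},\quad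 C^{m,\hat m}_{\mathrm{P1},k}=\sqrt{K}\,d_{\mathrm{P1},k}\sqrt{P_{m,k}E_{k,\hat m}},\quad C^{m}_{\mathrm{P1},k}=\sqrt{K}\,d_{\mathrm{P1},k}\sqrt{P_{m,k}},$$ $$a_k^{m,\hat m}=C^{m,\hat m}_{\mathrm{P1},k}\,\tilde f^{*}_{p(k),k}\,f_{m,k}\,\tilde h^{*}_{k,p(k)}\,h_{k,\hat m},\qquad b_k^m=C^{m}_{\mathrm{P1},k}\,\tilde f^{*}_{p(k),k}\,f_{m,k}\,\tilde h^{*}_{k,p(k)},$$ where $^*$ is complex conjugation. The effective SINR of the $m$th link is $$\mathrm{SINR}^{\mathrm{P1}}_{m}=\frac{\big|\sum_{k=1}^{K}a_k^{m,m}\big|^2}{\sum_{\hat m\ne m}\big|\sum_{k=1}^{K}a_k^{m,\hat m}\big|^2+\sigma^2M\sum_{k=1}^{K}|b_k^m|^2+KM\sigma^2}.$$ Constants: $\underline{C}=\sqrt{\underline{P}\,\underline{E}P_{\mathrm{rel}}/(\overline{E}+\sigma^2)}$, $\overline{C}=\sqrt{\overline{P}\,\overline{E}P_{\mathrm{rel}}/(\underline{E}+\sigma^2)}$, $\underline{c}=\sqrt{\underline{P}P_{\mathrm{rel}}/(\overline{E}+\sigma^2)}$, $\overline{c}=\sqrt{\overline{P}P_{\mathrm{rel}}/(\underline{E}+\sigma^2)}$, $\overline{C}_{\mathrm{SN}}=\sqrt{\overline{C}^2+\sigma^2(\overline{c}^2+1)}$, $\underline{C}_{\mathrm{SN}}=\sqrt{\underline{C}^2+\sigma^2(\underline{c}^2+1)}$.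 *)

theory Defs
  imports "HOL-Probability.Probability"
begin

text \<open>Density (with respect to Lebesgue measure on the complex plane) of the circularly symmetric
  complex Gaussian distribution CN(0,1). The variance 1 is the total variance \<open>E|Z|\<^sup>2\<close>, so the real
  and imaginary parts are independent centred real Gaussians of variance 1/2 each.\<close>

definition cn_density :: "complex \<Rightarrow> real" where
  "cn_density z = exp (- (cmod z)\<^sup>2) / pi"

definition phase :: "complex \<Rightarrow> complex" where
  "phase z = exp (\<i> * complex_of_real (Arg z))"

text \<open>All families of channel gains, one for each ordered pair, as a single family indexed by a
  disjoint sum, so that their joint independence can be stated with \<open>indep_vars\<close>.\<close>

definition gain_index :: "nat \<Rightarrow> nat \<Rightarrow> ((nat \<times> nat) + (nat \<times> nat)) set" where
  "gain_index K M = ({1..K} \<times> {1..M}) <+> ({1..M} \<times> {1..K})"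

definition gain_family ::
  "(nat \<Rightarrow> nat \<Rightarrow> 'w \<Rightarrow> complex) \<Rightarrow> (nat \<Rightarrow> nat \<Rightarrow> 'w \<Rightarrow> complex) \<Rightarrow>
   (nat \<times> nat) + (nat \<times> nat) \<Rightarrow> 'w \<Rightarrow> complex" where
  "gain_family h f = case_sum (\<lambda>(k, m). h k m) (\<lambda>(m, k). f m k)"

text \<open>In what follows \<open>K\<close> is the number of relays, \<open>M\<close> the number of source-destination pairs,
  \<open>E k m\<close> and \<open>P m k\<close> are the deterministic channel energies of the backward and forward links,
  \<open>h k m\<close> and \<open>f m k\<close> are realizations of the backward and forward channel gains, and
  \<open>p\<close> is the partitioning function. The noise variance is \<open>\<sigma>\<^sup>2\<close>.\<close>

definition d_P1 :: "nat \<Rightarrow> nat \<Rightarrow> real \<Rightarrow> real \<Rightarrow> (nat \<Rightarrow> nat \<Rightarrow> real) \<Rightarrow> nat \<Rightarrow> real" where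
  "d_P1 K M Prel \<sigma> E k =
     sqrt Prel * (real K / real M * (\<Sum>m = 1..M. E k m) + real K * \<sigma>\<^sup>2) powr (- 1 / 2)"

definition C_P1 ::
  "nat \<Rightarrow> nat \<Rightarrow> real \<Rightarrow> real \<Rightarrow> (nat \<Rightarrow> nat \<Rightarrow> real) \<Rightarrow> (nat \<Rightarrow> nat \<Rightarrow> real) \<Rightarrow>
   nat \<Rightarrow> nat \<Rightarrow> nat \<Rightarrow> real" where
  "C_P1 K M Prel \<sigma> E P m m' k =
     sqrt (real K) * d_P1 K M Prel \<sigma> E k * sqrt (P m k * E k m')"

definition c_P1 ::
  "nat \<Rightarrow> nat \<Rightarrow> real \<Rightarrow> real \<Rightarrow> (nat \<Rightarrow> nat \<Rightarrow> real) \<Rightarrow> (nat \<Rightarrow> nat \<Rightarrow> real) \<Rightarrow>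
   nat \<Rightarrow> nat \<Rightarrow> real" where
  "c_P1 K M Prel \<sigma> E P m k = sqrt (real K) * d_P1 K M Prel \<sigma> E k * sqrt (P m k)"

definition a_P1 ::
  "nat \<Rightarrow> nat \<Rightarrow> real \<Rightarrow> real \<Rightarrow> (nat \<Rightarrow> nat \<Rightarrow> real) \<Rightarrow> (nat \<Rightarrow> nat \<Rightarrow> real) \<Rightarrow>
   (nat \<Rightarrow> nat) \<Rightarrow> (nat \<Rightarrow> nat \<Rightarrow> complex) \<Rightarrow> (nat \<Rightarrow> nat \<Rightarrow> complex) \<Rightarrow>
   nat \<Rightarrow> nat \<Rightarrow> nat \<Rightarrow> complex" where
  "a_P1 K M Prel \<sigma> E P p h f m m' k =
     complex_of_real (C_P1 K M Prel \<sigma> E P m m' k) *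
     cnj (phase (f (p k) k)) * f m k * cnj (phase (h k (p k))) * h k m'"

definition b_P1 ::
  "nat \<Rightarrow> nat \<Rightarrow> real \<Rightarrow> real \<Rightarrow> (nat \<Rightarrow> nat \<Rightarrow> real) \<Rightarrow> (nat \<Rightarrow> nat \<Rightarrow> real) \<Rightarrow>
   (nat \<Rightarrow> nat) \<Rightarrow> (nat \<Rightarrow> nat \<Rightarrow> complex) \<Rightarrow> (nat \<Rightarrow> nat \<Rightarrow> complex) \<Rightarrow>
   nat \<Rightarrow> nat \<Rightarrow> complex" where
  "b_P1 K M Prel \<sigma> E P p h f m k =
     complex_of_real (c_P1 K M Prel \<sigma> E P m k) *
     cnj (phase (f (p k) k)) * f m k * cnj (phase (h k (p k)))"

definition SINR_P1 ::
  "nat \<Rightarrow> nat \<Rightarrow> real \<Rightarrow> real \<Rightarrow> (nat \<Rightarrow> nat \<Rightarrow> real) \<Rightarrow> (nat \<Rightarrow> nat \<Rightarrow> real) \<Rightarrow>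
   (nat \<Rightarrow> nat) \<Rightarrow> (nat \<Rightarrow> nat \<Rightarrow> complex) \<Rightarrow> (nat \<Rightarrow> nat \<Rightarrow> complex) \<Rightarrow>
   nat \<Rightarrow> real" where
  "SINR_P1 K M Prel \<sigma> E P p h f m =
     (cmod (\<Sum>k = 1..K. a_P1 K M Prel \<sigma> E P p h f m m k))\<^sup>2 /
     ((\<Sum>m' \<in> {1..M} - {m}. (cmod (\<Sum>k = 1..K. a_P1 K M Prel \<sigma> E P p h f m m' k))\<^sup>2)
      + \<sigma>\<^sup>2 * real M * (\<Sum>k = 1..K. (cmod (b_P1 K M Prel \<sigma> E P p h f m k))\<^sup>2)
      + real K * real M * \<sigma>\<^sup>2)"

text \<open>Each constant below comes in a lower and an upper version. The lower one takes the lower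
  bounds on the energies in the numerator and the upper bound on \<open>E\<close> in the denominator; the upper
  one does the opposite.\<close>

definition C_bound :: "real \<Rightarrow> real \<Rightarrow> real \<Rightarrow> real \<Rightarrow> real \<Rightarrow> real" where
  "C_bound Pnum Enum Eden Prel \<sigma> = sqrt (Pnum * Enum * Prel / (Eden + \<sigma>\<^sup>2))"

definition c_bound :: "real \<Rightarrow> real \<Rightarrow> real \<Rightarrow> real \<Rightarrow> real" where
  "c_bound Pnum Eden Prel \<sigma> = sqrt (Pnum * Prel / (Eden + \<sigma>\<^sup>2))"

definition C_SN :: "real \<Rightarrow> real \<Rightarrow> real \<Rightarrow> real" where
  "C_SN C c \<sigma> = sqrt (C\<^sup>2 + \<sigma>\<^sup>2 * (c\<^sup>2 + 1))"

definition L_P1 ::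
  "real \<Rightarrow> real \<Rightarrow> real \<Rightarrow> real \<Rightarrow> real \<Rightarrow> real \<Rightarrow> nat \<Rightarrow> nat \<Rightarrow> real \<Rightarrow> real" where
  "L_P1 Elo Ehi Plo Phi Prel \<sigma> K M x =
     (let Clo = C_bound Plo Elo Ehi Prel \<sigma>;
          Chi = C_bound Phi Ehi Elo Prel \<sigma>;
          chi = c_bound Phi Elo Prel \<sigma>;
          CSNhi = C_SN Chi chi \<sigma>
      in pi\<^sup>2 / 16 * (Clo\<^sup>2 / CSNhi\<^sup>2) * (real K / real M ^ 3) *
         ((max 0 (1 - 8 / (Clo * pi) * (real M / sqrt (real K)) * x))\<^sup>2 /
          (Chi\<^sup>2 / CSNhi\<^sup>2 + 3 / CSNhi\<^sup>2 * (x / sqrt (real M))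
           + \<sigma>\<^sup>2 / CSNhi\<^sup>2 * (chi\<^sup>2 + x / sqrt (real K)) + \<sigma>\<^sup>2 / CSNhi\<^sup>2)))"

definition U_P1 ::
  "real \<Rightarrow> real \<Rightarrow> real \<Rightarrow> real \<Rightarrow> real \<Rightarrow> real \<Rightarrow> nat \<Rightarrow> nat \<Rightarrow> real \<Rightarrow> real" where
  "U_P1 Elo Ehi Plo Phi Prel \<sigma> K M x =
     (let Clo = C_bound Plo Elo Ehi Prel \<sigma>;
          Chi = C_bound Phi Ehi Elo Prel \<sigma>;
          clo = c_bound Plo Ehi Prel \<sigma>;
          CSNlo = C_SN Clo clo \<sigma>
      in pi\<^sup>2 / 16 * (Chi\<^sup>2 / CSNlo\<^sup>2) * (real K / real M ^ 3) *
         ((1 + 8 / (Chi * pi) * (real M / sqrt (real K)) * x)\<^sup>2 /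
          (max 0 (Clo\<^sup>2 / CSNlo\<^sup>2 * ((real M - 1) / real M) - 3 / CSNlo\<^sup>2 * (x / sqrt (real M)))
           + max 0 (\<sigma>\<^sup>2 / CSNlo\<^sup>2 * (clo\<^sup>2 - x / sqrt (real K))) + \<sigma>\<^sup>2 / CSNlo\<^sup>2)))"

definition Delta_P1 :: "real \<Rightarrow> real \<Rightarrow> real \<Rightarrow> real \<Rightarrow> real \<Rightarrow> real" where
  "Delta_P1 Elo Ehi Phi Prel \<sigma> =
     (let Chi = C_bound Phi Ehi Elo Prel \<sigma>;
          chi = c_bound Phi Elo Prel \<sigma>
      in Min {2 powr (- 10 / 21), 1 / (2 powr (31 / 21) * Chi\<^sup>2), 1 / (8 * Chi ^ 4), 1 / (4 * chi ^ 4)})"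

end

theory Submission
  imports Defs
begin

text \<open>
  Put \<open>T = \<Delta> x\<^sup>2\<^sup>/\<^sup>7\<close>; for \<open>T < 7\<close> the claimed bound exceeds 1. Let \<open>Z m'\<close> be the sum over all relays of
  the coefficients \<open>a\<close> from source \<open>m'\<close> to destination \<open>m\<close>, so that the numerator of the SINR is
  \<open>\<bar>Z m\<bar>\<^sup>2\<close> and the interference is the sum of the \<open>\<bar>Z m'\<bar>\<^sup>2\<close> over \<open>m' \<noteq> m\<close>.
  Write \<open>Z m' = aligned m' + scattered m'\<close>, where the aligned part collects the relays of group \<open>m'\<close>.
  Condition on all forward gains and on the backward gains \<open>h k (p k)\<close>. Then the aligned parts are
  constants, and the scattered parts are centred complex Gaussians which are independent for different
  \<open>m'\<close>, with variance \<open>spread m'\<close>. Hence \<open>\<Sum> \<bar>Z m'\<bar>\<^sup>2\<close> is conditionally a sum of independent nonnegative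
  variables, and it is within \<open>K \<surd>M x\<close> of its conditional mean: from above by Hoeffding's inequality
  after truncation, and from below by the one-sided bound that needs second moments only.
  For \<open>m' \<noteq> m\<close> the aligned part is itself Gaussian given everything but the gains \<open>f m k\<close> with
  \<open>p k \<noteq> m\<close>, hence small; \<open>aligned m\<close> is a sum of independent products of two Rayleigh variables of
  mean \<open>\<pi> / 4\<close>. Each exceptional event has probability at most a small multiple of \<open>exp (- T)\<close>, and the
  choice of \<open>T\<close> makes all deviations smaller than those allowed for by the bounds \<open>L\<close> and \<open>U\<close>.
\<close>

section \<open>The complex Gaussian distribution\<close>

text \<open>The minus sign makes the half-lines generating the Borel sets have finite measure.\<close>

lemma distr_uminus_cmod_square:
  "distr lborel borel (\<lambda>z::complex. - (cmod z)\<^sup>2) = density lborel (\<lambda>t. ennreal pi * indicator {..0} t)"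
proof (rule measure_eqI_lessThan)
  fix x :: real
  have *: "emeasure (distr lborel borel (\<lambda>z::complex. - (cmod z)\<^sup>2)) {x<..} =
      (if x < 0 then ennreal (pi * (- x)) else 0)"
  proof (cases "x < 0")
    case True
    have "(\<lambda>z::complex. - (cmod z)\<^sup>2) -` {x<..} = ball 0 (sqrt (- x))"
    proof -
      have "x < - (cmod z)\<^sup>2 \<longleftrightarrow> cmod z < sqrt (- x)" for z
        using real_sqrt_less_iff[of "(cmod z)\<^sup>2" "- x"] by (simp add: less_minus_iff)
      then show ?thesis by auto
    qed
    then show ?thesis using True
      by (simp add: emeasure_distr emeasure_ball unit_ball_vol_2)
  next
    case False
    have "(\<lambda>z::complex. - (cmod z)\<^sup>2) -` {x<..} = {}"
      using False by (auto simp: not_less) (smt (verit) zero_le_power2)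
    then show ?thesis using False by (simp add: emeasure_distr)
  qed
  show "emeasure (distr lborel borel (\<lambda>z::complex. - (cmod z)\<^sup>2)) {x<..} < \<infinity>"
    by (simp add: *)
  have "emeasure (density lborel (\<lambda>t. ennreal pi * indicator {..0} t)) {x<..} =
      (\<integral>\<^sup>+t. ennreal pi * indicator {x<..0} t \<partial>lborel)"
    by (subst emeasure_density) (auto intro!: nn_integral_cong split: split_indicator)
  also have "\<dots> = (if x < 0 then ennreal (pi * (- x)) else 0)"
    by (cases "x < 0") (auto simp: nn_integral_cmult_indicator ennreal_mult'[symmetric])
  finally show "emeasure (distr lborel borel (\<lambda>z::complex. - (cmod z)\<^sup>2)) {x<..} =
      emeasure (density lborel (\<lambda>t. ennreal pi * indicator {..0} t)) {x<..}"
    using * by simp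
qed auto

lemma cn_density_measurable [measurable]: "cn_density \<in> borel_measurable borel"
  unfolding cn_density_def by measurable

lemma cn_density_nonneg: "0 \<le> cn_density z"
  by (simp add: cn_density_def)

text \<open>The density depends on \<open>z\<close> only through its squared modulus. Pushing
  Lebesgue measure forward along minus the squared modulus gives the constant density
  \<open>pi\<close> on the negative half-line, which cancels the factor \<open>1 / pi\<close> and
  leaves the exponential density after a reflection.\<close>

lemma nn_integral_cn_density_radial:
  fixes g :: "real \<Rightarrow> ennreal"
  assumes [measurable]: "g \<in> borel_measurable borel"
  shows "(\<integral>\<^sup>+z. ennreal (cn_density z) * g ((cmod z)\<^sup>2) \<partial>lborel) =
    (\<integral>\<^sup>+t. ennreal (exponential_density 1 t) * g t \<partial>lborel)"
proof -
  have "(\<integral>\<^sup>+z. ennreal (cn_density z) * g ((cmod z)\<^sup>2) \<partial>lborel) =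
      (\<integral>\<^sup>+s. ennreal (exp s / pi) * g (- s) \<partial>distr lborel borel (\<lambda>z::complex. - (cmod z)\<^sup>2))"
    by (subst nn_integral_distr) (auto simp: cn_density_def)
  also have "\<dots> = (\<integral>\<^sup>+s. ennreal pi * indicator {..0} s * (ennreal (exp s / pi) * g (- s)) \<partial>lborel)"
    unfolding distr_uminus_cmod_square by (subst nn_integral_density) auto
  also have "\<dots> = (\<integral>\<^sup>+s. indicator {..0} s * (ennreal (exp s) * g (- s)) \<partial>lborel)"
    by (intro nn_integral_cong)
      (auto split: split_indicator simp: mult.assoc[symmetric] ennreal_mult'[symmetric])
  also have "\<dots> = (\<integral>\<^sup>+t. indicator {..0} (- t) * (ennreal (exp (- t)) * g t) \<partial>lborel)"
    by (subst (2) lborel_distr_uminus[symmetric], subst nn_integral_distr) auto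
  also have "\<dots> = (\<integral>\<^sup>+t. ennreal (exponential_density 1 t) * g t \<partial>lborel)"
    by (intro nn_integral_cong) (auto split: split_indicator simp: exponential_density_def)
  finally show ?thesis .
qed

text \<open>Reduces all even moments and the tail of a complex Gaussian to known facts about the
  exponential distribution.\<close>

lemma distributed_cn_cmod_square:
  assumes X: "distributed W lborel X cn_density"
  shows "distributed W lborel (\<lambda>w. (cmod (X w))\<^sup>2) (exponential_density 1)"
proof -
  have [measurable]: "X \<in> borel_measurable W"
    using distributed_measurable[OF X] by simp
  have "distr W lborel (\<lambda>w. (cmod (X w))\<^sup>2) = density lborel (exponential_density 1)"
  proof (rule measure_eqI)
    fix A assume "A \<in> sets (distr W lborel (\<lambda>w. (cmod (X w))\<^sup>2))"
    then have [measurable]: "A \<in> sets borel" by simp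
    have "emeasure (distr W lborel (\<lambda>w. (cmod (X w))\<^sup>2)) A = (\<integral>\<^sup>+w. indicator A ((cmod (X w))\<^sup>2) \<partial>W)"
      by (subst nn_integral_distr[of "\<lambda>w. (cmod (X w))\<^sup>2" W lborel "indicator A", symmetric]) auto
    also have "\<dots> = (\<integral>\<^sup>+z. ennreal (cn_density z) * indicator A ((cmod z)\<^sup>2) \<partial>lborel)"
      by (rule distributed_nn_integral[OF X, symmetric]) measurable
    also have "\<dots> = emeasure (density lborel (exponential_density 1)) A"
      by (subst nn_integral_cn_density_radial) (auto simp: emeasure_density)
    finally show "emeasure (distr W lborel (\<lambda>w. (cmod (X w))\<^sup>2)) A = emeasure (density lborel (exponential_density 1)) A" .
  qed simp
  then show ?thesis
    by (simp add: distributed_def)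
qed


text \<open>The integral is Gamma at 3/2, that is, half of Gamma at 1/2.\<close>

lemma nn_integral_exponential_sqrt:
  "(\<integral>\<^sup>+t. ennreal (exponential_density 1 t) * ennreal (sqrt t) \<partial>lborel) = ennreal (sqrt pi / 2)"
proof -
  have "((\<lambda>t. t powr (3 / 2 - 1) / exp t) has_integral Gamma (3 / 2 :: real)) {0..}"
    by (rule Gamma_integral_real) simp
  moreover have "Gamma (3 / 2 :: real) = sqrt pi / 2"
    using Gamma_plus1[of "1 / 2 :: real"] Gamma_one_half_real nonpos_Ints_nonpos[of "1 / 2 :: real"] by fastforce
  ultimately have *: "((\<lambda>t. t powr (1 / 2) / exp t) has_integral (sqrt pi / 2)) {0..}"
    by simp
  have "(\<integral>\<^sup>+t. ennreal (exponential_density 1 t) * ennreal (sqrt t) \<partial>lborel) =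
      (\<integral>\<^sup>+t. ennreal (t powr (1 / 2) / exp t) * indicator {0..} t \<partial>lborel)"
    by (intro nn_integral_cong)
      (auto simp: exponential_density_def powr_half_sqrt exp_minus field_simps ennreal_mult'[symmetric]
        split: split_indicator)
  also have "\<dots> = ennreal (sqrt pi / 2)"
    by (rule nn_integral_has_integral_lebesgue'[OF _ *]) simp
  finally show ?thesis .
qed

lemma cnj_measurable [measurable]: "cnj \<in> borel_measurable borel"
  by (intro borel_measurable_continuous_onI continuous_on_cnj continuous_on_id)

text \<open>Dominates a variable by its square plus a constant, so that integrability of second
  moments yields integrability of first moments.\<close>

lemma le_one_plus_square: "y \<le> 1 + y\<^sup>2" for y :: real
proof -
  have "0 \<le> (y - 1 / 2)\<^sup>2" by simp
  then show ?thesis unfolding power2_diff by (simp add: power2_eq_square)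
qed

section \<open>Moments, tail and exponential moments of one complex Gaussian\<close>

context prob_space
begin

context
  fixes X :: "'a \<Rightarrow> complex"
  assumes X: "distributed M lborel X cn_density"
begin

lemma cn_measurable: "X \<in> borel_measurable M"
  using distributed_measurable[OF X] by simp

context
  notes [measurable] = cn_measurable
begin

lemma cn_square_integrable: "integrable M (\<lambda>w. (cmod (X w))\<^sup>2)"
  using erlang_ith_moment_integrable[OF _ distributed_cn_cmod_square[OF X], of 1] by simp

lemma cn_expectation_square: "expectation (\<lambda>w. (cmod (X w))\<^sup>2) = 1"
  using exponential_distributed_expectation[OF _ distributed_cn_cmod_square[OF X]] by simp

lemma cn_fourth_integrable: "integrable M (\<lambda>w. (cmod (X w)) ^ 4)"
  using erlang_ith_moment_integrable[OF _ distributed_cn_cmod_square[OF X], of 2]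
  by (simp flip: power_mult)

lemma cn_expectation_fourth: "expectation (\<lambda>w. (cmod (X w)) ^ 4) = 2"
  using erlang_ith_moment[OF _ distributed_cn_cmod_square[OF X], of 2]
  by (simp add: fact_2 flip: power_mult)

lemma cn_tail:
  assumes "0 \<le> t"
  shows "prob {w \<in> space M. t < (cmod (X w))\<^sup>2} = exp (- t)"
  using exponential_distributedD_gt[OF distributed_cn_cmod_square[OF X] assms] by simp

lemma cn_integrable: "integrable M X"
proof (rule Bochner_Integration.integrable_bound[of M "\<lambda>w. 1 + (cmod (X w))\<^sup>2"])
  show "AE w in M. norm (X w) \<le> norm (1 + (cmod (X w))\<^sup>2)"
  proof (rule AE_I2)
    fix w
    have "cmod (X w) \<le> 1 + (cmod (X w))\<^sup>2" by (rule le_one_plus_square)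
    then show "norm (X w) \<le> norm (1 + (cmod (X w))\<^sup>2)"
      by simp
  qed
qed (use cn_square_integrable in auto)

text \<open>The Rayleigh mean. The product of two independent such moduli has mean
  \<open>pi / 4\<close>, which is the source of the constant in the coherent signal.\<close>

lemma cn_expectation_cmod: "expectation (\<lambda>w. cmod (X w)) = sqrt pi / 2"
proof -
  have "(\<integral>\<^sup>+w. ennreal (sqrt ((cmod (X w))\<^sup>2)) \<partial>M) =
      (\<integral>\<^sup>+t. ennreal (exponential_density 1 t) * ennreal (sqrt t) \<partial>lborel)"
    by (rule distributed_nn_integral[OF distributed_cn_cmod_square[OF X], symmetric]) measurable
  then have "(\<integral>\<^sup>+w. ennreal (cmod (X w)) \<partial>M) = ennreal (sqrt pi / 2)"
    by (simp add: nn_integral_exponential_sqrt)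
  then show ?thesis
    by (intro integral_eq_nn_integral[THEN trans]) (auto simp: )
qed

text \<open>The density is even and Lebesgue measure is invariant under \<open>uminus\<close>, so
  every odd real function integrates to its own negative; this is applied to \<open>Re\<close> and
  \<open>Im\<close>.\<close>

lemma cn_expectation: "expectation X = 0"
proof -
  have zero: "expectation (\<lambda>w. g (X w)) = 0"
    if [measurable]: "g \<in> borel_measurable borel" and g: "\<And>z. g (- z) = - g z" for g :: "complex \<Rightarrow> real"
  proof -
    have reflect: "distr lborel borel uminus = (lborel :: complex measure)"
      by (subst lborel_affine[of "-1" 0]) (auto simp: density_1 one_ennreal_def[symmetric])
    have "expectation (\<lambda>w. g (X w)) = (\<integral>z. cn_density z * g z \<partial>lborel)"
      by (rule distributed_integral[OF X, symmetric]) (auto simp: cn_density_nonneg)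
    also have "\<dots> = (\<integral>z. cn_density z * g z \<partial>distr lborel borel uminus)"
      by (simp add: reflect)
    also have "\<dots> = (\<integral>z. cn_density (- z) * g (- z) \<partial>lborel)"
      by (rule integral_distr) auto
    also have "\<dots> = - (\<integral>z. cn_density z * g z \<partial>lborel)"
      by (simp add: g cn_density_def)
    also have "(\<integral>z. cn_density z * g z \<partial>lborel) = expectation (\<lambda>w. g (X w))"
      by (rule distributed_integral[OF X]) (auto simp: cn_density_nonneg)
    finally show ?thesis by simp
  qed
  have "Re (expectation X) = 0" "Im (expectation X) = 0"
    using zero[of Re] zero[of Im] cn_integrable by simp_all
  then show ?thesis by (simp add: complex_eq_iff)
qed

text \<open>Completing the square: translating Lebesgue measure by \<open>cnj a / 2\<close> absorbs
  the linear term into the Gaussian density and leaves a constant factor. The quarter is half the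
  variance of \<open>Re (a * X w)\<close>, which is half the squared modulus of
  \<open>a\<close>.\<close>

lemma cn_exp_linear:
  "integrable M (\<lambda>w. exp (Re (a * X w)))"
  "expectation (\<lambda>w. exp (Re (a * X w))) = exp ((cmod a)\<^sup>2 / 4)"
proof -
  have sq: "(cmod (z + cnj a / 2))\<^sup>2 = (cmod z)\<^sup>2 + Re (a * z) + (cmod a)\<^sup>2 / 4" for z
    unfolding cmod_power2 by (simp add: power2_eq_square field_simps)
  have "(\<integral>\<^sup>+w. ennreal (exp (Re (a * X w))) \<partial>M) =
      (\<integral>\<^sup>+z. ennreal (cn_density z) * ennreal (exp (Re (a * z))) \<partial>lborel)"
    by (rule distributed_nn_integral[OF X, symmetric]) measurable
  also have "\<dots> = (\<integral>\<^sup>+z. ennreal (cn_density z) * ennreal (exp (Re (a * z))) \<partial>distr lborel borel ((+) (cnj a / 2)))"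
    by (simp add: lborel_distr_plus)
  also have "\<dots> = (\<integral>\<^sup>+z. ennreal (exp ((cmod a)\<^sup>2 / 4)) * ennreal (cn_density z) \<partial>lborel)"
  proof (subst nn_integral_distr, simp, simp, rule nn_integral_cong)
    fix z
    have "Re (a * (cnj a / 2)) = (cmod a)\<^sup>2 / 2"
      unfolding cmod_power2 by (simp add: power2_eq_square field_simps)
    then have "- (cmod (cnj a / 2 + z))\<^sup>2 + Re (a * (cnj a / 2 + z)) = (cmod a)\<^sup>2 / 4 - (cmod z)\<^sup>2"
      using sq[of z] by (simp add: distrib_left add.commute)
    then show "ennreal (cn_density (cnj a / 2 + z)) * ennreal (exp (Re (a * (cnj a / 2 + z)))) =
        ennreal (exp ((cmod a)\<^sup>2 / 4)) * ennreal (cn_density z)"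
      by (simp add: cn_density_def ennreal_mult'[symmetric] exp_add[symmetric])
  qed
  also have "\<dots> = ennreal (exp ((cmod a)\<^sup>2 / 4)) * (\<integral>\<^sup>+z. ennreal (cn_density z) \<partial>lborel)"
    by (rule nn_integral_cmult) simp
  also have "(\<integral>\<^sup>+z. ennreal (cn_density z) \<partial>lborel) = 1"
    using distributed_nn_integral[OF X, of "\<lambda>_. 1"] by (simp add: emeasure_space_1)
  finally have *: "(\<integral>\<^sup>+w. ennreal (exp (Re (a * X w))) \<partial>M) = ennreal (exp ((cmod a)\<^sup>2 / 4))"
    by simp
  show "integrable M (\<lambda>w. exp (Re (a * X w)))"
    by (rule integrableI_nonneg) (auto simp: * simp del: times_complex.sel)
  show "expectation (\<lambda>w. exp (Re (a * X w))) = exp ((cmod a)\<^sup>2 / 4)"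
    by (subst integral_eq_nn_integral) (auto simp: * simp del: times_complex.sel)
qed

end

end

end

section \<open>Tail bounds\<close>

lemma (in prob_space) indep_vars_pair:
  assumes "indep_vars (\<lambda>_. N) g I" "i \<in> I" "j \<in> I" "i \<noteq> j"
  shows "indep_var N (g i) N (g j)"
proof -
  have "indep_var N ((\<lambda>u. u i) \<circ> (\<lambda>w. restrict (\<lambda>i. g i w) {i})) N ((\<lambda>u. u j) \<circ> (\<lambda>w. restrict (\<lambda>i. g i w) {j}))"
    using assms by (intro indep_var_compose[OF indep_var_restrict[OF assms(1)]]) auto
  then show ?thesis by (simp add: comp_def)
qed

context prob_space
begin

text \<open>Since \<open>exp (- y) \<le> 1 - y + y\<^sup>2 / 2\<close> for \<open>y \<ge> 0\<close>, no upper bound on the variables is required.\<close>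

lemma one_sided_lower_tail:
  fixes X :: "'i \<Rightarrow> 'a \<Rightarrow> real"
  assumes fin: "finite I" and ind: "indep_vars (\<lambda>_. borel) X I"
    and nonneg: "\<And>i w. i \<in> I \<Longrightarrow> 0 \<le> X i w"
    and int: "\<And>i. i \<in> I \<Longrightarrow> integrable M (\<lambda>w. (X i w)\<^sup>2)"
    and V: "(\<Sum>i\<in>I. expectation (\<lambda>w. (X i w)\<^sup>2)) \<le> V" "0 < V" and t: "0 < t"
  shows "prob {w \<in> space M. (\<Sum>i\<in>I. X i w) \<le> (\<Sum>i\<in>I. expectation (X i)) - t} \<le> exp (- t\<^sup>2 / (2 * V))"
proof -
  \<comment> \<open>This \<open>l\<close> minimizes the Chernoff exponent
    \<open>- l * t + l^2 / 2 * V\<close>.\<close>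
  define l where "l = t / V"
  have l: "0 < l" using V t by (simp add: l_def)
  have [measurable]: "X i \<in> borel_measurable M" if "i \<in> I" for i
    using ind that by (simp add: indep_vars_def)
  have int1: "integrable M (X i)" if "i \<in> I" for i
  proof (rule Bochner_Integration.integrable_bound[of M "\<lambda>w. 1 + (X i w)\<^sup>2"])
    show "AE w in M. norm (X i w) \<le> norm (1 + (X i w)\<^sup>2)"
    proof (rule AE_I2)
      fix w
      have "X i w \<le> 1 + (X i w)\<^sup>2" by (rule le_one_plus_square)
      then show "norm (X i w) \<le> norm (1 + (X i w)\<^sup>2)" using nonneg[OF that] by simp
    qed
  qed (use int that in auto)
  have exp_le: "exp (- y) \<le> 1 - y + y\<^sup>2 / 2" if "0 \<le> y" for y :: real
  proof -
    have "\<exists>s. \<bar>s\<bar> \<le> \<bar>- y\<bar> \<and> exp (- y) = (\<Sum>m<3. (- y) ^ m / fact m) + exp s / fact 3 * (- y) ^ 3"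
      by (rule Maclaurin_exp_le)
    then obtain s where "exp (- y) = (\<Sum>m<3. (- y) ^ m / fact m) + exp s / fact 3 * (- y) ^ 3" by blast
    then have "exp (- y) = 1 - y + y\<^sup>2 / 2 - exp s / 6 * y ^ 3"
      by (simp add: eval_nat_numeral)
    moreover have "0 \<le> exp s / 6 * y ^ 3" using that by simp
    ultimately show ?thesis by linarith
  qed
  have intexp: "integrable M (\<lambda>w. exp (- l * X i w))" if "i \<in> I" for i
    by (rule integrable_const_bound[of _ 1]) (use that l nonneg in \<open>auto intro!: AE_I2\<close>)
  have single: "expectation (\<lambda>w. exp (- l * X i w)) \<le>
      exp (- l * expectation (X i) + l\<^sup>2 / 2 * expectation (\<lambda>w. (X i w)\<^sup>2))" if "i \<in> I" for i
  proof -
    have "expectation (\<lambda>w. exp (- l * X i w)) \<le> expectation (\<lambda>w. 1 - l * X i w + l\<^sup>2 / 2 * (X i w)\<^sup>2)"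
      using exp_le[of "l * X i w" for w] nonneg[OF that] l that int1 int intexp
      by (intro integral_mono) (auto simp: power_mult_distrib)
    also have "\<dots> = 1 + (- l * expectation (X i) + l\<^sup>2 / 2 * expectation (\<lambda>w. (X i w)\<^sup>2))"
      using that int1 int by (simp add: prob_space)
    also have "\<dots> \<le> exp (- l * expectation (X i) + l\<^sup>2 / 2 * expectation (\<lambda>w. (X i w)\<^sup>2))"
      by (rule exp_ge_add_one_self)
    finally show ?thesis .
  qed
  let ?\<mu> = "\<Sum>i\<in>I. expectation (X i)"
  have ind': "indep_vars (\<lambda>_. borel) (\<lambda>i w. exp (- l * X i w)) I"
    using indep_vars_compose2[OF ind, of "\<lambda>i y. exp (- l * y)" "\<lambda>_. borel"] by simp
  have eq: "(\<lambda>w. exp (- l * (\<Sum>i\<in>I. X i w))) = (\<lambda>w. \<Prod>i\<in>I. exp (- l * X i w))"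
    using fin by (simp add: sum_distrib_left exp_sum sum_negf[symmetric])
  have int_prod: "integrable M (\<lambda>w. \<Prod>i\<in>I. exp (- l * X i w))"
    by (rule indep_vars_integrable[OF fin ind' intexp])
  have "prob {w \<in> space M. (\<Sum>i\<in>I. X i w) \<le> ?\<mu> - t} \<le>
      exp (l * (?\<mu> - t)) * (\<integral>w\<in>space M. exp (- l * (\<Sum>i\<in>I. X i w)) \<partial>M)"
    using int_prod eq by (intro Chernoff_ineq_le l) (simp_all add: set_integrable_def cong: Bochner_Integration.integrable_cong)
  also have "(\<integral>w\<in>space M. exp (- l * (\<Sum>i\<in>I. X i w)) \<partial>M) = (\<Prod>i\<in>I. expectation (\<lambda>w. exp (- l * X i w)))"
    by (simp only: eq set_integral_space[OF int_prod] indep_vars_lebesgue_integral[OF fin ind' intexp])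
  also have "\<dots> \<le> (\<Prod>i\<in>I. exp (- l * expectation (X i) + l\<^sup>2 / 2 * expectation (\<lambda>w. (X i w)\<^sup>2)))"
    by (intro prod_mono conjI single integral_nonneg) auto
  also have "\<dots> = exp (- l * ?\<mu> + l\<^sup>2 / 2 * (\<Sum>i\<in>I. expectation (\<lambda>w. (X i w)\<^sup>2)))"
    using fin by (simp add: exp_sum[symmetric] sum.distrib sum_subtractf sum_distrib_left sum_negf sum_divide_distrib)
  also have "\<dots> \<le> exp (- l * ?\<mu> + l\<^sup>2 / 2 * V)"
    using V by (simp add: mult_left_mono)
  also have "exp (l * (?\<mu> - t)) * exp (- l * ?\<mu> + l\<^sup>2 / 2 * V) = exp (- t\<^sup>2 / (2 * V))"
    using V unfolding exp_add[symmetric] l_def by (simp add: field_simps power2_eq_square)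
  finally show ?thesis by simp
qed

text \<open>Hoeffding's inequality is applied to the variables cut off at \<open>B\<close>. Cutting
  off only lowers the means, and on the event that all variables stay below \<open>B\<close> it does
  not change the sum.\<close>

lemma truncated_upper_tail:
  fixes X :: "'i \<Rightarrow> 'a \<Rightarrow> real"
  assumes fin: "finite I" and ne: "I \<noteq> {}" and ind: "indep_vars (\<lambda>_. borel) X I"
    and nonneg: "\<And>i w. i \<in> I \<Longrightarrow> 0 \<le> X i w"
    and int: "\<And>i. i \<in> I \<Longrightarrow> integrable M (X i)"
    and B: "0 < B" and t: "0 < t"
  shows "prob {w \<in> space M. (\<forall>i\<in>I. X i w \<le> B) \<and> (\<Sum>i\<in>I. expectation (X i)) + t \<le> (\<Sum>i\<in>I. X i w)}
    \<le> exp (- 2 * t\<^sup>2 / (real (card I) * B\<^sup>2))"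
proof -
  have [measurable]: "X i \<in> borel_measurable M" if "i \<in> I" for i
    using ind that by (simp add: indep_vars_def)
  have "indep_vars (\<lambda>_. borel) (\<lambda>i w. min (X i w) B) I"
    using indep_vars_compose2[OF ind, of "\<lambda>i y. min y B" "\<lambda>_. borel"] by simp
  then interpret Hoeffding_ineq M I "\<lambda>i w. min (X i w) B" "\<lambda>_. 0" "\<lambda>_. B" "\<Sum>i\<in>I. expectation (\<lambda>w. min (X i w) B)"
    using fin nonneg B by unfold_locales (auto intro!: AE_I2)
  have le: "(\<Sum>i\<in>I. expectation (\<lambda>w. min (X i w) B)) \<le> (\<Sum>i\<in>I. expectation (X i))"
    by (intro sum_mono integral_mono int Bochner_Integration.integrable_min) (use int in auto)
  have "prob {w \<in> space M. (\<forall>i\<in>I. X i w \<le> B) \<and> (\<Sum>i\<in>I. expectation (X i)) + t \<le> (\<Sum>i\<in>I. X i w)}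
      \<le> prob {w \<in> space M. (\<Sum>i\<in>I. expectation (\<lambda>w. min (X i w) B)) + t \<le> (\<Sum>i\<in>I. min (X i w) B)}"
    using le by (intro finite_measure_mono) (auto simp: min_absorb1 cong: sum.cong)
  also have "\<dots> \<le> exp (- 2 * t\<^sup>2 / (\<Sum>i\<in>I. (B - 0)\<^sup>2))"
    using fin ne B t by (intro Hoeffding_ineq_ge) (auto simp: card_gt_0_iff)
  finally show ?thesis by simp
qed


section \<open>Linear combinations of independent complex Gaussians\<close>

context
  fixes z :: "'i \<Rightarrow> 'a \<Rightarrow> complex" and J :: "'i set"
  assumes fin: "finite J" and ind: "indep_vars (\<lambda>_. borel) z J"
    and cn: "\<And>i. i \<in> J \<Longrightarrow> distributed M lborel (z i) cn_density"
begin

lemma cn_family_measurable: "i \<in> J \<Longrightarrow> z i \<in> borel_measurable M"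
  using cn cn_measurable by blast

context
  notes [measurable] = cn_family_measurable
begin

text \<open>By independence the exponential moments multiply, so the combination behaves like a
  single complex Gaussian whose variance is the sum of the squared moduli of the
  coefficients.\<close>

lemma cn_combination_exp:
  "integrable M (\<lambda>w. exp (Re (\<Sum>i\<in>J. a i * z i w)))" (is ?int)
  "expectation (\<lambda>w. exp (Re (\<Sum>i\<in>J. a i * z i w))) = exp ((\<Sum>i\<in>J. (cmod (a i))\<^sup>2) / 4)" (is ?eq)
proof -
  have eq: "(\<lambda>w. exp (Re (\<Sum>i\<in>J. a i * z i w))) = (\<lambda>w. \<Prod>i\<in>J. exp (Re (a i * z i w)))"
    using fin by (simp only: Re_sum exp_sum)
  have ind': "indep_vars (\<lambda>_. borel) (\<lambda>i w. exp (Re (a i * z i w))) J"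
    using indep_vars_compose2[OF ind, of "\<lambda>i y. exp (Re (a i * y))" "\<lambda>_. borel"] by simp
  note exp_single = cn_exp_linear[OF cn]
  show ?int
    unfolding eq by (rule indep_vars_integrable[OF fin ind' exp_single(1)])
  have "expectation (\<lambda>w. \<Prod>i\<in>J. exp (Re (a i * z i w))) = (\<Prod>i\<in>J. expectation (\<lambda>w. exp (Re (a i * z i w))))"
    by (rule indep_vars_lebesgue_integral[OF fin ind' exp_single(1)])
  also have "\<dots> = exp ((\<Sum>i\<in>J. (cmod (a i))\<^sup>2) / 4)"
    unfolding sum_divide_distrib exp_sum[OF fin] by (intro prod.cong refl exp_single(2))
  finally show ?eq unfolding eq .
qed

text \<open>Scaling the coefficients by \<open>s\<close> brings in the free Chernoff parameter.
  Working with an upper bound \<open>S\<close> instead of the exact variance keeps later divisions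
  by \<open>S\<close> meaningful even if all coefficients vanish.\<close>

lemma cn_combination_exp_le:
  assumes "(\<Sum>i\<in>J. (cmod (a i))\<^sup>2) \<le> S"
  shows "expectation (\<lambda>w. exp (s * Re (\<Sum>i\<in>J. a i * z i w))) \<le> exp (s\<^sup>2 * S / 4)"
    and "integrable M (\<lambda>w. exp (s * Re (\<Sum>i\<in>J. a i * z i w)))"
proof -
  have eq: "s * Re (\<Sum>i\<in>J. a i * z i w) = Re (\<Sum>i\<in>J. (of_real s * a i) * z i w)" for w
    by (simp add: sum_distrib_left mult.assoc right_diff_distrib)
  have "(\<Sum>i\<in>J. (cmod (of_real s * a i))\<^sup>2) = s\<^sup>2 * (\<Sum>i\<in>J. (cmod (a i))\<^sup>2)"
    by (simp add: norm_mult power_mult_distrib sum_distrib_left)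
  then show "expectation (\<lambda>w. exp (s * Re (\<Sum>i\<in>J. a i * z i w))) \<le> exp (s\<^sup>2 * S / 4)"
    unfolding eq cn_combination_exp using assms by (simp add: mult_left_mono)
  show "integrable M (\<lambda>w. exp (s * Re (\<Sum>i\<in>J. a i * z i w)))"
    unfolding eq by (rule cn_combination_exp)
qed

lemma cn_combination_Re_tail:
  assumes S: "(\<Sum>i\<in>J. (cmod (a i))\<^sup>2) \<le> S" "0 < S" and t: "0 < t"
  shows "prob {w \<in> space M. t \<le> Re (\<Sum>i\<in>J. a i * z i w)} \<le> exp (- t\<^sup>2 / S)"
proof -
  \<comment> \<open>This \<open>s\<close> minimizes \<open>- s * t + s^2 * S / 4\<close>.\<close>
  define s where "s = 2 * t / S"
  have s: "0 < s" using S t by (simp add: s_def)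
  note int = cn_combination_exp_le(2)[OF S(1), of s]
  have "prob {w \<in> space M. t \<le> Re (\<Sum>i\<in>J. a i * z i w)} \<le>
      exp (- s * t) * (\<integral>w\<in>space M. exp (s * Re (\<Sum>i\<in>J. a i * z i w)) \<partial>M)"
    using int by (intro Chernoff_ineq_ge s) (simp_all only: set_integrable_def, simp_all cong: Bochner_Integration.integrable_cong)
  also have "(\<integral>w\<in>space M. exp (s * Re (\<Sum>i\<in>J. a i * z i w)) \<partial>M) = expectation (\<lambda>w. exp (s * Re (\<Sum>i\<in>J. a i * z i w)))"
    by (rule set_integral_space[OF int])
  also have "\<dots> \<le> exp (s\<^sup>2 * S / 4)"
    by (rule cn_combination_exp_le(1)[OF S(1)])
  also have "exp (- s * t) * exp (s\<^sup>2 * S / 4) = exp (- t\<^sup>2 / S)"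
    using S unfolding exp_add[symmetric] s_def by (simp add: field_simps power2_eq_square)
  finally show ?thesis by simp
qed

text \<open>Multiplying all coefficients by a unit keeps their squared moduli. A one-sided bound for
  real parts therefore covers both signs of the real and the imaginary part.\<close>

lemma cn_combination_rotate:
  "Re (\<Sum>i\<in>J. (- a i) * z i w) = - Re (\<Sum>i\<in>J. a i * z i w)"
  "Re (\<Sum>i\<in>J. (- \<i> * a i) * z i w) = Im (\<Sum>i\<in>J. a i * z i w)"
  "Re (\<Sum>i\<in>J. (\<i> * a i) * z i w) = - Im (\<Sum>i\<in>J. a i * z i w)"
  by (simp_all add: sum_negf[symmetric] algebra_simps)

text \<open>A squared modulus above \<open>2 * y * S\<close> forces the real or the imaginary part
  to be at least \<open>sqrt (y * S)\<close> in absolute value. This gives four one-sided events,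
  each of probability at most \<open>exp (- y)\<close>.\<close>

lemma cn_combination_tail:
  assumes S: "(\<Sum>i\<in>J. (cmod (a i))\<^sup>2) \<le> S" "0 < S" and y: "0 < y"
  shows "prob {w \<in> space M. 2 * y * S < (cmod (\<Sum>i\<in>J. a i * z i w))\<^sup>2} \<le> 4 * exp (- y)"
proof -
  define t where "t = sqrt (y * S)"
  have t: "0 < t" "t\<^sup>2 = y * S" using S y by (simp_all add: t_def)
  let ?N = "\<lambda>w. \<Sum>i\<in>J. a i * z i w"
  define A where "A b = {w \<in> space M. t \<le> Re (\<Sum>i\<in>J. (b * a i) * z i w)}" for b
  have [measurable]: "A b \<in> events" for b unfolding A_def by measurable
  have A: "prob (A b) \<le> exp (- y)" if "cmod b = 1" for b
  proof -
    have "(\<Sum>i\<in>J. (cmod (b * a i))\<^sup>2) \<le> S"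
      using S that by (simp add: norm_mult)
    from cn_combination_Re_tail[OF this S(2) t(1)] show ?thesis
      using S unfolding A_def t(2) by simp
  qed
  have "{w \<in> space M. 2 * y * S < (cmod (?N w))\<^sup>2} \<subseteq> A 1 \<union> A (- 1) \<union> (A (- \<i>) \<union> A \<i>)"
  proof
    fix w assume w: "w \<in> {w \<in> space M. 2 * y * S < (cmod (?N w))\<^sup>2}"
    have "t \<le> \<bar>Re (?N w)\<bar> \<or> t \<le> \<bar>Im (?N w)\<bar>"
    proof (rule ccontr)
      assume "\<not> ?thesis"
      then have "\<bar>Re (?N w)\<bar>\<^sup>2 \<le> t\<^sup>2" "\<bar>Im (?N w)\<bar>\<^sup>2 \<le> t\<^sup>2"
        by (intro power_mono; simp)+
      then show False using w t unfolding cmod_power2 by (simp del: Re_sum Im_sum)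
    qed
    then show "w \<in> A 1 \<union> A (- 1) \<union> (A (- \<i>) \<union> A \<i>)"
      using w cn_combination_rotate[of a w] by (auto simp: A_def simp del: Re_sum Im_sum)
  qed
  then have "prob {w \<in> space M. 2 * y * S < (cmod (?N w))\<^sup>2} \<le> prob (A 1 \<union> A (- 1) \<union> (A (- \<i>) \<union> A \<i>))"
    by (intro finite_measure_mono) auto
  also have "\<dots> \<le> (prob (A 1) + prob (A (- 1))) + (prob (A (- \<i>)) + prob (A \<i>))"
    by (intro order_trans[OF measure_Un_le] add_mono measure_Un_le) auto
  also have "\<dots> \<le> 4 * exp (- y)"
    using A[of 1] A[of "- 1"] A[of "- \<i>"] A[of \<i>] by simp
  finally show ?thesis .
qed

text \<open>A fourth power is dominated by two exponentials whose expectations are known. The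
  constant is coarse, since later only the order of magnitude counts.\<close>

lemma cn_combination_Re_fourth:
  assumes S: "(\<Sum>i\<in>J. (cmod (a i))\<^sup>2) \<le> S" "0 < S"
  shows "integrable M (\<lambda>w. Re (\<Sum>i\<in>J. a i * z i w) ^ 4)"
    and "expectation (\<lambda>w. Re (\<Sum>i\<in>J. a i * z i w) ^ 4) \<le> 96 * S\<^sup>2"
proof -
  let ?R = "\<lambda>w. Re (\<Sum>i\<in>J. a i * z i w)"
  \<comment> \<open>With this normalization each of the two exponential moments is at most
    \<open>exp 1\<close>, hence at most 3; the final 96 is 16 times (3 + 3).\<close>
  define s where "s = 2 / sqrt S"
  have s: "0 < s" "s\<^sup>2 * S = 4" "s ^ 4 = 16 / S\<^sup>2"
    using S by (simp_all add: s_def power_divide, simp add: eval_nat_numeral)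
  have bound: "y ^ 4 \<le> 256 * (exp y + exp (- y))" for y :: real
  proof -
    have "(\<bar>y\<bar> / 4) ^ 4 \<le> (1 + \<bar>y\<bar> / 4) ^ 4"
      by (rule power_mono) auto
    also have "\<dots> \<le> exp \<bar>y\<bar>"
      using exp_ge_one_plus_x_over_n_power_n[of 4 "\<bar>y\<bar>"] by simp
    also have "\<dots> \<le> exp y + exp (- y)"
      by (cases "0 \<le> y") auto
    finally show ?thesis by (simp add: power_divide power_even_abs)
  qed
  have pw: "?R w ^ 4 \<le> 16 * S\<^sup>2 * (exp (s * ?R w) + exp (- s * ?R w))" for w
    using bound[of "s * ?R w"] S unfolding power_mult_distrib s(3)
    by (simp add: field_simps del: Re_sum)
  note e = cn_combination_exp_le[OF S(1), of s] cn_combination_exp_le[OF S(1), of "- s"]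
  have intb: "integrable M (\<lambda>w. 16 * S\<^sup>2 * (exp (s * ?R w) + exp (- s * ?R w)))"
    by (intro integrable_mult_right Bochner_Integration.integrable_add e)
  show int: "integrable M (\<lambda>w. ?R w ^ 4)"
    by (rule Bochner_Integration.integrable_bound[OF intb]) (use pw in \<open>auto intro!: AE_I2 simp del: Re_sum simp: abs_of_nonneg\<close>)
  have "expectation (\<lambda>w. ?R w ^ 4) \<le> expectation (\<lambda>w. 16 * S\<^sup>2 * (exp (s * ?R w) + exp (- s * ?R w)))"
    by (intro integral_mono int intb pw)
  also have "\<dots> = 16 * S\<^sup>2 * (expectation (\<lambda>w. exp (s * ?R w)) + expectation (\<lambda>w. exp (- s * ?R w)))"
    using e by (simp only: Bochner_Integration.integral_add integral_mult_right_zero)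
  also have "\<dots> \<le> 16 * S\<^sup>2 * (3 + 3)"
    using e(1) e(3) s(2) exp_le by (intro mult_left_mono add_mono) (auto simp del: Re_sum intro: order_trans)
  finally show "expectation (\<lambda>w. ?R w ^ 4) \<le> 96 * S\<^sup>2" by simp
qed

lemma power4_add_le: "(x + y) ^ 4 \<le> 8 * (x ^ 4 + y ^ 4)" for x y :: real
proof -
  have sq: "(u + v)\<^sup>2 \<le> 2 * (u\<^sup>2 + v\<^sup>2)" for u v :: real
    using zero_le_power2[of "u - v"] unfolding power2_diff power2_sum by simp
  have "(x + y) ^ 4 = ((x + y)\<^sup>2)\<^sup>2" by (simp flip: power_mult)
  also have "\<dots> \<le> (2 * (x\<^sup>2 + y\<^sup>2))\<^sup>2" by (intro power_mono sq) simp
  also have "\<dots> = 4 * (x\<^sup>2 + y\<^sup>2)\<^sup>2" by (simp only: power_mult_distrib) simp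
  also have "\<dots> \<le> 4 * (2 * ((x\<^sup>2)\<^sup>2 + (y\<^sup>2)\<^sup>2))" using sq[of "x\<^sup>2" "y\<^sup>2"] by simp
  finally show ?thesis by (simp flip: power_mult)
qed

lemma cn_combination_fourth:
  assumes S: "(\<Sum>i\<in>J. (cmod (a i))\<^sup>2) \<le> S" "0 < S"
  shows "integrable M (\<lambda>w. cmod (c + (\<Sum>i\<in>J. a i * z i w)) ^ 4)"
    and "expectation (\<lambda>w. cmod (c + (\<Sum>i\<in>J. a i * z i w)) ^ 4) \<le> 8 * (cmod c ^ 4 + 384 * S\<^sup>2)"
proof -
  let ?N = "\<lambda>w. \<Sum>i\<in>J. a i * z i w"
  have S': "(\<Sum>i\<in>J. (cmod (- \<i> * a i))\<^sup>2) \<le> S"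
    using S by (simp add: norm_mult)
  have pw: "cmod (c + ?N w) ^ 4 \<le> 8 * (cmod c ^ 4 + 2 * (Re (?N w) ^ 4 + Im (?N w) ^ 4))" for w
  proof -
    have "cmod (?N w) ^ 4 = ((cmod (?N w))\<^sup>2)\<^sup>2" by (simp flip: power_mult)
    also have "\<dots> = ((Re (?N w))\<^sup>2 + (Im (?N w))\<^sup>2)\<^sup>2" by (simp only: cmod_power2)
    also have "\<dots> \<le> 2 * (((Re (?N w))\<^sup>2)\<^sup>2 + ((Im (?N w))\<^sup>2)\<^sup>2)"
      using zero_le_power2[of "(Re (?N w))\<^sup>2 - (Im (?N w))\<^sup>2"] unfolding power2_diff power2_sum by (simp del: Re_sum Im_sum)
    finally have *: "cmod (?N w) ^ 4 \<le> 2 * (Re (?N w) ^ 4 + Im (?N w) ^ 4)"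
      by (simp flip: power_mult)
    have "cmod (c + ?N w) ^ 4 \<le> (cmod c + cmod (?N w)) ^ 4"
      by (intro power_mono norm_triangle_ineq) simp
    also have "\<dots> \<le> 8 * (cmod c ^ 4 + cmod (?N w) ^ 4)"
      by (rule power4_add_le)
    finally show ?thesis using * by simp
  qed
  note R = cn_combination_Re_fourth[OF S] cn_combination_Re_fourth[OF S' S(2), unfolded cn_combination_rotate]
  have intb: "integrable M (\<lambda>w. 8 * (cmod c ^ 4 + 2 * (Re (?N w) ^ 4 + Im (?N w) ^ 4)))"
    by (intro integrable_mult_right Bochner_Integration.integrable_add R integrable_const)
  show int: "integrable M (\<lambda>w. cmod (c + ?N w) ^ 4)"
    by (rule Bochner_Integration.integrable_bound[OF intb])
      (use pw in \<open>auto intro!: AE_I2 order_trans[OF pw] simp del: Re_sum Im_sum simp: \<close>)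
  have "expectation (\<lambda>w. cmod (c + ?N w) ^ 4) \<le>
      expectation (\<lambda>w. 8 * (cmod c ^ 4 + 2 * (Re (?N w) ^ 4 + Im (?N w) ^ 4)))"
    by (intro integral_mono int intb pw)
  also have "\<dots> = 8 * (cmod c ^ 4 + 2 * (expectation (\<lambda>w. Re (?N w) ^ 4) + expectation (\<lambda>w. Im (?N w) ^ 4)))"
    using R(1,3) by (simp add: prob_space del: Re_sum Im_sum)
  also have "\<dots> \<le> 8 * (cmod c ^ 4 + 384 * S\<^sup>2)"
    using R(2,4) by simp
  finally show "expectation (\<lambda>w. cmod (c + ?N w) ^ 4) \<le> 8 * (cmod c ^ 4 + 384 * S\<^sup>2)" .
qed

text \<open>Independence and centring make the family orthonormal in mean square.\<close>

lemma cn_cross_expectation: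
  assumes "i \<in> J" "j \<in> J"
  shows "integrable M (\<lambda>w. z i w * cnj (z j w))"
    and "expectation (\<lambda>w. z i w * cnj (z j w)) = (if i = j then 1 else 0)"
proof -
  have "integrable M (\<lambda>w. z i w * cnj (z j w)) \<and> expectation (\<lambda>w. z i w * cnj (z j w)) = (if i = j then 1 else 0)"
  proof (cases "i = j")
    case True
    have "integrable M (\<lambda>w. complex_of_real ((cmod (z j w))\<^sup>2))"
      using cn_square_integrable[OF cn[OF assms(2)]] by (rule integrable_of_real)
    moreover have "expectation (\<lambda>w. complex_of_real ((cmod (z j w))\<^sup>2)) = 1"
      using cn_expectation_square[OF cn[OF assms(2)]] by (simp only: integral_complex_of_real) simp
    ultimately show ?thesis
      using True by (simp only: complex_norm_square) simp
  next
    case False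
    have "indep_var borel (z i) borel (z j)"
      using indep_vars_pair[OF ind] assms False .
    then have *: "indep_var borel (z i) borel (\<lambda>w. cnj (z j w))"
      using indep_var_compose[of borel "z i" borel "z j" "\<lambda>x. x" borel cnj borel] by (simp add: comp_def)
    have c: "integrable M (\<lambda>w. cnj (z j w))"
      using cn_integrable[OF cn[OF assms(2)]] by simp
    show ?thesis
      using indep_var_integrable[OF * cn_integrable[OF cn[OF assms(1)]] c] False
        indep_var_lebesgue_integral[OF * cn_integrable[OF cn[OF assms(1)]] c]
        cn_expectation[OF cn[OF assms(1)]] by simp
  qed
  then show "integrable M (\<lambda>w. z i w * cnj (z j w))"
    and "expectation (\<lambda>w. z i w * cnj (z j w)) = (if i = j then 1 else 0)" by auto
qed

text \<open>Expand the squared modulus: the part linear in the Gaussians has mean zero, and in the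
  double sum orthonormality keeps only the diagonal. An exact value is required here because it
  serves as the conditional mean of the interference.\<close>

lemma cn_combination_second:
  shows "integrable M (\<lambda>w. (cmod (c + (\<Sum>i\<in>J. a i * z i w)))\<^sup>2)"
    and "expectation (\<lambda>w. (cmod (c + (\<Sum>i\<in>J. a i * z i w)))\<^sup>2) = (cmod c)\<^sup>2 + (\<Sum>i\<in>J. (cmod (a i))\<^sup>2)"
proof -
  let ?N = "\<lambda>w. \<Sum>i\<in>J. a i * z i w"
  have expand: "(cmod (c + ?N w))\<^sup>2 = (cmod c)\<^sup>2 + 2 * Re (\<Sum>i\<in>J. cnj c * a i * z i w) +
      Re (\<Sum>i\<in>J. \<Sum>j\<in>J. a i * cnj (a j) * (z i w * cnj (z j w)))" for w
  proof -
    have "(cmod (c + ?N w))\<^sup>2 = (cmod c)\<^sup>2 + 2 * Re (cnj c * ?N w) + (cmod (?N w))\<^sup>2"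
      unfolding cmod_power2 by (simp add: power2_eq_square algebra_simps del: Re_sum Im_sum)
    also have "(cmod (?N w))\<^sup>2 = Re (?N w * cnj (?N w))"
      by (simp flip: complex_norm_square del: cnj_sum)
    also have "?N w * cnj (?N w) = (\<Sum>i\<in>J. \<Sum>j\<in>J. a i * cnj (a j) * (z i w * cnj (z j w)))"
      by (simp add: sum_product ac_simps)
    also have "cnj c * ?N w = (\<Sum>i\<in>J. cnj c * a i * z i w)"
      by (simp add: sum_distrib_left mult.assoc)
    finally show ?thesis .
  qed
  have i1: "integrable M (\<lambda>w. \<Sum>i\<in>J. cnj c * a i * z i w)"
    using cn_integrable[OF cn] by (intro Bochner_Integration.integrable_sum integrable_mult_right) auto
  have i2: "integrable M (\<lambda>w. \<Sum>i\<in>J. \<Sum>j\<in>J. a i * cnj (a j) * (z i w * cnj (z j w)))"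
    using cn_cross_expectation(1) by (intro Bochner_Integration.integrable_sum integrable_mult_right) auto
  have e1: "expectation (\<lambda>w. \<Sum>i\<in>J. cnj c * a i * z i w) = 0"
    using cn_integrable[OF cn] cn_expectation[OF cn]
    by (subst Bochner_Integration.integral_sum) auto
  have "expectation (\<lambda>w. \<Sum>i\<in>J. \<Sum>j\<in>J. a i * cnj (a j) * (z i w * cnj (z j w))) =
      (\<Sum>i\<in>J. \<Sum>j\<in>J. a i * cnj (a j) * expectation (\<lambda>w. z i w * cnj (z j w)))"
    using cn_cross_expectation(1) by (simp add: Bochner_Integration.integral_sum)
  also have "\<dots> = (\<Sum>i\<in>J. a i * cnj (a i))"
    using fin by (simp add: cn_cross_expectation(2) if_distrib[of "\<lambda>y. _ * y"] cong: if_cong)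
  also have "\<dots> = of_real (\<Sum>i\<in>J. (cmod (a i))\<^sup>2)"
    by (simp only: of_real_sum complex_norm_square)
  finally have e2: "Re (expectation (\<lambda>w. \<Sum>i\<in>J. \<Sum>j\<in>J. a i * cnj (a j) * (z i w * cnj (z j w)))) =
      (\<Sum>i\<in>J. (cmod (a i))\<^sup>2)"
    by (simp only: Re_complex_of_real)
  have I: "integrable M (\<lambda>w. 2 * Re (\<Sum>i\<in>J. cnj c * a i * z i w))"
    "integrable M (\<lambda>w. Re (\<Sum>i\<in>J. \<Sum>j\<in>J. a i * cnj (a j) * (z i w * cnj (z j w))))"
    by (intro integrable_mult_right integrable_Re i1 i2)+
  show "integrable M (\<lambda>w. (cmod (c + ?N w))\<^sup>2)"
    unfolding expand by (intro Bochner_Integration.integrable_add integrable_const I)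
  have "expectation (\<lambda>w. (cmod (c + ?N w))\<^sup>2) = (cmod c)\<^sup>2 + 2 * Re (expectation (\<lambda>w. \<Sum>i\<in>J. cnj c * a i * z i w)) +
      Re (expectation (\<lambda>w. \<Sum>i\<in>J. \<Sum>j\<in>J. a i * cnj (a j) * (z i w * cnj (z j w))))"
    unfolding expand integral_Re[OF i1, symmetric] integral_Re[OF i2, symmetric] using I
    by (simp add: prob_space del: Re_sum)
  then show "expectation (\<lambda>w. (cmod (c + ?N w))\<^sup>2) = (cmod c)\<^sup>2 + (\<Sum>i\<in>J. (cmod (a i))\<^sup>2)"
    by (simp only: e1 e2) simp
qed

end

end

end

section \<open>Conditioning on part of an independent family\<close>

text \<open>Conditioning by Fubini. The joint law of the coordinates inside and outside
  \<open>L\<close> is a product measure, so a bound valid for every frozen choice \<open>u\<close>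
  of the outer coordinates, with only those in \<open>L\<close> random, integrates to the same
  bound.\<close>

lemma (in prob_space) indep_vars_section_bound:
  fixes g :: "'i \<Rightarrow> 'a \<Rightarrow> 'b::topological_space"
  assumes ind: "indep_vars (\<lambda>_. borel) g I" and L: "L \<subseteq> I"
    and meas: "Measurable.pred (PiM I (\<lambda>_. borel)) Q"
    and local: "\<And>u v. (\<And>i. i \<in> I \<Longrightarrow> u i = v i) \<Longrightarrow> Q u = Q v"
    and section_le: "\<And>u. prob {w \<in> space M. Q (\<lambda>i. if i \<in> L then g i w else u i)} \<le> \<epsilon>"
  shows "prob {w \<in> space M. Q (\<lambda>i. g i w)} \<le> \<epsilon>"
proof -
  let ?J = "I - L"
  let ?X = "\<lambda>w. restrict (\<lambda>i. g i w) ?J" and ?Y = "\<lambda>w. restrict (\<lambda>i. g i w) L"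
  let ?S = "PiM ?J (\<lambda>_. borel :: 'b measure)" and ?T = "PiM L (\<lambda>_. borel :: 'b measure)"
  have "indep_var ?S ?X ?T ?Y"
    using L by (intro indep_var_restrict[OF ind]) auto
  then have [measurable]: "?X \<in> measurable M ?S" "?Y \<in> measurable M ?T"
    and prod: "distr M ?S ?X \<Otimes>\<^sub>M distr M ?T ?Y = distr M (?S \<Otimes>\<^sub>M ?T) (\<lambda>w. (?X w, ?Y w))"
    unfolding indep_var_distribution_eq by auto
  interpret Y: prob_space "distr M ?T ?Y" by (rule prob_space_distr) measurable
  interpret X: prob_space "distr M ?S ?X" by (rule prob_space_distr) measurable
  define A where "A = {x \<in> space (?S \<Otimes>\<^sub>M ?T). Q (merge ?J L x)}"
  have "merge ?J L \<in> measurable (?S \<Otimes>\<^sub>M ?T) (PiM (?J \<union> L) (\<lambda>_. borel))"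
    by (rule measurable_merge)
  moreover have "?J \<union> L = I" using L by auto
  ultimately have [measurable]: "merge ?J L \<in> measurable (?S \<Otimes>\<^sub>M ?T) (PiM I (\<lambda>_. borel))"
    by simp
  have A: "A \<in> sets (?S \<Otimes>\<^sub>M ?T)"
    using meas unfolding A_def by measurable
  \<comment> \<open>\<open>merge\<close> is \<open>undefined\<close> outside \<open>I\<close>,
    whereas \<open>u\<close> is arbitrary there; the locality of \<open>Q\<close> makes the two
    agree.\<close>
  have Q_merge: "Q (merge ?J L (u, \<lambda>i. g i w)) = Q (\<lambda>i. if i \<in> L then g i w else u i)" for u w
    by (rule local) (auto simp: merge_def)
  have sect: "emeasure (distr M ?T ?Y) (Pair u -` A) \<le> ennreal \<epsilon>" if u: "u \<in> space ?S" for u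
  proof -
    have "emeasure (distr M ?T ?Y) (Pair u -` A) = emeasure M (?Y -` (Pair u -` A) \<inter> space M)"
      using A u by (intro emeasure_distr) (auto intro: sets_Pair1)
    also have "?Y -` (Pair u -` A) \<inter> space M = {w \<in> space M. Q (\<lambda>i. if i \<in> L then g i w else u i)}"
      using u measurable_space[OF \<open>?Y \<in> measurable M ?T\<close>]
      by (auto simp: A_def space_pair_measure Q_merge)
    also have "emeasure M \<dots> \<le> ennreal \<epsilon>"
      using section_le[of u] by (simp add: emeasure_eq_measure ennreal_leI)
    finally show ?thesis .
  qed
  have pos: "0 \<le> \<epsilon>" using section_le measure_nonneg order_trans by blast
  have "{w \<in> space M. Q (\<lambda>i. g i w)} = (\<lambda>w. (?X w, ?Y w)) -` A \<inter> space M"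
  proof -
    have "Q (merge ?J L (?X w, ?Y w)) = Q (\<lambda>i. g i w)" for w
      by (rule local) (auto simp: merge_def)
    then show ?thesis
      using measurable_space[OF \<open>?Y \<in> measurable M ?T\<close>] measurable_space[OF \<open>?X \<in> measurable M ?S\<close>]
      by (auto simp: A_def space_pair_measure)
  qed
  then have "emeasure M {w \<in> space M. Q (\<lambda>i. g i w)} = emeasure (distr M (?S \<Otimes>\<^sub>M ?T) (\<lambda>w. (?X w, ?Y w))) A"
    using A by (subst emeasure_distr) auto
  also have "\<dots> = (\<integral>\<^sup>+u. emeasure (distr M ?T ?Y) (Pair u -` A) \<partial>distr M ?S ?X)"
    unfolding prod[symmetric] using A by (intro Y.emeasure_pair_measure_alt) (simp cong: sets_pair_measure_cong)
  also have "\<dots> \<le> (\<integral>\<^sup>+u. ennreal \<epsilon> \<partial>distr M ?S ?X)"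
    using sect by (intro nn_integral_mono) simp
  also have "\<dots> = ennreal \<epsilon>"
    using X.emeasure_space_1 by simp
  finally show ?thesis
    using pos by (simp add: emeasure_eq_measure)
qed

text \<open>Functions of disjoint blocks of an independent family are independent. Each
  \<open>G j\<close> takes a full assignment and is required to look only at its block, so the
  conclusion is free of \<open>restrict\<close>.\<close>

lemma (in prob_space) indep_vars_regroup:
  fixes g :: "'i \<Rightarrow> 'a \<Rightarrow> 'b::topological_space" and G :: "'j \<Rightarrow> ('i \<Rightarrow> 'b) \<Rightarrow> 'c::topological_space"
  assumes ind: "indep_vars (\<lambda>_. borel) g I" and B: "\<And>j. j \<in> N \<Longrightarrow> B j \<subseteq> I" and disj: "disjoint_family_on B N"
    and G: "\<And>j. j \<in> N \<Longrightarrow> G j \<in> borel_measurable (PiM (B j) (\<lambda>_. borel))"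
    and local: "\<And>j u v. j \<in> N \<Longrightarrow> (\<And>i. i \<in> B j \<Longrightarrow> u i = v i) \<Longrightarrow> G j u = G j v"
  shows "indep_vars (\<lambda>_. borel) (\<lambda>j w. G j (\<lambda>i. g i w)) N"
proof -
  have "indep_vars (\<lambda>_. borel) (\<lambda>j w. G j (restrict (\<lambda>i. g i w) (B j))) N"
    by (rule indep_vars_compose2[OF indep_vars_restrict[OF ind B disj]]) (use G in auto)
  then show ?thesis
    by (rule indep_vars_cong[THEN iffD1, rotated 3]) (auto intro!: ext local)
qed

lemma (in prob_space) indep_vars_reindex:
  assumes ind: "indep_vars (\<lambda>_. N) g (s ` I)" and inj: "inj_on s I"
  shows "indep_vars (\<lambda>_. N) (\<lambda>i. g (s i)) I"
proof -
  have rv: "\<forall>i\<in>I. random_variable N (g (s i))"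
    using ind by (auto simp: indep_vars_def2)
  have sets: "indep_sets (\<lambda>j. {g j -` A \<inter> space M |A. A \<in> sets N}) (s ` I)"
    using ind by (auto simp: indep_vars_def2)
  have "indep_sets (\<lambda>i. {g (s i) -` A \<inter> space M |A. A \<in> sets N}) I"
  proof (rule indep_setsI)
    show "{g (s i) -` A \<inter> space M |A. A \<in> sets N} \<subseteq> events" if "i \<in> I" for i
      using rv that by auto
    fix A J assume J: "J \<noteq> {}" "J \<subseteq> I" "finite J" "\<forall>j\<in>J. A j \<in> {g (s j) -` A \<inter> space M |A. A \<in> sets N}"
    have injJ: "inj_on s J" using inj J(2) by (rule inj_on_subset)
    let ?A = "\<lambda>k. A (the_inv_into J s k)"
    have "prob (\<Inter>k\<in>s ` J. ?A k) = (\<Prod>k\<in>s ` J. prob (?A k))"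
      using J by (intro indep_setsD[OF sets]) (auto simp: the_inv_into_f_f[OF injJ])
    then show "prob (\<Inter>j\<in>J. A j) = (\<Prod>j\<in>J. prob (A j))"
      by (simp add: prod.reindex[OF injJ] the_inv_into_f_f[OF injJ] cong: INF_cong_simp prod.cong)
  qed
  then show ?thesis using rv by (simp add: indep_vars_def2)
qed

section \<open>The relay network\<close>

type_synonym assignment = "(nat \<times> nat) + (nat \<times> nat) \<Rightarrow> complex"

text \<open>The value 1 at zero comes from \<open>Arg 0 = 0\<close>; it makes the phase unimodular
  everywhere, without exceptional null sets.\<close>

lemma phase_eq: "phase z = (if z = 0 then 1 else sgn z)"
  by (simp add: phase_def cis_conv_exp[symmetric] cis_Arg Arg_zero)

lemma phase_measurable [measurable]: "phase \<in> borel_measurable borel"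
  unfolding phase_eq[abs_def] sgn_div_norm[abs_def] by measurable

lemma cmod_phase [simp]: "cmod (phase z) = 1"
  by (simp add: phase_def)

text \<open>The reason for coherent addition: after phase correction each relay serving the
  destination contributes a nonnegative real number.\<close>

lemma cnj_phase_mult: "cnj (phase z) * z = complex_of_real (cmod z)"
proof (cases "z = 0")
  case False
  then have "cnj (phase z) * z = (z * cnj z) / of_real (cmod z)"
    by (simp add: phase_eq sgn_div_norm scaleR_conv_of_real divide_inverse mult.commute)
  also have "\<dots> = of_real (cmod z)"
    using False by (simp add: complex_norm_square[symmetric] power2_eq_square)
  finally show ?thesis .
qed (simp add: phase_eq)

text \<open>With deviation \<open>sqrt n * T^2\<close> and truncation at \<open>T\<close>, the
  Hoeffding exponent is at least 2 times the square of \<open>T\<close>. For the lower tail the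
  second moments sum to at most \<open>2 * n\<close>, which gives the exponent
  \<open>T ^ 4 / 4\<close>. Both exceed \<open>T\<close> because \<open>T\<close> is at least 4.
  Since \<open>n\<close> only has to dominate the number of terms, a sum over one group may use the
  total number of relays.\<close>

lemma (in prob_space) sum_concentration:
  fixes X :: "'i \<Rightarrow> 'a \<Rightarrow> real"
  assumes fin: "finite I" and ne: "I \<noteq> {}" and card: "real (card I) \<le> n"
    and ind: "indep_vars (\<lambda>_. borel) X I" and nonneg: "\<And>i w. i \<in> I \<Longrightarrow> 0 \<le> X i w"
    and int: "\<And>i. i \<in> I \<Longrightarrow> integrable M (X i)"
    and int2: "\<And>i. i \<in> I \<Longrightarrow> integrable M (\<lambda>w. (X i w)\<^sup>2)"
    and second: "\<And>i. i \<in> I \<Longrightarrow> expectation (\<lambda>w. (X i w)\<^sup>2) \<le> 2"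
    and T: "4 \<le> T"
  shows "prob {w \<in> space M. (\<forall>i\<in>I. X i w \<le> T) \<and> (\<Sum>i\<in>I. expectation (X i)) + sqrt n * T\<^sup>2 \<le> (\<Sum>i\<in>I. X i w)} \<le> exp (- T)"
    and "prob {w \<in> space M. (\<Sum>i\<in>I. X i w) \<le> (\<Sum>i\<in>I. expectation (X i)) - sqrt n * T\<^sup>2} \<le> exp (- T)"
proof -
  have c: "0 < real (card I)" using fin ne by (simp add: card_gt_0_iff)
  then have n: "0 < n" using card by linarith
  have t: "0 < sqrt n * T\<^sup>2" using n T by simp
  have t2: "(sqrt n * T\<^sup>2)\<^sup>2 = n * T ^ 4"
    using n by (simp add: power_mult_distrib flip: power_mult)
  have "real (card I) * T ^ 3 \<le> n * T ^ 3"
    using card T by (intro mult_right_mono) auto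
  moreover have "n * T ^ 3 \<le> n * T ^ 4" "0 \<le> n * T ^ 4"
    using n T by (auto intro!: mult_left_mono power_increasing)
  ultimately have "real (card I) * T ^ 3 \<le> 2 * (n * T ^ 4)"
    by linarith
  then have "T \<le> 2 * (n * T ^ 4) / (real (card I) * T\<^sup>2)"
    using c T by (simp add: field_simps eval_nat_numeral)
  then show "prob {w \<in> space M. (\<forall>i\<in>I. X i w \<le> T) \<and> (\<Sum>i\<in>I. expectation (X i)) + sqrt n * T\<^sup>2 \<le> (\<Sum>i\<in>I. X i w)} \<le> exp (- T)"
    using T by (intro order_trans[OF truncated_upper_tail[OF fin ne ind nonneg int _ t]]) (auto simp: t2)
  have "4 \<le> T ^ 3" using T power_mono[of 4 T 3] by simp
  then have "4 * T \<le> T ^ 3 * T" using T by (intro mult_right_mono) auto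
  then have "T \<le> T ^ 4 / 4" by (simp add: eval_nat_numeral mult_ac)
  then have "T \<le> n * T ^ 4 / (2 * (2 * n))"
    using n by simp
  moreover have "(\<Sum>i\<in>I. expectation (\<lambda>w. (X i w)\<^sup>2)) \<le> 2 * n"
    using sum_mono[of I "\<lambda>i. expectation (\<lambda>w. (X i w)\<^sup>2)" "\<lambda>_. 2"] second card by simp
  ultimately show "prob {w \<in> space M. (\<Sum>i\<in>I. X i w) \<le> (\<Sum>i\<in>I. expectation (X i)) - sqrt n * T\<^sup>2} \<le> exp (- T)"
    using n by (intro order_trans[OF one_sided_lower_tail[where V = "2 * n", OF fin ind nonneg int2 _ _ t]]) (auto simp: t2)
qed

text \<open>The destination \<open>m\<close> is fixed; \<open>C m' k\<close> stands for \<open>C_P1 K M Prel \<sigma> E P m m' k\<close> and \<open>Cb\<close> for its upper bound.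
  \<open>T\<close> is the level at which squared moduli are truncated.\<close>

locale relay_gains = prob_space W for W :: "'w measure" +
  fixes g :: "(nat \<times> nat) + (nat \<times> nat) \<Rightarrow> 'w \<Rightarrow> complex" and K M m :: nat and p :: "nat \<Rightarrow> nat"
    and C :: "nat \<Rightarrow> nat \<Rightarrow> real" and Cb T x :: real
  assumes K: "0 < K" and M: "2 \<le> M" and m: "m \<in> {1..M}"
    and p: "\<And>k. k \<in> {1..K} \<Longrightarrow> p k \<in> {1..M}"
    and group_card: "\<And>m'. m' \<in> {1..M} \<Longrightarrow> real (card {k \<in> {1..K}. p k = m'}) = real K / real M"
    and indep: "indep_vars (\<lambda>_. borel) g (gain_index K M)"
    and cn: "\<And>i. i \<in> gain_index K M \<Longrightarrow> distributed W lborel (g i) cn_density"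
    and C: "\<And>m' k. m' \<in> {1..M} \<Longrightarrow> k \<in> {1..K} \<Longrightarrow> 0 \<le> C m' k \<and> C m' k \<le> Cb"
    and Cb: "0 < Cb" and T: "7 \<le> T" and x: "0 < x" "200 * Cb ^ 4 * T ^ 5 \<le> x\<^sup>2"
begin

text \<open>The factor shared by the coefficients \<open>a_P1\<close> of all sources: the forward
  gain to \<open>m\<close> times unimodular phase corrections. The constant \<open>C\<close> and the
  backward gain are split off.\<close>

definition rotated :: "assignment \<Rightarrow> nat \<Rightarrow> complex" where
  "rotated u k = cnj (phase (u (Inr (p k, k)))) * u (Inr (m, k)) * cnj (phase (u (Inl (k, p k))))"

definition aligned :: "assignment \<Rightarrow> nat \<Rightarrow> complex" where
  "aligned u m' = (\<Sum>k | k \<in> {1..K} \<and> p k = m'. of_real (C m' k) * rotated u k * u (Inl (k, m')))"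

definition scattered :: "assignment \<Rightarrow> nat \<Rightarrow> complex" where
  "scattered u m' = (\<Sum>k | k \<in> {1..K} \<and> p k \<noteq> m'. of_real (C m' k) * rotated u k * u (Inl (k, m')))"

definition spread :: "assignment \<Rightarrow> nat \<Rightarrow> real" where
  "spread u m' = (\<Sum>k | k \<in> {1..K} \<and> p k \<noteq> m'. (C m' k)\<^sup>2 * (cmod (u (Inr (m, k))))\<^sup>2)"

definition truncated :: "assignment \<Rightarrow> bool" where
  "truncated u \<longleftrightarrow> (\<forall>k\<in>{1..K}. (cmod (u (Inr (m, k))))\<^sup>2 \<le> T \<and> (cmod (u (Inl (k, p k))))\<^sup>2 \<le> T)"

text \<open>The threshold is that of \<open>cn_combination_tail\<close> at level \<open>T\<close>:
  the variance bound is the group size \<open>K / M\<close> times the bound on one squared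
  coefficient under truncation. The threshold in \<open>scattered_small\<close> arises in the same
  way from at most \<open>K\<close> terms.\<close>

definition aligned_small :: "assignment \<Rightarrow> nat \<Rightarrow> bool" where
  "aligned_small u m' \<longleftrightarrow> (cmod (aligned u m'))\<^sup>2 \<le> 2 * T * (real K / real M * (Cb\<^sup>2 * T))"

definition scattered_small :: "assignment \<Rightarrow> nat \<Rightarrow> bool" where
  "scattered_small u m' \<longleftrightarrow> (cmod (scattered u m'))\<^sup>2 \<le> 2 * T * (real K * (Cb\<^sup>2 * T))"

section \<open>Locality and measurability of the network quantities\<close>

lemma index_Inl [simp]: "Inl (k, m') \<in> gain_index K M \<longleftrightarrow> k \<in> {1..K} \<and> m' \<in> {1..M}"
  and index_Inr [simp]: "Inr (m', k) \<in> gain_index K M \<longleftrightarrow> k \<in> {1..K} \<and> m' \<in> {1..M}"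
  by (auto simp: gain_index_def)

lemma index_cases:
  assumes "k \<in> {1..K}" "m' \<in> {1..M}"
  shows "Inl (k, m') \<in> gain_index K M" "Inl (k, p k) \<in> gain_index K M"
    "Inr (p k, k) \<in> gain_index K M" "Inr (m, k) \<in> gain_index K M"
  using assms p m by simp_all

lemma gain_measurable [measurable]: "i \<in> gain_index K M \<Longrightarrow> g i \<in> borel_measurable W"
  using cn cn_measurable by blast

lemma cmod_rotated [simp]: "cmod (rotated u k) = cmod (u (Inr (m, k)))"
  by (simp add: rotated_def norm_mult)

context
  fixes u v :: assignment
  assumes eq: "\<And>i. i \<in> gain_index K M \<Longrightarrow> u i = v i"
begin

lemma rotated_cong: "k \<in> {1..K} \<Longrightarrow> rotated u k = rotated v k"
  unfolding rotated_def using index_cases m eq by metis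

lemma aligned_cong: "m' \<in> {1..M} \<Longrightarrow> aligned u m' = aligned v m'"
  unfolding aligned_def by (intro sum.cong) (auto simp: rotated_cong eq)

lemma scattered_cong: "m' \<in> {1..M} \<Longrightarrow> scattered u m' = scattered v m'"
  unfolding scattered_def by (intro sum.cong) (auto simp: rotated_cong eq)

lemma spread_cong: "m' \<in> {1..M} \<Longrightarrow> spread u m' = spread v m'"
  unfolding spread_def using m by (intro sum.cong) (auto simp: eq)

lemma truncated_cong: "truncated u = truncated v"
  unfolding truncated_def using index_cases m eq by (metis (no_types, lifting))

end

lemma component_measurable [measurable (raw)]:
  "i \<in> gain_index K M \<Longrightarrow> (\<lambda>u. u i) \<in> borel_measurable (PiM (gain_index K M) (\<lambda>_. borel :: complex measure))"
  by (rule measurable_component_singleton)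

lemma rotated_measurable [measurable]:
  "k \<in> {1..K} \<Longrightarrow> (\<lambda>u. rotated u k) \<in> borel_measurable (PiM (gain_index K M) (\<lambda>_. borel))"
proof -
  assume k: "k \<in> {1..K}"
  note [measurable] = component_measurable[OF index_cases(2)[OF k m]]
    component_measurable[OF index_cases(3)[OF k m]] component_measurable[OF index_cases(4)[OF k m]]
  show ?thesis unfolding rotated_def by measurable
qed

lemma aligned_measurable [measurable]:
  "m' \<in> {1..M} \<Longrightarrow> (\<lambda>u. aligned u m') \<in> borel_measurable (PiM (gain_index K M) (\<lambda>_. borel))"
  unfolding aligned_def
  by (intro borel_measurable_sum borel_measurable_times borel_measurable_const rotated_measurable component_measurable) auto

lemma scattered_measurable [measurable]:
  "m' \<in> {1..M} \<Longrightarrow> (\<lambda>u. scattered u m') \<in> borel_measurable (PiM (gain_index K M) (\<lambda>_. borel))"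
  unfolding scattered_def
  by (intro borel_measurable_sum borel_measurable_times borel_measurable_const rotated_measurable component_measurable) auto

lemma spread_measurable [measurable]:
  "m' \<in> {1..M} \<Longrightarrow> (\<lambda>u. spread u m') \<in> borel_measurable (PiM (gain_index K M) (\<lambda>_. borel))"
  unfolding spread_def using m
  by (intro borel_measurable_sum borel_measurable_times borel_measurable_const borel_measurable_power borel_measurable_norm component_measurable) auto

lemma truncated_measurable [measurable]:
  "Measurable.pred (PiM (gain_index K M) (\<lambda>_. borel)) truncated"
proof -
  have "Measurable.pred (PiM (gain_index K M) (\<lambda>_. borel))
      (\<lambda>u. (cmod (u (Inr (m, k))))\<^sup>2 \<le> T \<and> (cmod (u (Inl (k, p k))))\<^sup>2 \<le> T)" if k: "k \<in> {1..K}" for k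
  proof -
    note [measurable] = component_measurable[OF index_cases(2)[OF k m]]
      component_measurable[OF index_cases(4)[OF k m]]
    show ?thesis by measurable
  qed
  then show ?thesis
    unfolding truncated_def[abs_def] by (intro pred_intros_finite) auto
qed

lemma aligned_small_measurable [measurable]:
  "m' \<in> {1..M} \<Longrightarrow> Measurable.pred (PiM (gain_index K M) (\<lambda>_. borel)) (\<lambda>u. aligned_small u m')"
  unfolding aligned_small_def by measurable

lemma scattered_small_measurable [measurable]:
  "m' \<in> {1..M} \<Longrightarrow> Measurable.pred (PiM (gain_index K M) (\<lambda>_. borel)) (\<lambda>u. scattered_small u m')"
  unfolding scattered_small_def by measurable

text \<open>Measurability of gains is available only on the index set; locality allows
  \<open>Q\<close> to be evaluated on the restricted family instead.\<close>

lemma event_measurable: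
  assumes meas: "Measurable.pred (PiM (gain_index K M) (\<lambda>_. borel)) Q"
    and local: "\<And>u. Q (restrict u (gain_index K M)) = Q u"
  shows "{w \<in> space W. Q (\<lambda>i. g i w)} \<in> events"
proof -
  have "(\<lambda>w. restrict (\<lambda>i. g i w) (gain_index K M)) \<in> measurable W (PiM (gain_index K M) (\<lambda>_. borel))"
    by (intro measurable_restrict gain_measurable)
  then have "Measurable.pred W (\<lambda>w. Q (restrict (\<lambda>i. g i w) (gain_index K M)))"
    using meas by measurable
  then show ?thesis by (simp add: pred_def local)
qed

end

section \<open>Exceptional events\<close>

context relay_gains
begin

lemma prob_not_truncated: "prob {w \<in> space W. \<not> truncated (\<lambda>i. g i w)} \<le> 2 * real K * exp (- T)"
proof -
  let ?A = "\<lambda>k. {w \<in> space W. T < (cmod (g (Inr (m, k)) w))\<^sup>2} \<union> {w \<in> space W. T < (cmod (g (Inl (k, p k)) w))\<^sup>2}"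
  have A: "?A k \<in> events" "prob (?A k) \<le> 2 * exp (- T)" if k: "k \<in> {1..K}" for k
  proof -
    note idx = index_cases(2)[OF k m] index_cases(4)[OF k m]
    note [measurable] = gain_measurable[OF idx(1)] gain_measurable[OF idx(2)]
    show "?A k \<in> events" by measurable
    have "prob (?A k) \<le> prob {w \<in> space W. T < (cmod (g (Inr (m, k)) w))\<^sup>2} + prob {w \<in> space W. T < (cmod (g (Inl (k, p k)) w))\<^sup>2}"
      by (rule measure_Un_le) measurable
    also have "\<dots> = 2 * exp (- T)"
      using cn_tail[OF cn[OF idx(1)], of T] cn_tail[OF cn[OF idx(2)], of T] T by simp
    finally show "prob (?A k) \<le> 2 * exp (- T)" .
  qed
  have "{w \<in> space W. \<not> truncated (\<lambda>i. g i w)} = (\<Union>k\<in>{1..K}. ?A k)"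
    by (auto simp: truncated_def not_le)
  also have "prob \<dots> \<le> (\<Sum>k\<in>{1..K}. prob (?A k))"
    using A by (intro measure_UNION_le) auto
  also have "\<dots> \<le> (\<Sum>k\<in>{1..K}. 2 * exp (- T))"
    using A by (intro sum_mono) auto
  finally show ?thesis by simp
qed

lemma indep_subfamily: "inj_on s J \<Longrightarrow> s ` J \<subseteq> gain_index K M \<Longrightarrow> indep_vars (\<lambda>_. borel) (\<lambda>k. g (s k)) J"
  by (rule indep_vars_reindex[OF indep_vars_subset[OF indep]])

text \<open>The squared moduli have mean 1 and second moment 2, just as
  \<open>sum_concentration\<close> asks. The forward energy governs both the conditional variances
  \<open>spread\<close> and the forwarded noise.\<close>

lemma prob_forward_energy:
  "prob {w \<in> space W. truncated (\<lambda>i. g i w) \<and> real K + sqrt K * T\<^sup>2 \<le> (\<Sum>k=1..K. (cmod (g (Inr (m, k)) w))\<^sup>2)} \<le> exp (- T)"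
  "prob {w \<in> space W. (\<Sum>k=1..K. (cmod (g (Inr (m, k)) w))\<^sup>2) \<le> real K - sqrt K * T\<^sup>2} \<le> exp (- T)"
proof -
  let ?X = "\<lambda>k w. (cmod (g (Inr (m, k)) w))\<^sup>2"
  have cnk: "distributed W lborel (g (Inr (m, k))) cn_density" if "k \<in> {1..K}" for k
    using cn index_cases(4)[OF that m] .
  have ind: "indep_vars (\<lambda>_. borel) ?X {1..K}"
    by (rule indep_vars_compose2[OF indep_subfamily]) (use m in \<open>auto simp: inj_on_def\<close>)
  have e: "(\<Sum>k=1..K. expectation (?X k)) = real K"
    using cn_expectation_square[OF cnk] by simp
  note conc = sum_concentration[where I="{1..K}" and X="?X" and n="real K" and T=T, OF _ _ _ ind, unfolded e]
  have *: "integrable W (?X k)" "integrable W (\<lambda>w. (?X k w)\<^sup>2)" "expectation (\<lambda>w. (?X k w)\<^sup>2) \<le> 2"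
    if "k \<in> {1..K}" for k
    using cn_square_integrable[OF cnk[OF that]] cn_fourth_integrable[OF cnk[OF that]]
      cn_expectation_fourth[OF cnk[OF that]] by (simp_all flip: power_mult)
  have [measurable]: "g (Inr (m, k)) \<in> borel_measurable W" if "k \<in> {1..K}" for k
    using gain_measurable index_cases(4)[OF that m] .
  show "prob {w \<in> space W. (\<Sum>k=1..K. ?X k w) \<le> real K - sqrt K * T\<^sup>2} \<le> exp (- T)"
    using K T * by (intro conc) auto
  have "prob {w \<in> space W. truncated (\<lambda>i. g i w) \<and> real K + sqrt K * T\<^sup>2 \<le> (\<Sum>k=1..K. ?X k w)} \<le>
      prob {w \<in> space W. (\<forall>k\<in>{1..K}. ?X k w \<le> T) \<and> real K + sqrt K * T\<^sup>2 \<le> (\<Sum>k=1..K. ?X k w)}"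
    by (intro finite_measure_mono) (auto simp: truncated_def)
  also have "\<dots> \<le> exp (- T)"
    using K T * by (intro conc) auto
  finally show "prob {w \<in> space W. truncated (\<lambda>i. g i w) \<and> real K + sqrt K * T\<^sup>2 \<le> (\<Sum>k=1..K. ?X k w)} \<le> exp (- T)" .
qed

lemma group_card_pos: "m' \<in> {1..M} \<Longrightarrow> 0 < card {k \<in> {1..K}. p k = m'}"
  using group_card K M by (metis atLeastAtMost_iff divide_eq_0_iff gr0I not_less_eq_eq numeral_2_eq_2 of_nat_0 of_nat_eq_0_iff zero_less_Suc Suc_leD le_zero_eq)

text \<open>The terms are independent across relays because each uses its own pair of gains. Each
  term is a product of two independent Rayleigh variables, so its mean is \<open>pi / 4\<close> and
  its second moment is 1; the group has \<open>K / M\<close> members.\<close>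

lemma prob_coherent_sum:
  fixes G defines "G \<equiv> {k \<in> {1..K}. p k = m}"
  shows "prob {w \<in> space W. truncated (\<lambda>i. g i w) \<and>
      real K / real M * (pi / 4) + sqrt K * T\<^sup>2 \<le> (\<Sum>k\<in>G. cmod (g (Inr (m, k)) w) * cmod (g (Inl (k, m)) w))} \<le> exp (- T)"
    (is ?upper)
  and "prob {w \<in> space W. (\<Sum>k\<in>G. cmod (g (Inr (m, k)) w) * cmod (g (Inl (k, m)) w)) \<le>
      real K / real M * (pi / 4) - sqrt K * T\<^sup>2} \<le> exp (- T)" (is ?lower)
proof -
  let ?X = "\<lambda>k w. cmod (g (Inr (m, k)) w) * cmod (g (Inl (k, m)) w)"
  have G: "finite G" "G \<noteq> {}" "real (card G) \<le> real K"
    using group_card_pos[OF m] card_mono[of "{1..K}" "{k \<in> {1..K}. p k = m}"]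
    unfolding G_def by (auto simp: card_gt_0_iff simp del: atLeastAtMost_iff)
  have cnk: "distributed W lborel (g (Inr (m, k))) cn_density" "distributed W lborel (g (Inl (k, m))) cn_density"
    if "k \<in> G" for k
    using that m by (auto intro!: cn simp: G_def)
  have [measurable]: "g (Inr (m, k)) \<in> borel_measurable W" "g (Inl (k, m)) \<in> borel_measurable W" if "k \<in> G" for k
    using cn_measurable[OF cnk(1)[OF that]] cn_measurable[OF cnk(2)[OF that]] by auto
  have pair: "indep_var borel (g (Inr (m, k))) borel (g (Inl (k, m)))" if "k \<in> G" for k
    using that m by (intro indep_vars_pair[OF indep]) (auto simp: G_def)
  have ind: "indep_vars (\<lambda>_. borel) ?X G"
  proof -
    have "(\<lambda>u. cmod (u (Inr (m, k))) * cmod (u (Inl (k, m)))) \<in>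
        borel_measurable (PiM {Inr (m, k), Inl (k, m)} (\<lambda>_. borel :: complex measure))" for k
      by (intro borel_measurable_times borel_measurable_norm measurable_component_singleton) auto
    then show ?thesis
      using m by (intro indep_vars_regroup[OF indep, where B="\<lambda>k. {Inr (m, k), Inl (k, m)}"
        and G="\<lambda>k u. cmod (u (Inr (m, k))) * cmod (u (Inl (k, m)))"])
        (auto simp: G_def disjoint_family_on_def)
  qed
  have mom: "integrable W (?X k)" "integrable W (\<lambda>w. (?X k w)\<^sup>2)" "expectation (?X k) = pi / 4"
    "expectation (\<lambda>w. (?X k w)\<^sup>2) = 1" if k: "k \<in> G" for k
  proof -
    have i1: "indep_var borel (\<lambda>w. cmod (g (Inr (m, k)) w)) borel (\<lambda>w. cmod (g (Inl (k, m)) w))"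
      using indep_var_compose[OF pair[OF k], of cmod borel cmod borel] by (simp add: comp_def)
    have i2: "indep_var borel (\<lambda>w. (cmod (g (Inr (m, k)) w))\<^sup>2) borel (\<lambda>w. (cmod (g (Inl (k, m)) w))\<^sup>2)"
      using indep_var_compose[OF pair[OF k], of "\<lambda>z. (cmod z)\<^sup>2" borel "\<lambda>z. (cmod z)\<^sup>2" borel] by (simp add: comp_def)
    note int = cn_integrable[OF cnk(1)[OF k]] cn_integrable[OF cnk(2)[OF k]]
    note int2 = cn_square_integrable[OF cnk(1)[OF k]] cn_square_integrable[OF cnk(2)[OF k]]
    show "integrable W (?X k)" "expectation (?X k) = pi / 4"
      using indep_var_integrable[OF i1 integrable_norm[OF int(1)] integrable_norm[OF int(2)]]
        indep_var_lebesgue_integral[OF i1 integrable_norm[OF int(1)] integrable_norm[OF int(2)]]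
        cn_expectation_cmod[OF cnk(1)[OF k]] cn_expectation_cmod[OF cnk(2)[OF k]] by simp_all
    show "integrable W (\<lambda>w. (?X k w)\<^sup>2)" "expectation (\<lambda>w. (?X k w)\<^sup>2) = 1"
      using indep_var_integrable[OF i2 int2] indep_var_lebesgue_integral[OF i2 int2]
        cn_expectation_square[OF cnk(1)[OF k]] cn_expectation_square[OF cnk(2)[OF k]]
      by (simp_all add: power_mult_distrib)
  qed
  have e: "(\<Sum>k\<in>G. expectation (?X k)) = real K / real M * (pi / 4)"
  proof -
    have "(\<Sum>k\<in>G. expectation (?X k)) = (\<Sum>k\<in>G. pi / 4)"
      by (rule sum.cong[OF refl mom(3)])
    also have "\<dots> = real K / real M * (pi / 4)"
      using group_card[OF m] by (simp only: G_def sum_constant)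
    finally show ?thesis .
  qed
  note conc = sum_concentration[where I=G and X="?X" and n="real K" and T=T, OF G ind, unfolded e]
  show ?lower
    using T mom by (intro conc) auto
  have "prob {w \<in> space W. truncated (\<lambda>i. g i w) \<and> real K / real M * (pi / 4) + sqrt K * T\<^sup>2 \<le> (\<Sum>k\<in>G. ?X k w)} \<le>
      prob {w \<in> space W. (\<forall>k\<in>G. ?X k w \<le> T) \<and> real K / real M * (pi / 4) + sqrt K * T\<^sup>2 \<le> (\<Sum>k\<in>G. ?X k w)}"
  proof (intro finite_measure_mono)
    show "{w \<in> space W. (\<forall>k\<in>G. ?X k w \<le> T) \<and> real K / real M * (pi / 4) + sqrt K * T\<^sup>2 \<le> (\<Sum>k\<in>G. ?X k w)} \<in> events"
      using G(1) by measurable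
    \<comment> \<open>Truncation bounds both squared moduli by \<open>T\<close>, hence their product
      by the square of \<open>T\<close>.\<close>
    have "?X k w \<le> T" if "truncated (\<lambda>i. g i w)" "k \<in> G" for k w
    proof -
      have "(cmod (g (Inr (m, k)) w))\<^sup>2 \<le> T" "(cmod (g (Inl (k, m)) w))\<^sup>2 \<le> T"
        using that by (auto simp: truncated_def G_def)
      moreover have "0 \<le> T" using T by linarith
      ultimately have "(?X k w)\<^sup>2 \<le> T\<^sup>2"
        unfolding power_mult_distrib power2_eq_square[of T] by (intro mult_mono) simp_all
      then show ?thesis by (rule power2_le_imp_le) fact
    qed
    then show "{w \<in> space W. truncated (\<lambda>i. g i w) \<and> real K / real M * (pi / 4) + sqrt K * T\<^sup>2 \<le> (\<Sum>k\<in>G. ?X k w)} \<subseteq>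
        {w \<in> space W. (\<forall>k\<in>G. ?X k w \<le> T) \<and> real K / real M * (pi / 4) + sqrt K * T\<^sup>2 \<le> (\<Sum>k\<in>G. ?X k w)}"
      by auto
  qed
  also have "\<dots> \<le> exp (- T)"
    using T mom by (intro conc) auto
  finally show ?upper .
qed

text \<open>For a relay of group \<open>m'\<close> different from \<open>m\<close> the phase
  corrections involve the gains to and from \<open>m'\<close>, not the forward gain to
  \<open>m\<close>. With all other gains frozen, the aligned part is thus linear in the forward
  gains to \<open>m\<close> from that group, and it has no coherent mean.\<close>

lemma prob_aligned_large:
  assumes m': "m' \<in> {1..M}" "m' \<noteq> m"
  shows "prob {w \<in> space W. truncated (\<lambda>i. g i w) \<and> \<not> aligned_small (\<lambda>i. g i w) m'} \<le> 4 * exp (- T)"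
proof -
  define G where "G = {k \<in> {1..K}. p k = m'}"
  define L where "L = (\<lambda>k. Inr (m, k) :: (nat \<times> nat) + (nat \<times> nat)) ` G"
  let ?S = "real K / real M * (Cb\<^sup>2 * T)"
  have L: "L \<subseteq> gain_index K M" using m by (auto simp: L_def G_def)
  have S: "0 < ?S" using K M Cb T by simp
  show ?thesis
  proof (rule indep_vars_section_bound[OF indep L, where Q="\<lambda>u. truncated u \<and> \<not> aligned_small u m'"])
    show "Measurable.pred (PiM (gain_index K M) (\<lambda>_. borel)) (\<lambda>u. truncated u \<and> \<not> aligned_small u m')"
      using m'(1) by measurable
    show "(truncated u \<and> \<not> aligned_small u m') = (truncated v \<and> \<not> aligned_small v m')"
      if "\<And>i. i \<in> gain_index K M \<Longrightarrow> u i = v i" for u v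
      using truncated_cong[OF that] aligned_cong[OF that] m' by (simp add: aligned_small_def)
  next
    fix u
    let ?v = "\<lambda>w i. if i \<in> L then g i w else u i"
    define a where "a k = of_real (C m' k) * cnj (phase (u (Inr (p k, k)))) * cnj (phase (u (Inl (k, p k)))) * u (Inl (k, m'))" for k
    have al: "aligned (?v w) m' = (\<Sum>k\<in>G. a k * g (Inr (m, k)) w)" for w
      unfolding aligned_def G_def[symmetric] a_def rotated_def
      using m'(2) by (intro sum.cong) (auto simp: L_def G_def)
    show "prob {w \<in> space W. truncated (?v w) \<and> \<not> aligned_small (?v w) m'} \<le> 4 * exp (- T)"
    \<comment> \<open>The backward gains that bound the coefficients are frozen. If one of them
      exceeds the truncation level, the event is empty for every value of the random gains.\<close>
    proof (cases "\<forall>k\<in>G. (cmod (u (Inl (k, m'))))\<^sup>2 \<le> T")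
      case True
      have "(\<Sum>k\<in>G. (cmod (a k))\<^sup>2) \<le> (\<Sum>k\<in>G. Cb\<^sup>2 * T)"
      proof (rule sum_mono)
        fix k assume k: "k \<in> G"
        have "(cmod (a k))\<^sup>2 = (C m' k)\<^sup>2 * (cmod (u (Inl (k, m'))))\<^sup>2"
          by (simp add: a_def norm_mult power_mult_distrib)
        also have "\<dots> \<le> Cb\<^sup>2 * T"
          using C[OF m'(1)] k True by (intro mult_mono power_mono) (auto simp: G_def)
        finally show "(cmod (a k))\<^sup>2 \<le> Cb\<^sup>2 * T" .
      qed
      also have "\<dots> = ?S" using group_card[OF m'(1)] by (simp add: G_def)
      finally have "(\<Sum>k\<in>G. (cmod (a k))\<^sup>2) \<le> ?S" .
      moreover have "indep_vars (\<lambda>_. borel) (\<lambda>k. g (Inr (m, k))) G"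
        using m by (intro indep_subfamily) (auto simp: inj_on_def G_def)
      moreover have cnG: "distributed W lborel (g (Inr (m, k))) cn_density" if "k \<in> G" for k
        using that m by (intro cn) (auto simp: G_def)
      moreover have "finite G" by (simp add: G_def)
      ultimately have "prob {w \<in> space W. 2 * T * ?S < (cmod (\<Sum>k\<in>G. a k * g (Inr (m, k)) w))\<^sup>2} \<le> 4 * exp (- T)"
        using S T by (intro cn_combination_tail) auto
      moreover have "prob {w \<in> space W. truncated (?v w) \<and> \<not> aligned_small (?v w) m'} \<le>
          prob {w \<in> space W. 2 * T * ?S < (cmod (\<Sum>k\<in>G. a k * g (Inr (m, k)) w))\<^sup>2}"
      proof (intro finite_measure_mono)
        have [measurable]: "g (Inr (m, k)) \<in> borel_measurable W" if "k \<in> G" for k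
          using cn_measurable[OF cnG[OF that]] .
        show "{w \<in> space W. 2 * T * ?S < (cmod (\<Sum>k\<in>G. a k * g (Inr (m, k)) w))\<^sup>2} \<in> events"
          by measurable
      qed (auto simp: aligned_small_def al)
      ultimately show ?thesis by linarith
    next
      case False
      then have "\<not> truncated (?v w)" for w
        unfolding truncated_def by (auto simp: L_def G_def)
      then show ?thesis by simp
    qed
  qed
qed

text \<open>The scattered parts depend on these backward gains; the aligned parts, the phases and the truncation do not.\<close>

definition free_index :: "((nat \<times> nat) + (nat \<times> nat)) set" where
  "free_index = Inl ` {(k, m'). k \<in> {1..K} \<and> m' \<in> {1..M} \<and> p k \<noteq> m'}"

definition mixed :: "assignment \<Rightarrow> 'w \<Rightarrow> assignment" where
  "mixed u w i = (if i \<in> free_index then g i w else u i)"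

lemma free_index_subset: "free_index \<subseteq> gain_index K M"
  by (auto simp: free_index_def)

lemma mixed_simps [simp]:
  "mixed u w (Inr j) = u (Inr j)"
  "mixed u w (Inl (k, p k)) = u (Inl (k, p k))"
  "k \<in> {1..K} \<Longrightarrow> m' \<in> {1..M} \<Longrightarrow> p k \<noteq> m' \<Longrightarrow> mixed u w (Inl (k, m')) = g (Inl (k, m')) w"
  by (auto simp: mixed_def free_index_def)

lemma rotated_mixed [simp]: "rotated (mixed u w) k = rotated u k"
  by (simp add: rotated_def)

lemma truncated_mixed [simp]: "truncated (mixed u w) = truncated u"
  by (simp add: truncated_def)

lemma spread_mixed [simp]: "spread (mixed u w) m' = spread u m'"
  by (simp add: spread_def)

lemma aligned_mixed [simp]: "aligned (mixed u w) m' = aligned u m'"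
  unfolding aligned_def by (intro sum.cong) auto

lemma aligned_small_mixed [simp]: "aligned_small (mixed u w) m' = aligned_small u m'"
  by (simp add: aligned_small_def)

lemma scattered_mixed:
  "m' \<in> {1..M} \<Longrightarrow> scattered (mixed u w) m' =
    (\<Sum>k | k \<in> {1..K} \<and> p k \<noteq> m'. of_real (C m' k) * rotated u k * g (Inl (k, m')) w)"
  unfolding scattered_def by (intro sum.cong) auto

lemma spread_eq: "spread u m' = (\<Sum>k | k \<in> {1..K} \<and> p k \<noteq> m'. (cmod (of_real (C m' k) * rotated u k))\<^sup>2)"
  by (simp add: spread_def norm_mult power_mult_distrib)

lemma spread_le:
  assumes "truncated u" "m' \<in> {1..M}"
  shows "spread u m' \<le> real K * (Cb\<^sup>2 * T)"
proof -
  have "spread u m' \<le> (\<Sum>k | k \<in> {1..K} \<and> p k \<noteq> m'. Cb\<^sup>2 * T)"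
    unfolding spread_def using assms C T
    by (intro sum_mono mult_mono power_mono) (auto simp: truncated_def)
  also have "\<dots> \<le> (\<Sum>k\<in>{1..K}. Cb\<^sup>2 * T)"
    using T by (intro sum_mono2) auto
  finally show ?thesis by simp
qed

lemma free_gains:
  assumes "m' \<in> {1..M}"
  shows "finite {k. k \<in> {1..K} \<and> p k \<noteq> m'}"
    and "indep_vars (\<lambda>_. borel) (\<lambda>k. g (Inl (k, m'))) {k. k \<in> {1..K} \<and> p k \<noteq> m'}"
    and "k \<in> {k. k \<in> {1..K} \<and> p k \<noteq> m'} \<Longrightarrow> distributed W lborel (g (Inl (k, m'))) cn_density"
proof -
  let ?H = "{k. k \<in> {1..K} \<and> p k \<noteq> m'}"
  show "finite ?H" by simp
  have "(\<lambda>k. Inl (k, m')) ` ?H \<subseteq> gain_index K M" using assms by auto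
  then show "indep_vars (\<lambda>_. borel) (\<lambda>k. g (Inl (k, m'))) ?H"
    by (rule indep_subfamily[rotated]) (simp add: inj_on_def)
  show "distributed W lborel (g (Inl (k, m'))) cn_density" if "k \<in> ?H"
    using assms that by (intro cn) simp
qed

lemma scale_pos: "0 < real K * (Cb\<^sup>2 * T)"
  using K Cb T by simp

section \<open>Conditional bounds given all but the free backward gains\<close>

lemma prob_section_bound:
  assumes "Measurable.pred (PiM (gain_index K M) (\<lambda>_. borel)) Q"
    and local: "\<And>u. Q (restrict u (gain_index K M)) = Q u"
    and "\<And>u. prob {w \<in> space W. Q (mixed u w)} \<le> \<epsilon>"
  shows "prob {w \<in> space W. Q (\<lambda>i. g i w)} \<le> \<epsilon>"
proof (rule indep_vars_section_bound[OF indep free_index_subset assms(1) _ assms(3)[unfolded mixed_def[abs_def]]])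
  show "Q u = Q v" if "\<And>i. i \<in> gain_index K M \<Longrightarrow> u i = v i" for u v
    using local[of u] local[of v] restrict_ext[of "gain_index K M" u v] that by simp
qed

lemma mixed_event_measurable:
  assumes meas: "Measurable.pred (PiM (gain_index K M) (\<lambda>_. borel)) Q"
    and local: "\<And>u. Q (restrict u (gain_index K M)) = Q u"
  shows "{w \<in> space W. Q (mixed u w)} \<in> events"
proof -
  have "(\<lambda>w. restrict (mixed u w) (gain_index K M)) \<in> measurable W (PiM (gain_index K M) (\<lambda>_. borel))"
  proof (rule measurable_restrict)
    show "(\<lambda>w. mixed u w i) \<in> borel_measurable W" if "i \<in> gain_index K M" for i
      using gain_measurable[OF that] by (cases "i \<in> free_index") (simp_all add: mixed_def)
  qed
  then have "Measurable.pred W (\<lambda>w. Q (restrict (mixed u w) (gain_index K M)))"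
    using meas by measurable
  then show ?thesis by (simp add: pred_def local)
qed

lemma prob_scattered_large:
  assumes m': "m' \<in> {1..M}"
  shows "prob {w \<in> space W. truncated (\<lambda>i. g i w) \<and> \<not> scattered_small (\<lambda>i. g i w) m'} \<le> 4 * exp (- T)"
proof (rule prob_section_bound[where Q="\<lambda>u. truncated u \<and> \<not> scattered_small u m'"])
  show "Measurable.pred (PiM (gain_index K M) (\<lambda>_. borel)) (\<lambda>u. truncated u \<and> \<not> scattered_small u m')"
    using m' by measurable
  fix u :: assignment
  let ?u = "restrict u (gain_index K M)"
  have "truncated ?u = truncated u" "scattered ?u m' = scattered u m'"
    using m' by (auto intro!: truncated_cong scattered_cong)
  then show "(truncated ?u \<and> \<not> scattered_small ?u m') = (truncated u \<and> \<not> scattered_small u m')"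
    by (simp add: scattered_small_def)
  show "prob {w \<in> space W. truncated (mixed u w) \<and> \<not> scattered_small (mixed u w) m'} \<le> 4 * exp (- T)"
  proof (cases "truncated u")
    case True
    then show ?thesis
      using cn_combination_tail[OF free_gains[OF m'] _ scale_pos, of "\<lambda>k. of_real (C m' k) * rotated u k" T]
        spread_le[OF True m'] T
      by (simp add: spread_eq scattered_small_def scattered_mixed[OF m'] not_le)
  qed simp
qed

text \<open>Different sources use disjoint sets of free backward gains, so with \<open>u\<close>
  frozen the summands are independent, and their means are given by
  \<open>cn_combination_second\<close>. The upper tail needs the summands bounded by means of
  \<open>scattered_small\<close>; the lower tail needs only their second moments.\<close>

lemma interference_deviation:
  assumes u: "truncated u" "\<And>m'. m' \<in> {1..M} - {m} \<Longrightarrow> aligned_small u m'"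
  defines "X \<equiv> \<lambda>m' w. (cmod (aligned u m' + scattered (mixed u w) m'))\<^sup>2"
    and "\<mu> \<equiv> \<Sum>m'\<in>{1..M} - {m}. (cmod (aligned u m'))\<^sup>2 + spread u m'"
    and "t \<equiv> real K * sqrt M * x"
  shows "prob {w \<in> space W. (\<forall>m'\<in>{1..M} - {m}. scattered_small (mixed u w) m') \<and>
      \<mu> + t \<le> (\<Sum>m'\<in>{1..M} - {m}. X m' w)} \<le> exp (- T)"
    and "prob {w \<in> space W. (\<Sum>m'\<in>{1..M} - {m}. X m' w) \<le> \<mu> - t} \<le> exp (- T)"
proof -
  let ?N = "{1..M} - {m}"
  let ?S = "real K * (Cb\<^sup>2 * T)"
  \<comment> \<open>A squared modulus of a sum is at most twice the sum of the squared moduli; the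
    aligned part contributes \<open>2 * (T * ?S)\<close> and the scattered part
    \<open>4 * (T * ?S)\<close>.\<close>
  define B where "B = 6 * T * ?S"
  have t: "0 < t" using K M x by (simp add: t_def)
  have t2: "t\<^sup>2 = (real K)\<^sup>2 * real M * x\<^sup>2" by (simp add: t_def power_mult_distrib)
  have B: "0 < B" using scale_pos T by (simp add: B_def)
  have card_N: "card ?N = M - 1" using m by (simp add: card_Diff_singleton)
  then have "card ?N \<noteq> 0" using M by linarith
  then have "?N \<noteq> {}" by (metis card.empty)
  then have N: "finite ?N" "?N \<noteq> {}" "card ?N = M - 1" using card_N by auto
  have Xeq: "X m' = (\<lambda>w. (cmod (aligned u m' + (\<Sum>k | k \<in> {1..K} \<and> p k \<noteq> m'.
      of_real (C m' k) * rotated u k * g (Inl (k, m')) w)))\<^sup>2)" if "m' \<in> ?N" for m'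
    using that by (simp add: X_def scattered_mixed fun_eq_iff)
  have ind: "indep_vars (\<lambda>_. borel) X ?N"
  proof -
    let ?B = "\<lambda>m'. (\<lambda>k. Inl (k, m') :: (nat \<times> nat) + (nat \<times> nat)) ` {k. k \<in> {1..K} \<and> p k \<noteq> m'}"
    let ?G = "\<lambda>m' v. (cmod (aligned u m' + (\<Sum>k | k \<in> {1..K} \<and> p k \<noteq> m'.
      of_real (C m' k) * rotated u k * v (Inl (k, m')))))\<^sup>2"
    have "indep_vars (\<lambda>_. borel) (\<lambda>m' w. ?G m' (\<lambda>i. g i w)) ?N"
    proof (rule indep_vars_regroup[OF indep, of _ ?B])
      show "?G m' \<in> borel_measurable (PiM (?B m') (\<lambda>_. borel))" for m'
        by (intro borel_measurable_power borel_measurable_norm borel_measurable_add borel_measurable_sum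
          borel_measurable_times borel_measurable_const measurable_component_singleton) auto
      show "?G m' v = ?G m' v'" if "\<And>i. i \<in> ?B m' \<Longrightarrow> v i = v' i" for m' v v'
        using that by (intro arg_cong[where f="\<lambda>z. (cmod (aligned u m' + z))\<^sup>2"] sum.cong) auto
    qed (auto simp: disjoint_family_on_def)
    then show ?thesis
      by (rule indep_vars_cong[THEN iffD1, rotated 3]) (auto simp: Xeq)
  qed
  have mom: "integrable W (X m')" "expectation (X m') = (cmod (aligned u m'))\<^sup>2 + spread u m'"
    "integrable W (\<lambda>w. (X m' w)\<^sup>2)" "expectation (\<lambda>w. (X m' w)\<^sup>2) \<le> 8 * ((cmod (aligned u m')) ^ 4 + 384 * ?S\<^sup>2)"
    if "m' \<in> ?N" for m'
  proof -
    have m': "m' \<in> {1..M}" using that by simp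
    note fg = free_gains[OF m']
    show "integrable W (X m')" "expectation (X m') = (cmod (aligned u m'))\<^sup>2 + spread u m'"
      unfolding Xeq[OF that] spread_eq
      using cn_combination_second[OF fg, of "aligned u m'" "\<lambda>k. of_real (C m' k) * rotated u k"] by blast+
    have "(\<Sum>k | k \<in> {1..K} \<and> p k \<noteq> m'. (cmod (of_real (C m' k) * rotated u k))\<^sup>2) \<le> ?S"
      using spread_le[OF u(1) m'] by (simp only: spread_eq)
    note fourth = cn_combination_fourth[OF fg, where c="aligned u m'" and a="\<lambda>k. of_real (C m' k) * rotated u k",
      OF _ this scale_pos]
    have eq: "(X m' w)\<^sup>2 = cmod (aligned u m' + (\<Sum>k | k \<in> {1..K} \<and> p k \<noteq> m'.
        of_real (C m' k) * rotated u k * g (Inl (k, m')) w)) ^ 4" for w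
      unfolding Xeq[OF that] by (simp flip: power_mult)
    show "integrable W (\<lambda>w. (X m' w)\<^sup>2)" "expectation (\<lambda>w. (X m' w)\<^sup>2) \<le> 8 * ((cmod (aligned u m')) ^ 4 + 384 * ?S\<^sup>2)"
      unfolding eq using fourth by blast+
  qed
  have X0: "0 \<le> X m' w" for m' w by (simp add: X_def)
  have \<mu>: "(\<Sum>m'\<in>?N. expectation (X m')) = \<mu>"
    using mom(2) by (simp add: \<mu>_def)
  \<comment> \<open>The aligned variance carries the factor \<open>1 / M\<close>; as
    \<open>M\<close> is at least 2, it absorbs the factor 2 of the threshold.\<close>
  have al: "(cmod (aligned u m'))\<^sup>2 \<le> T * ?S" if "m' \<in> ?N" for m'
  proof -
    have "2 / real M * (T * ?S) \<le> 1 * (T * ?S)"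
      using M scale_pos T by (intro mult_right_mono) auto
    then show ?thesis
      using u(2)[OF that] by (simp add: aligned_small_def mult_ac)
  qed
  have [measurable]: "X m' \<in> borel_measurable W" if "m' \<in> ?N" for m'
    using mom(1)[OF that] by simp
  have KM: "real (card ?N) \<le> real M" "0 < real (card ?N)" using N M by auto
  have pos: "0 < (real K)\<^sup>2 * real M" using K M by simp
  have "prob {w \<in> space W. (\<forall>m'\<in>?N. scattered_small (mixed u w) m') \<and> \<mu> + t \<le> (\<Sum>m'\<in>?N. X m' w)} \<le>
      prob {w \<in> space W. (\<forall>m'\<in>?N. X m' w \<le> B) \<and> (\<Sum>m'\<in>?N. expectation (X m')) + t \<le> (\<Sum>m'\<in>?N. X m' w)}"
  proof (intro finite_measure_mono)
    show "{w \<in> space W. (\<forall>m'\<in>?N. X m' w \<le> B) \<and> (\<Sum>m'\<in>?N. expectation (X m')) + t \<le> (\<Sum>m'\<in>?N. X m' w)} \<in> events"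
      by measurable
    have "X m' w \<le> B" if "m' \<in> ?N" "scattered_small (mixed u w) m'" for m' w
    proof -
      let ?a = "cmod (aligned u m')" and ?b = "cmod (scattered (mixed u w) m')"
      have "X m' w \<le> (?a + ?b)\<^sup>2"
        unfolding X_def by (intro power_mono norm_triangle_ineq) simp
      also have "\<dots> \<le> 2 * ?a\<^sup>2 + 2 * ?b\<^sup>2"
        using zero_le_power2[of "?a - ?b"] unfolding power2_sum power2_diff by simp
      also have "\<dots> \<le> 2 * (T * ?S) + 2 * (2 * T * ?S)"
        using al[OF that(1)] that(2) by (intro add_mono mult_left_mono) (auto simp: scattered_small_def)
      finally show ?thesis by (simp add: B_def mult_ac)
    qed
    then show "{w \<in> space W. (\<forall>m'\<in>?N. scattered_small (mixed u w) m') \<and> \<mu> + t \<le> (\<Sum>m'\<in>?N. X m' w)} \<subseteq>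
        {w \<in> space W. (\<forall>m'\<in>?N. X m' w \<le> B) \<and> (\<Sum>m'\<in>?N. expectation (X m')) + t \<le> (\<Sum>m'\<in>?N. X m' w)}"
      unfolding \<mu> by blast
  qed
  also have "\<dots> \<le> exp (- 2 * t\<^sup>2 / (real (card ?N) * B\<^sup>2))"
    using N mom X0 B t by (intro truncated_upper_tail ind) auto
  also have "\<dots> \<le> exp (- T)"
  proof -
    \<comment> \<open>Hoeffding's exponent is at least \<open>T\<close> once 36 times
      \<open>Cb ^ 4 * T ^ 5\<close> is at most twice the square of \<open>x\<close>, which the
      locale assumption on \<open>x\<close> grants.\<close>
    have "T * (real (card ?N) * B\<^sup>2) \<le> T * (real M * B\<^sup>2)"
      using KM T by (intro mult_left_mono mult_right_mono) auto
    also have "\<dots> = ((real K)\<^sup>2 * real M) * (36 * Cb ^ 4 * T ^ 5)"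
      by (simp add: B_def power_mult_distrib eval_nat_numeral)
    also have "\<dots> \<le> ((real K)\<^sup>2 * real M) * (2 * x\<^sup>2)"
    proof -
      have "0 \<le> Cb ^ 4 * T ^ 5" using Cb T by simp
      then have "36 * Cb ^ 4 * T ^ 5 \<le> 2 * x\<^sup>2" using x(2) by simp
      then show ?thesis using pos by (intro mult_left_mono) auto
    qed
    also have "\<dots> = 2 * t\<^sup>2" by (simp add: t2)
    finally show ?thesis using KM B by (simp add: field_simps)
  qed
  finally show "prob {w \<in> space W. (\<forall>m'\<in>?N. scattered_small (mixed u w) m') \<and>
      \<mu> + t \<le> (\<Sum>m'\<in>?N. X m' w)} \<le> exp (- T)" .
  \<comment> \<open>The fourth moment bound is 8 times the sum of the fourth power of the aligned
    part and \<open>384 * ?S^2\<close>. The first is at most the square of \<open>T * ?S\<close>,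
    the second at most 8 times that square because the square of \<open>T\<close> is at least 49; 8
    times 9 gives 72.\<close>
  define V where "V = 72 * real M * (T * ?S)\<^sup>2"
  have V: "(\<Sum>m'\<in>?N. expectation (\<lambda>w. (X m' w)\<^sup>2)) \<le> V" "0 < V"
  proof -
    have "(\<Sum>m'\<in>?N. expectation (\<lambda>w. (X m' w)\<^sup>2)) \<le> (\<Sum>m'\<in>?N. 72 * (T * ?S)\<^sup>2)"
    proof (rule sum_mono)
      fix m' assume m': "m' \<in> ?N"
      have "(cmod (aligned u m')) ^ 4 = ((cmod (aligned u m'))\<^sup>2)\<^sup>2" by (simp flip: power_mult)
      also have "\<dots> \<le> (T * ?S)\<^sup>2" using al[OF m'] by (intro power_mono) auto
      finally have "(cmod (aligned u m')) ^ 4 \<le> (T * ?S)\<^sup>2" .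
      moreover have "384 * ?S\<^sup>2 \<le> 8 * (T * ?S)\<^sup>2"
      proof -
        have "48 \<le> T\<^sup>2" using power_mono[OF T, of 2] by simp
        then have "48 * ?S\<^sup>2 \<le> T\<^sup>2 * ?S\<^sup>2" by (intro mult_right_mono) auto
        then show ?thesis unfolding power_mult_distrib[of T ?S] by linarith
      qed
      ultimately have "8 * ((cmod (aligned u m')) ^ 4 + 384 * ?S\<^sup>2) \<le> 8 * ((T * ?S)\<^sup>2 + 8 * (T * ?S)\<^sup>2)"
        by (intro mult_left_mono add_mono) simp_all
      then show "expectation (\<lambda>w. (X m' w)\<^sup>2) \<le> 72 * (T * ?S)\<^sup>2"
        by (intro order_trans[OF mom(4)[OF m']]) simp
    qed
    also have "\<dots> \<le> V"
      using KM by (simp add: V_def mult_right_mono)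
    finally show "(\<Sum>m'\<in>?N. expectation (\<lambda>w. (X m' w)\<^sup>2)) \<le> V" .
    have "0 < T" using T by linarith
    then show "0 < V" using M K Cb by (simp add: V_def)
  qed
  have "prob {w \<in> space W. (\<Sum>m'\<in>?N. X m' w) \<le> (\<Sum>m'\<in>?N. expectation (X m')) - t} \<le> exp (- t\<^sup>2 / (2 * V))"
    using N mom X0 V t by (intro one_sided_lower_tail ind) auto
  also have "\<dots> \<le> exp (- T)"
  proof -
    have "T * (2 * V) = ((real K)\<^sup>2 * real M) * (144 * Cb ^ 4 * T ^ 5)"
      by (simp add: V_def power_mult_distrib eval_nat_numeral)
    also have "\<dots> \<le> ((real K)\<^sup>2 * real M) * x\<^sup>2"
    proof -
      have "0 \<le> Cb ^ 4 * T ^ 5" using Cb T by simp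
      then have "144 * Cb ^ 4 * T ^ 5 \<le> x\<^sup>2" using x(2) by simp
      then show ?thesis using pos by (intro mult_left_mono) auto
    qed
    also have "\<dots> = t\<^sup>2" by (simp add: t2)
    finally show ?thesis using V by (simp add: field_simps)
  qed
  finally show "prob {w \<in> space W. (\<Sum>m'\<in>?N. X m' w) \<le> \<mu> - t} \<le> exp (- T)"
    unfolding \<mu> .
qed

end

lemma pred_le_real [measurable (raw)]:
  fixes f g :: "'a \<Rightarrow> real"
  assumes "f \<in> borel_measurable N" "g \<in> borel_measurable N"
  shows "Measurable.pred N (\<lambda>u. f u \<le> g u)"
  using borel_measurable_le[OF assms] by (simp add: pred_def)

section \<open>The typical event and its probability\<close>

context relay_gains
begin

definition interference :: "assignment \<Rightarrow> real" where
  "interference u = (\<Sum>m'\<in>{1..M} - {m}. (cmod (aligned u m' + scattered u m'))\<^sup>2)"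

definition mean_interference :: "assignment \<Rightarrow> real" where
  "mean_interference u = (\<Sum>m'\<in>{1..M} - {m}. (cmod (aligned u m'))\<^sup>2 + spread u m')"

definition forward_energy :: "assignment \<Rightarrow> real" where
  "forward_energy u = (\<Sum>k=1..K. (cmod (u (Inr (m, k))))\<^sup>2)"

definition coherent_sum :: "assignment \<Rightarrow> real" where
  "coherent_sum u = (\<Sum>k | k \<in> {1..K} \<and> p k = m. cmod (u (Inr (m, k))) * cmod (u (Inl (k, m))))"

text \<open>Kept apart from \<open>typical\<close> because it is the condition under which the
  interference deviations are bounded. Scattered smallness includes the source \<open>m\<close>,
  where it controls the error in the signal.\<close>

definition small_terms :: "assignment \<Rightarrow> bool" where
  "small_terms u \<longleftrightarrow> truncated u \<and> (\<forall>m'\<in>{1..M} - {m}. aligned_small u m') \<and> (\<forall>m'\<in>{1..M}. scattered_small u m')"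

definition typical :: "assignment \<Rightarrow> bool" where
  "typical u \<longleftrightarrow> small_terms u \<and>
    \<bar>forward_energy u - real K\<bar> \<le> sqrt K * T\<^sup>2 \<and>
    \<bar>coherent_sum u - real K / real M * (pi / 4)\<bar> \<le> sqrt K * T\<^sup>2 \<and>
    \<bar>interference u - mean_interference u\<bar> \<le> real K * sqrt M * x"

abbreviation on_index :: "assignment \<Rightarrow> assignment" where
  "on_index u \<equiv> restrict u (gain_index K M)"

lemma truncated_on_index [simp]: "truncated (on_index u) = truncated u"
  by (rule truncated_cong) simp

lemma aligned_on_index [simp]: "m' \<in> {1..M} \<Longrightarrow> aligned (on_index u) m' = aligned u m'"
  by (rule aligned_cong) simp_all

lemma scattered_on_index [simp]: "m' \<in> {1..M} \<Longrightarrow> scattered (on_index u) m' = scattered u m'"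
  by (rule scattered_cong) simp_all

lemma spread_on_index [simp]: "m' \<in> {1..M} \<Longrightarrow> spread (on_index u) m' = spread u m'"
  by (rule spread_cong) simp_all

lemma aligned_small_on_index [simp]: "m' \<in> {1..M} \<Longrightarrow> aligned_small (on_index u) m' = aligned_small u m'"
  by (simp add: aligned_small_def)

lemma scattered_small_on_index [simp]: "m' \<in> {1..M} \<Longrightarrow> scattered_small (on_index u) m' = scattered_small u m'"
  by (simp add: scattered_small_def)

lemma small_terms_on_index [simp]: "small_terms (on_index u) = small_terms u"
  by (simp add: small_terms_def)

lemma interference_on_index [simp]: "interference (on_index u) = interference u"
  unfolding interference_def by (intro sum.cong) simp_all

lemma mean_interference_on_index [simp]: "mean_interference (on_index u) = mean_interference u"
  unfolding mean_interference_def by (intro sum.cong) simp_all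

lemma forward_energy_on_index [simp]: "forward_energy (on_index u) = forward_energy u"
  unfolding forward_energy_def using m by (intro sum.cong) simp_all

lemma coherent_sum_on_index [simp]: "coherent_sum (on_index u) = coherent_sum u"
  unfolding coherent_sum_def using m by (intro sum.cong) simp_all

lemma typical_on_index [simp]: "typical (on_index u) = typical u"
  by (simp add: typical_def)

lemma interference_measurable [measurable]:
  "interference \<in> borel_measurable (PiM (gain_index K M) (\<lambda>_. borel))"
  unfolding interference_def[abs_def]
  by (intro borel_measurable_sum borel_measurable_power borel_measurable_norm borel_measurable_add
    aligned_measurable scattered_measurable) auto

lemma mean_interference_measurable [measurable]:
  "mean_interference \<in> borel_measurable (PiM (gain_index K M) (\<lambda>_. borel))"
  unfolding mean_interference_def[abs_def]
  by (intro borel_measurable_sum borel_measurable_power borel_measurable_norm borel_measurable_add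
    aligned_measurable spread_measurable) auto

lemma forward_energy_measurable [measurable]:
  "forward_energy \<in> borel_measurable (PiM (gain_index K M) (\<lambda>_. borel))"
  unfolding forward_energy_def[abs_def] using m
  by (intro borel_measurable_sum borel_measurable_power borel_measurable_norm component_measurable) auto

lemma coherent_sum_measurable [measurable]:
  "coherent_sum \<in> borel_measurable (PiM (gain_index K M) (\<lambda>_. borel))"
  unfolding coherent_sum_def[abs_def] using m
  by (intro borel_measurable_sum borel_measurable_times borel_measurable_norm component_measurable) auto

lemma small_terms_measurable [measurable]:
  "Measurable.pred (PiM (gain_index K M) (\<lambda>_. borel)) small_terms"
  unfolding small_terms_def[abs_def]
  by (intro pred_intros_logic pred_intros_finite truncated_measurable aligned_small_measurable scattered_small_measurable) auto

lemma prob_interference_deviation: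
  "prob {w \<in> space W. small_terms (\<lambda>i. g i w) \<and>
      mean_interference (\<lambda>i. g i w) + real K * sqrt M * x \<le> interference (\<lambda>i. g i w)} \<le> exp (- T)"
  "prob {w \<in> space W. small_terms (\<lambda>i. g i w) \<and>
      interference (\<lambda>i. g i w) \<le> mean_interference (\<lambda>i. g i w) - real K * sqrt M * x} \<le> exp (- T)"
proof -
  let ?t = "real K * sqrt M * x"
  have mean: "mean_interference (mixed u w) = mean_interference u" for u w
    by (simp add: mean_interference_def)
  have ac: "small_terms (mixed u w) \<longleftrightarrow> truncated u \<and> (\<forall>m'\<in>{1..M} - {m}. aligned_small u m') \<and>
      (\<forall>m'\<in>{1..M}. scattered_small (mixed u w) m')" for u w
    by (simp add: small_terms_def)
  show "prob {w \<in> space W. small_terms (\<lambda>i. g i w) \<and>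
      mean_interference (\<lambda>i. g i w) + ?t \<le> interference (\<lambda>i. g i w)} \<le> exp (- T)"
  proof (rule prob_section_bound[where Q="\<lambda>u. small_terms u \<and> mean_interference u + ?t \<le> interference u"])
    fix u
    let ?A = "{w \<in> space W. (\<forall>m'\<in>{1..M} - {m}. scattered_small (mixed u w) m') \<and>
        mean_interference u + ?t \<le> interference (mixed u w)}"
    show "prob {w \<in> space W. small_terms (mixed u w) \<and> mean_interference (mixed u w) + ?t \<le> interference (mixed u w)} \<le> exp (- T)"
    proof (cases "truncated u \<and> (\<forall>m'\<in>{1..M} - {m}. aligned_small u m')")
      case True
      have "?A \<in> events"
      proof (rule mixed_event_measurable[where Q="\<lambda>v. (\<forall>m'\<in>{1..M} - {m}. scattered_small v m') \<and> mean_interference u + ?t \<le> interference v"])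
        have "Measurable.pred (PiM (gain_index K M) (\<lambda>_. borel)) (\<lambda>v. \<forall>m'\<in>{1..M} - {m}. scattered_small v m')"
          by (intro pred_intros_finite scattered_small_measurable) auto
        then show "Measurable.pred (PiM (gain_index K M) (\<lambda>_. borel))
            (\<lambda>v. (\<forall>m'\<in>{1..M} - {m}. scattered_small v m') \<and> mean_interference u + ?t \<le> interference v)"
          by measurable
      qed simp
      then have "prob {w \<in> space W. small_terms (mixed u w) \<and> mean_interference (mixed u w) + ?t \<le> interference (mixed u w)} \<le> prob ?A"
        by (intro finite_measure_mono) (auto simp: ac mean)
      also have "\<dots> \<le> exp (- T)"
        using interference_deviation(1)[of u] True by (simp add: mean_interference_def interference_def)
      finally show ?thesis .
    next
      case False
      then have "\<not> small_terms (mixed u w)" for w using ac by blast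
      then show ?thesis by simp
    qed
  qed ((measurable)[1], simp)
  show "prob {w \<in> space W. small_terms (\<lambda>i. g i w) \<and>
      interference (\<lambda>i. g i w) \<le> mean_interference (\<lambda>i. g i w) - ?t} \<le> exp (- T)"
  proof (rule prob_section_bound[where Q="\<lambda>u. small_terms u \<and> interference u \<le> mean_interference u - ?t"])
    fix u
    let ?A = "{w \<in> space W. interference (mixed u w) \<le> mean_interference u - ?t}"
    show "prob {w \<in> space W. small_terms (mixed u w) \<and> interference (mixed u w) \<le> mean_interference (mixed u w) - ?t} \<le> exp (- T)"
    proof (cases "truncated u \<and> (\<forall>m'\<in>{1..M} - {m}. aligned_small u m')")
      case True
      have "?A \<in> events"
        by (rule mixed_event_measurable[where Q="\<lambda>v. interference v \<le> mean_interference u - ?t"]) ((measurable)[1], simp)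
      then have "prob {w \<in> space W. small_terms (mixed u w) \<and> interference (mixed u w) \<le> mean_interference (mixed u w) - ?t} \<le> prob ?A"
        by (intro finite_measure_mono) (auto simp: ac mean)
      also have "\<dots> \<le> exp (- T)"
        using interference_deviation(2)[of u] True by (simp add: mean_interference_def interference_def)
      finally show ?thesis .
    next
      case False
      then have "\<not> small_terms (mixed u w)" for w using ac by blast
      then show ?thesis by simp
    qed
  qed ((measurable)[1], simp)
qed

lemma not_typical_event: "{w \<in> space W. \<not> typical (\<lambda>i. g i w)} \<in> events"
proof (rule event_measurable[where Q="\<lambda>u. \<not> typical u"])
  show "Measurable.pred (PiM (gain_index K M) (\<lambda>_. borel)) (\<lambda>u. \<not> typical u)"
    unfolding typical_def by measurable
qed simp

text \<open>A union bound: truncation costs \<open>2 * K\<close>, aligned and scattered smallness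
  cost 4 for each of at most \<open>M\<close> sources, and the two tails of forward energy, coherent
  sum and interference cost 1 each.\<close>

lemma prob_not_typical:
  "prob {w \<in> space W. \<not> typical (\<lambda>i. g i w)} \<le> (2 * real K + 8 * real M + 6) * exp (- T)"
proof -
  define A where "A Q = {w \<in> space W. Q (\<lambda>i. g i w)}" for Q
  let ?n = "real K / real M * (pi / 4)" and ?s = "sqrt K * T\<^sup>2" and ?t = "real K * sqrt M * x"
  let ?Q1 = "\<lambda>u. \<not> truncated u"
  let ?Q2 = "\<lambda>u. truncated u \<and> real K + ?s \<le> forward_energy u"
  let ?Q3 = "\<lambda>u. forward_energy u \<le> real K - ?s"
  let ?Q4 = "\<lambda>u. truncated u \<and> ?n + ?s \<le> coherent_sum u"
  let ?Q5 = "\<lambda>u. coherent_sum u \<le> ?n - ?s"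
  let ?Q6 = "\<lambda>m' u. truncated u \<and> \<not> aligned_small u m'"
  let ?Q7 = "\<lambda>m' u. truncated u \<and> \<not> scattered_small u m'"
  let ?Q8 = "\<lambda>u. small_terms u \<and> mean_interference u + ?t \<le> interference u"
  let ?Q9 = "\<lambda>u. small_terms u \<and> interference u \<le> mean_interference u - ?t"
  have A: "A Q \<in> events" if "Measurable.pred (PiM (gain_index K M) (\<lambda>_. borel)) Q" "\<And>u. Q (on_index u) = Q u" for Q
    unfolding A_def using that by (rule event_measurable)
  have ev: "A ?Q1 \<in> events" "A ?Q2 \<in> events" "A ?Q3 \<in> events" "A ?Q4 \<in> events" "A ?Q5 \<in> events" "A ?Q8 \<in> events" "A ?Q9 \<in> events"
    by (rule A, (measurable)[1], simp)+
  have ev6: "A (?Q6 m') \<in> events" and ev7: "A (?Q7 m') \<in> events" if m': "m' \<in> {1..M}" for m'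
  proof -
    note [measurable] = aligned_small_measurable[OF m'] scattered_small_measurable[OF m']
    show "A (?Q6 m') \<in> events" "A (?Q7 m') \<in> events"
      by (rule A, (measurable)[1], (use m' in simp)[1], (use m' in simp)[1])+
  qed
  let ?B6 = "\<Union>m'\<in>{1..M} - {m}. A (?Q6 m')" and ?B7 = "\<Union>m'\<in>{1..M}. A (?Q7 m')"
  have evU: "?B6 \<in> events" "?B7 \<in> events"
    using ev6 ev7 by auto
  \<comment> \<open>Each later event may be intersected with truncation or
    \<open>small_terms\<close>, since the failure of these is already covered by the other events of
    the union.\<close>
  have cover: "{w \<in> space W. \<not> typical (\<lambda>i. g i w)} \<subseteq>
      A ?Q1 \<union> (A ?Q2 \<union> (A ?Q3 \<union> (A ?Q4 \<union> (A ?Q5 \<union> (?B6 \<union> (?B7 \<union> (A ?Q8 \<union> A ?Q9)))))))"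
    unfolding A_def typical_def small_terms_def by (auto simp: abs_le_iff not_le)
  have "prob {w \<in> space W. \<not> typical (\<lambda>i. g i w)} \<le>
      prob (A ?Q1 \<union> (A ?Q2 \<union> (A ?Q3 \<union> (A ?Q4 \<union> (A ?Q5 \<union> (?B6 \<union> (?B7 \<union> (A ?Q8 \<union> A ?Q9))))))))"
    using cover by (rule finite_measure_mono) (intro sets.Un ev evU)
  also have "\<dots> \<le> prob (A ?Q1) + (prob (A ?Q2) + (prob (A ?Q3) + (prob (A ?Q4) + (prob (A ?Q5) +
      (prob ?B6 + (prob ?B7 + (prob (A ?Q8) + prob (A ?Q9))))))))"
    by (intro order_trans[OF measure_Un_le] add_left_mono sets.Un ev evU order_refl)
  also have "\<dots> \<le> 2 * real K * exp (- T) + (exp (- T) + (exp (- T) + (exp (- T) + (exp (- T) +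
      (real M * (4 * exp (- T)) + (real M * (4 * exp (- T)) + (exp (- T) + exp (- T))))))))"
  proof (intro add_mono)
    show "prob (A ?Q1) \<le> 2 * real K * exp (- T)"
      unfolding A_def by (rule prob_not_truncated)
    show "prob (A ?Q2) \<le> exp (- T)" "prob (A ?Q3) \<le> exp (- T)"
      unfolding A_def forward_energy_def by (rule prob_forward_energy)+
    show "prob (A ?Q4) \<le> exp (- T)" "prob (A ?Q5) \<le> exp (- T)"
      unfolding A_def coherent_sum_def using prob_coherent_sum by simp_all
    show "prob (A ?Q8) \<le> exp (- T)" "prob (A ?Q9) \<le> exp (- T)"
      unfolding A_def by (rule prob_interference_deviation)+
    have "prob ?B6 \<le> (\<Sum>m'\<in>{1..M} - {m}. prob (A (?Q6 m')))"
      using ev6 by (intro measure_UNION_le) auto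
    also have "\<dots> \<le> (\<Sum>m'\<in>{1..M} - {m}. 4 * exp (- T))"
      unfolding A_def by (intro sum_mono prob_aligned_large) auto
    also have "\<dots> \<le> (\<Sum>m'\<in>{1..M}. 4 * exp (- T))"
      by (intro sum_mono2) auto
    finally show "prob ?B6 \<le> real M * (4 * exp (- T))" by simp
    have "prob ?B7 \<le> (\<Sum>m'\<in>{1..M}. prob (A (?Q7 m')))"
      using ev7 by (intro measure_UNION_le) auto
    also have "\<dots> \<le> (\<Sum>m'\<in>{1..M}. 4 * exp (- T))"
      unfolding A_def by (intro sum_mono prob_scattered_large) auto
    finally show "prob ?B7 \<le> real M * (4 * exp (- T))" by simp
  qed
  also have "\<dots> = (2 * real K + 8 * real M + 6) * exp (- T)"
    by (simp add: algebra_simps)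
  finally show ?thesis .
qed

end

section \<open>Bounds on a typical realization\<close>

text \<open>The normalization \<open>S2\<close> cancels, and the left-hand side becomes the square
  of \<open>N\<close> over \<open>K * M * D\<close>. The term with \<open>8 / (Cl * pi)\<close> is
  exactly the signal error \<open>2 * x * sqrt K\<close> relative to the mean amplitude; the maximum
  with 0 keeps \<open>N\<close> nonnegative, so that squaring is monotone.\<close>

lemma lower_bound_algebra:
  fixes Cl Cb cb S2 s2 K M I B x s :: real
  assumes pos: "0 < K" "0 < M" "0 < S2" "0 < Cl" "0 < s2" "0 \<le> x" "0 \<le> s" "0 \<le> I" "0 \<le> B"
    and s: "Cl * (K / M * (pi / 4)) - 2 * x * sqrt K \<le> s"
    and I: "I \<le> K * M * (Cb\<^sup>2 + 3 * (x / sqrt M))" and B: "B \<le> K * (cb\<^sup>2 + x / sqrt K)"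
  shows "pi\<^sup>2 / 16 * (Cl\<^sup>2 / S2) * (K / M ^ 3) * ((max 0 (1 - 8 / (Cl * pi) * (M / sqrt K) * x))\<^sup>2 /
      (Cb\<^sup>2 / S2 + 3 / S2 * (x / sqrt M) + s2 / S2 * (cb\<^sup>2 + x / sqrt K) + s2 / S2))
    \<le> s\<^sup>2 / (I + s2 * M * B + K * M * s2)"
proof -
  define D where "D = Cb\<^sup>2 + 3 * (x / sqrt M) + s2 * (cb\<^sup>2 + x / sqrt K) + s2"
  define y where "y = max 0 (1 - 8 / (Cl * pi) * (M / sqrt K) * x)"
  define N where "N = Cl * (K / M * (pi / 4)) * y"
  have D: "0 < D" unfolding D_def using pos by (intro add_nonneg_pos add_nonneg_nonneg mult_nonneg_nonneg) auto
  have D_eq: "Cb\<^sup>2 / S2 + 3 / S2 * (x / sqrt M) + s2 / S2 * (cb\<^sup>2 + x / sqrt K) + s2 / S2 = D / S2"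
    unfolding D_def by (simp add: add_divide_distrib)
  have lhs: "pi\<^sup>2 / 16 * (Cl\<^sup>2 / S2) * (K / M ^ 3) * (y\<^sup>2 / (D / S2)) = N\<^sup>2 / (K * M * D)"
    using pos D by (simp add: N_def field_simps power2_eq_square power3_eq_cube)
  have KK: "K / sqrt K = sqrt K" using pos by (simp add: real_div_sqrt)
  have "Cl * (K / M * (pi / 4)) * (8 / (Cl * pi) * (M / sqrt K) * x) = 2 * x * (K / sqrt K)"
    using pos by (simp add: field_simps)
  then have "Cl * (K / M * (pi / 4)) * (1 - 8 / (Cl * pi) * (M / sqrt K) * x) \<le> s"
    using s unfolding KK right_diff_distrib by simp
  then have N: "0 \<le> N" "N \<le> s"
    using pos by (auto simp: N_def y_def max_def)
  have "s2 * M * B \<le> s2 * M * (K * (cb\<^sup>2 + x / sqrt K))"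
    using pos by (intro mult_left_mono B) auto
  then have "I + s2 * M * B + K * M * s2 \<le> K * M * D"
    using I by (simp add: D_def algebra_simps)
  moreover have "0 < I + s2 * M * B + K * M * s2"
    using pos by (intro add_nonneg_pos add_nonneg_nonneg mult_nonneg_nonneg mult_pos_pos) auto
  ultimately have "N\<^sup>2 / (K * M * D) \<le> s\<^sup>2 / (I + s2 * M * B + K * M * s2)"
    using N by (intro frac_le power_mono) auto
  then show ?thesis unfolding D_eq y_def[symmetric] lhs .
qed

text \<open>Dual to the lower bound. The maxima with 0 are justified by nonnegativity of
  \<open>I\<close> and \<open>B\<close>, and the term \<open>s2\<close> keeps the denominator
  positive when both maxima vanish.\<close>

lemma upper_bound_algebra:
  fixes Cl Cb cl S2 s2 K M I B x s :: real
  assumes pos: "0 < K" "0 < M" "0 < S2" "0 < Cb" "0 < s2" "0 \<le> x" "0 \<le> s" "0 \<le> I" "0 \<le> B"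
    and s: "s \<le> Cb * (K / M * (pi / 4)) + 2 * x * sqrt K"
    and I: "K * M * (Cl\<^sup>2 * ((M - 1) / M) - 3 * (x / sqrt M)) \<le> I" and B: "K * (cl\<^sup>2 - x / sqrt K) \<le> B"
  shows "s\<^sup>2 / (I + s2 * M * B + K * M * s2) \<le>
    pi\<^sup>2 / 16 * (Cb\<^sup>2 / S2) * (K / M ^ 3) * ((1 + 8 / (Cb * pi) * (M / sqrt K) * x)\<^sup>2 /
      (max 0 (Cl\<^sup>2 / S2 * ((M - 1) / M) - 3 / S2 * (x / sqrt M)) +
       max 0 (s2 / S2 * (cl\<^sup>2 - x / sqrt K)) + s2 / S2))"
proof -
  define D1 where "D1 = Cl\<^sup>2 * ((M - 1) / M) - 3 * (x / sqrt M)"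
  define D2 where "D2 = s2 * (cl\<^sup>2 - x / sqrt K)"
  define D where "D = max 0 D1 + max 0 D2 + s2"
  define y where "y = 1 + 8 / (Cb * pi) * (M / sqrt K) * x"
  define N where "N = Cb * (K / M * (pi / 4)) * y"
  have D: "0 < D" unfolding D_def using pos by (intro add_nonneg_pos add_nonneg_nonneg) auto
  have scale: "max 0 (z / S2) = max 0 z / S2" for z
    using pos by (auto simp: max_def zero_le_divide_iff divide_le_0_iff)
  have D_eq: "max 0 (Cl\<^sup>2 / S2 * ((M - 1) / M) - 3 / S2 * (x / sqrt M)) +
      max 0 (s2 / S2 * (cl\<^sup>2 - x / sqrt K)) + s2 / S2 = D / S2"
  proof -
    have "Cl\<^sup>2 / S2 * ((M - 1) / M) - 3 / S2 * (x / sqrt M) = D1 / S2"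
      by (simp add: D1_def diff_divide_distrib)
    moreover have "s2 / S2 * (cl\<^sup>2 - x / sqrt K) = D2 / S2"
      by (simp add: D2_def)
    ultimately show ?thesis by (simp only: scale D_def add_divide_distrib)
  qed
  have rhs: "pi\<^sup>2 / 16 * (Cb\<^sup>2 / S2) * (K / M ^ 3) * (y\<^sup>2 / (D / S2)) = N\<^sup>2 / (K * M * D)"
    using pos D by (simp add: N_def field_simps power2_eq_square power3_eq_cube)
  have KK: "K / sqrt K = sqrt K" using pos by (simp add: real_div_sqrt)
  have "Cb * (K / M * (pi / 4)) * (8 / (Cb * pi) * (M / sqrt K) * x) = 2 * x * (K / sqrt K)"
    using pos by (simp add: field_simps)
  then have N: "s \<le> N"
    using s unfolding N_def y_def KK distrib_left by simp
  have "K * M * max 0 D1 \<le> I"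
    using I pos by (auto simp: max_def D1_def)
  moreover have "K * M * max 0 D2 \<le> s2 * M * B"
  proof -
    have "s2 * M * (K * (cl\<^sup>2 - x / sqrt K)) \<le> s2 * M * B"
      using pos by (intro mult_left_mono B) auto
    then show ?thesis using pos by (auto simp: max_def D2_def mult_ac)
  qed
  ultimately have "K * M * D \<le> I + s2 * M * B + K * M * s2"
    by (simp add: D_def distrib_left)
  then have "s\<^sup>2 / (I + s2 * M * B + K * M * s2) \<le> N\<^sup>2 / (K * M * D)"
    using N pos D by (intro frac_le power_mono) auto
  then show ?thesis unfolding D_eq y_def[symmetric] rhs .
qed

section \<open>Signal, interference and noise for a typical assignment\<close>

context relay_gains
begin

lemma groups_nonempty: "real M \<le> real K"
proof -
  have "1 \<le> real K / real M"
    using group_card[OF m] group_card_pos[OF m] by simp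
  then show ?thesis using M by (simp add: field_simps)
qed

text \<open>Since \<open>M\<close> is at most \<open>K\<close>, the error scales
  \<open>M * sqrt K\<close> and \<open>K\<close> are both at most \<open>K * sqrt M\<close>, the
  scale of the interference deviation.\<close>

lemma sqrt_bounds: "real M * sqrt K \<le> real K * sqrt M" "real K \<le> real K * sqrt M" "0 < sqrt K"
proof -
  have "sqrt M * (sqrt M * sqrt K) \<le> sqrt K * (sqrt M * sqrt K)"
    using groups_nonempty by (intro mult_right_mono) auto
  moreover have "sqrt M * (sqrt M * sqrt K) = real M * sqrt K"
    by (simp flip: mult.assoc)
  moreover have "sqrt K * (sqrt M * sqrt K) = real K * sqrt M"
    by (metis mult.assoc mult.commute of_nat_0_le_iff real_sqrt_mult_self abs_of_nonneg)
  ultimately show "real M * sqrt K \<le> real K * sqrt M" by simp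
  have "1 \<le> sqrt M" using M by simp
  then show "real K \<le> real K * sqrt M" using mult_left_mono[of 1 "sqrt M" "real K"] by simp
  show "0 < sqrt K" using K by simp
qed

text \<open>Phase correction makes the aligned part of source \<open>m\<close> a nonnegative real
  \<open>A\<close> between \<open>Cl\<close> and \<open>Cb\<close> times the coherent sum. Its
  fluctuation costs at most \<open>sqrt K * (x / 2)\<close> and the scattered part at most
  \<open>sqrt K * x\<close>, together less than the allowed \<open>2 * x * sqrt K\<close>.\<close>

lemma signal_bounds:
  assumes good: "typical u" and CT: "Cb * T\<^sup>2 \<le> x / 2"
    and Cl: "0 \<le> Cl" "\<And>k. k \<in> {1..K} \<Longrightarrow> Cl \<le> C m k" "Cl \<le> Cb"
  shows "Cl * (real K / real M * (pi / 4)) - 2 * x * sqrt K \<le> cmod (aligned u m + scattered u m)"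
    and "cmod (aligned u m + scattered u m) \<le> Cb * (real K / real M * (pi / 4)) + 2 * x * sqrt K"
proof -
  let ?G = "{k. k \<in> {1..K} \<and> p k = m}" and ?n = "real K / real M * (pi / 4)"
  define A where "A = (\<Sum>k\<in>?G. C m k * (cmod (u (Inr (m, k))) * cmod (u (Inl (k, m)))))"
  have "aligned u m = (\<Sum>k\<in>?G. of_real (C m k * (cmod (u (Inr (m, k))) * cmod (u (Inl (k, m))))))"
    unfolding aligned_def
  proof (intro sum.cong refl)
    fix k assume "k \<in> ?G"
    then have "p k = m" by simp
    have "of_real (C m k) * rotated u k * u (Inl (k, m)) =
        of_real (C m k) * ((cnj (phase (u (Inr (m, k)))) * u (Inr (m, k))) * (cnj (phase (u (Inl (k, m)))) * u (Inl (k, m))))"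
      by (simp add: rotated_def \<open>p k = m\<close> mult_ac)
    then show "of_real (C m k) * rotated u k * u (Inl (k, m)) =
        of_real (C m k * (cmod (u (Inr (m, k))) * cmod (u (Inl (k, m)))))"
      by (simp add: cnj_phase_mult)
  qed
  then have al: "aligned u m = of_real A" by (simp add: A_def)
  have R: "\<bar>coherent_sum u - ?n\<bar> \<le> sqrt K * T\<^sup>2"
    using good by (simp add: typical_def)
  have A: "Cl * coherent_sum u \<le> A" "A \<le> Cb * coherent_sum u" "0 \<le> A"
    unfolding A_def coherent_sum_def sum_distrib_left using Cl C[OF m]
    by (auto intro!: sum_mono mult_right_mono sum_nonneg)
  have CT': "Cb * (sqrt K * T\<^sup>2) \<le> sqrt K * (x / 2)"
    using mult_left_mono[OF CT, of "sqrt K"] by (simp add: mult_ac)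
  have "Cl * (?n - sqrt K * T\<^sup>2) \<le> Cl * coherent_sum u"
    using R Cl by (intro mult_left_mono) auto
  moreover have "Cl * (sqrt K * T\<^sup>2) \<le> Cb * (sqrt K * T\<^sup>2)"
    using Cl by (intro mult_right_mono) auto
  ultimately have lower: "Cl * ?n - sqrt K * (x / 2) \<le> A"
    using A(1) CT' by (simp add: right_diff_distrib)
  have "Cb * coherent_sum u \<le> Cb * (?n + sqrt K * T\<^sup>2)"
    using R Cb by (intro mult_left_mono) auto
  then have upper: "A \<le> Cb * ?n + sqrt K * (x / 2)"
    using A(2) CT' by (simp add: distrib_left)
  have "T \<le> T\<^sup>2" using T by (simp add: self_le_power)
  then have "Cb * T \<le> Cb * T\<^sup>2" using Cb by (intro mult_left_mono) auto
  then have "Cb * T \<le> x / 2" using CT by linarith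
  then have "(Cb * T)\<^sup>2 \<le> (x / 2)\<^sup>2" using Cb T by (intro power_mono) auto
  then have "2 * real K * (Cb * T)\<^sup>2 \<le> 2 * real K * (x / 2)\<^sup>2"
    by (intro mult_left_mono) auto
  moreover have "2 * real K * (x / 2)\<^sup>2 \<le> real K * x\<^sup>2"
    by (simp add: power_divide)
  moreover have "(cmod (scattered u m))\<^sup>2 \<le> 2 * real K * (Cb * T)\<^sup>2"
    using good m by (simp add: typical_def small_terms_def scattered_small_def power_mult_distrib power2_eq_square mult_ac)
  ultimately have "(cmod (scattered u m))\<^sup>2 \<le> real K * x\<^sup>2"
    by linarith
  also have "\<dots> = (sqrt K * x)\<^sup>2" by (simp add: power_mult_distrib)
  finally have sc: "cmod (scattered u m) \<le> sqrt K * x"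
    by (rule power2_le_imp_le) (use x in simp)
  have pos: "0 \<le> sqrt K * x" using x by simp
  have "cmod (aligned u m + scattered u m) \<le> A + cmod (scattered u m)"
    using norm_triangle_ineq[of "aligned u m" "scattered u m"] A(3) by (simp add: al)
  then show "cmod (aligned u m + scattered u m) \<le> Cb * ?n + 2 * x * sqrt K"
    using upper sc pos by (simp add: mult_ac)
  have "A - cmod (scattered u m) \<le> cmod (aligned u m + scattered u m)"
    using norm_diff_ineq[of "aligned u m" "scattered u m"] A(3) by (simp add: al)
  then show "Cl * ?n - 2 * x * sqrt K \<le> cmod (aligned u m + scattered u m)"
    using lower sc pos by (simp add: mult_ac)
qed

text \<open>Three errors are collected on the scale \<open>K * sqrt M * x\<close>: the aligned parts
  give at most \<open>2 / 14\<close>, the fluctuation of the forward energy \<open>1 / 14\<close>,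
  and the deviation from the conditional mean 1. The allowance is 3.\<close>

lemma interference_upper:
  assumes good: "typical u" and CT: "Cb\<^sup>2 * T\<^sup>2 \<le> x / 14"
  shows "interference u \<le> real K * real M * (Cb\<^sup>2 + 3 * (x / sqrt M))"
proof -
  let ?N = "{1..M} - {m}"
  have card_N: "real (card ?N) \<le> real M"
    using card_mono[of "{1..M}" ?N] by simp
  have F: "forward_energy u \<le> real K + sqrt K * T\<^sup>2"
    and I: "interference u \<le> mean_interference u + real K * sqrt M * x"
    using good by (auto simp: typical_def)
  have spread: "spread u m' \<le> Cb\<^sup>2 * forward_energy u" if "m' \<in> {1..M}" for m'
  proof -
    have "spread u m' \<le> (\<Sum>k | k \<in> {1..K} \<and> p k \<noteq> m'. Cb\<^sup>2 * (cmod (u (Inr (m, k))))\<^sup>2)"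
      unfolding spread_def using C[OF that] by (intro sum_mono mult_right_mono power_mono) auto
    also have "\<dots> \<le> (\<Sum>k=1..K. Cb\<^sup>2 * (cmod (u (Inr (m, k))))\<^sup>2)"
      by (intro sum_mono2) auto
    finally show ?thesis by (simp add: forward_energy_def sum_distrib_left)
  qed
  have "mean_interference u \<le> (\<Sum>m'\<in>?N. 2 * T * (real K / real M * (Cb\<^sup>2 * T)) + Cb\<^sup>2 * (real K + sqrt K * T\<^sup>2))"
    unfolding mean_interference_def
  proof (intro sum_mono add_mono)
    fix m' assume m': "m' \<in> ?N"
    show "(cmod (aligned u m'))\<^sup>2 \<le> 2 * T * (real K / real M * (Cb\<^sup>2 * T))"
      using good m' by (simp add: typical_def small_terms_def aligned_small_def)
    have "Cb\<^sup>2 * forward_energy u \<le> Cb\<^sup>2 * (real K + sqrt K * T\<^sup>2)"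
      using F by (intro mult_left_mono) auto
    then show "spread u m' \<le> Cb\<^sup>2 * (real K + sqrt K * T\<^sup>2)"
      using spread[of m'] m' by simp
  qed
  also have "\<dots> \<le> real M * (2 * T * (real K / real M * (Cb\<^sup>2 * T)) + Cb\<^sup>2 * (real K + sqrt K * T\<^sup>2))"
    using card_N T by (simp only: sum_constant) (intro mult_right_mono add_nonneg_nonneg mult_nonneg_nonneg, auto)
  also have "\<dots> = real K * real M * Cb\<^sup>2 + 2 * real K * (Cb\<^sup>2 * T\<^sup>2) + (real M * sqrt K) * (Cb\<^sup>2 * T\<^sup>2)"
    using M by (simp add: field_simps power2_eq_square)
  also have "\<dots> \<le> real K * real M * Cb\<^sup>2 + 2 * ((real K * sqrt M) * (x / 14)) + (real K * sqrt M) * (x / 14)"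
  proof -
    have "real K * (Cb\<^sup>2 * T\<^sup>2) \<le> (real K * sqrt M) * (x / 14)"
      by (rule mult_mono[OF sqrt_bounds(2) CT]) auto
    moreover have "(real M * sqrt K) * (Cb\<^sup>2 * T\<^sup>2) \<le> (real K * sqrt M) * (x / 14)"
      by (rule mult_mono[OF sqrt_bounds(1) CT]) auto
    ultimately show ?thesis unfolding mult.assoc[of 2] by linarith
  qed
  finally have "mean_interference u \<le>
      real K * real M * Cb\<^sup>2 + 2 * ((real K * sqrt M) * (x / 14)) + (real K * sqrt M) * (x / 14)" .
  moreover have "0 \<le> real K * sqrt M * x"
    using x by simp
  ultimately have "interference u \<le> real K * real M * Cb\<^sup>2 + 3 * (real K * sqrt M * x)"
    using I by (simp only: times_divide_eq_right)
  also have "\<dots> = real K * real M * (Cb\<^sup>2 + 3 * (x / sqrt M))"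
  proof -
    have "real M / sqrt M = sqrt M" by (rule real_div_sqrt) simp
    then have "real K * real M * (3 * (x / sqrt M)) = 3 * (real K * sqrt M * x)"
      by (metis (no_types, opaque_lifting) mult.assoc mult.commute mult.left_commute times_divide_eq_right)
    then show ?thesis by (simp add: distrib_left)
  qed
  finally show ?thesis .
qed

text \<open>The aligned parts are dropped. Each relay is missing from the \<open>spread\<close> of
  its own group only, so summing over the sources other than \<open>m\<close> counts the forward
  energy at least \<open>M - 2\<close> times. The lost multiple of \<open>K\<close>, compared with
  the target factor \<open>M - 1\<close>, is absorbed by the error term.\<close>

lemma interference_lower:
  assumes good: "typical u" and CT: "Cb\<^sup>2 * T\<^sup>2 \<le> x / 14"
    and Cl: "0 \<le> Cl" "\<And>m' k. m' \<in> {1..M} \<Longrightarrow> k \<in> {1..K} \<Longrightarrow> Cl \<le> C m' k" "Cl \<le> Cb"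
  shows "real K * real M * (Cl\<^sup>2 * ((real M - 1) / real M) - 3 * (x / sqrt M)) \<le> interference u"
proof -
  let ?N = "{1..M} - {m}"
  let ?e = "\<lambda>k. (cmod (u (Inr (m, k))))\<^sup>2"
  have card_N: "real (card ?N) = real M - 1"
    using m M by (simp add: card_Diff_singleton of_nat_diff)
  have F: "real K - sqrt K * T\<^sup>2 \<le> forward_energy u"
    and I: "mean_interference u - real K * sqrt M * x \<le> interference u"
    using good by (auto simp: typical_def abs_le_iff)
  have split: "(\<Sum>k | k \<in> {1..K} \<and> p k \<noteq> m'. ?e k) = forward_energy u - (\<Sum>k | k \<in> {1..K} \<and> p k = m'. ?e k)" for m'
  proof -
    have "forward_energy u = (\<Sum>k\<in>{k. k \<in> {1..K} \<and> p k \<noteq> m'} \<union> {k. k \<in> {1..K} \<and> p k = m'}. ?e k)"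
      unfolding forward_energy_def by (rule sum.cong) auto
    also have "\<dots> = (\<Sum>k | k \<in> {1..K} \<and> p k \<noteq> m'. ?e k) + (\<Sum>k | k \<in> {1..K} \<and> p k = m'. ?e k)"
      by (rule sum.union_disjoint) auto
    finally show ?thesis by simp
  qed
  have "(\<Sum>m'\<in>?N. \<Sum>k | k \<in> {1..K} \<and> p k = m'. ?e k) \<le> (\<Sum>m'\<in>{1..M}. \<Sum>k | k \<in> {1..K} \<and> p k = m'. ?e k)"
    by (intro sum_mono2 sum_nonneg) auto
  also have "\<dots> = forward_energy u"
    unfolding forward_energy_def using p by (intro sum.group) auto
  finally have "(real M - 2) * forward_energy u \<le> (\<Sum>m'\<in>?N. \<Sum>k | k \<in> {1..K} \<and> p k \<noteq> m'. ?e k)"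
    unfolding split sum_subtractf sum_constant card_N by (simp add: algebra_simps)
  moreover have "(real M - 2) * (real K - sqrt K * T\<^sup>2) \<le> (real M - 2) * forward_energy u"
    using F M by (intro mult_left_mono) auto
  moreover have "(real M - 1) * real K - real K - real M * sqrt K * T\<^sup>2 \<le> (real M - 2) * (real K - sqrt K * T\<^sup>2)"
    by (simp add: algebra_simps)
  ultimately have e: "(real M - 1) * real K - (real K + real M * sqrt K * T\<^sup>2) \<le> (\<Sum>m'\<in>?N. \<Sum>k | k \<in> {1..K} \<and> p k \<noteq> m'. ?e k)"
    by linarith
  have "Cl\<^sup>2 * ((real M - 1) * real K) - Cl\<^sup>2 * (real K + real M * sqrt K * T\<^sup>2) \<le>
      Cl\<^sup>2 * (\<Sum>m'\<in>?N. \<Sum>k | k \<in> {1..K} \<and> p k \<noteq> m'. ?e k)"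
    using mult_left_mono[OF e, of "Cl\<^sup>2"] by (simp add: right_diff_distrib)
  also have "\<dots> \<le> (\<Sum>m'\<in>?N. spread u m')"
    unfolding sum_distrib_left spread_def using Cl by (intro sum_mono mult_right_mono power_mono) auto
  also have "\<dots> \<le> mean_interference u"
    unfolding mean_interference_def by (intro sum_mono) simp
  finally have mean: "Cl\<^sup>2 * ((real M - 1) * real K) - Cl\<^sup>2 * (real K + real M * sqrt K * T\<^sup>2) \<le> mean_interference u" .
  \<comment> \<open>Inserting the square of \<open>T\<close> in front of \<open>K\<close> brings
    both summands into the form \<open>Cb^2 * T^2\<close>, which the hypothesis controls.\<close>
  have "Cl\<^sup>2 * (real K + real M * sqrt K * T\<^sup>2) \<le> Cb\<^sup>2 * (real K * T\<^sup>2 + real M * sqrt K * T\<^sup>2)"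
  proof (intro mult_mono add_mono power_mono Cl order_refl)
    have "1 \<le> T\<^sup>2" using T by (simp add: one_le_power)
    then show "real K \<le> real K * T\<^sup>2" using mult_left_mono[of 1 "T\<^sup>2" "real K"] by simp
  qed (use T in auto)
  also have "\<dots> = real K * (Cb\<^sup>2 * T\<^sup>2) + (real M * sqrt K) * (Cb\<^sup>2 * T\<^sup>2)"
    by (simp add: algebra_simps)
  also have "\<dots> \<le> (real K * sqrt M) * (x / 14) + (real K * sqrt M) * (x / 14)"
    using mult_mono[OF sqrt_bounds(2) CT] mult_mono[OF sqrt_bounds(1) CT] by (intro add_mono) simp_all
  also have "\<dots> \<le> 2 * (real K * sqrt M * x)"
    using mult_nonneg_nonneg[of "real K * sqrt M" x] x by simp
  finally have loss: "Cl\<^sup>2 * (real K + real M * sqrt K * T\<^sup>2) \<le> 2 * (real K * sqrt M * x)" .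
  have "real K * real M * (Cl\<^sup>2 * ((real M - 1) / real M)) = Cl\<^sup>2 * ((real M - 1) * real K)"
    using M by (simp add: field_simps)
  moreover have "real K * real M * (3 * (x / sqrt M)) = 3 * (real K * sqrt M * x)"
  proof -
    have "real M / sqrt M = sqrt M" by (rule real_div_sqrt) simp
    then show ?thesis
      by (metis (no_types, opaque_lifting) mult.assoc mult.commute mult.left_commute times_divide_eq_right)
  qed
  ultimately show ?thesis
    using mean loss I unfolding right_diff_distrib[of "real K * real M"] by linarith
qed

lemma noise_bounds:
  assumes good: "typical u" and CT: "cb\<^sup>2 * T\<^sup>2 \<le> x"
    and c: "0 \<le> cl" "cl \<le> cb" "\<And>k. k \<in> {1..K} \<Longrightarrow> cl \<le> c k \<and> c k \<le> cb"
  shows "(\<Sum>k=1..K. (c k)\<^sup>2 * (cmod (u (Inr (m, k))))\<^sup>2) \<le> real K * (cb\<^sup>2 + x / sqrt K)"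
    and "real K * (cl\<^sup>2 - x / sqrt K) \<le> (\<Sum>k=1..K. (c k)\<^sup>2 * (cmod (u (Inr (m, k))))\<^sup>2)"
proof -
  let ?B = "\<Sum>k=1..K. (c k)\<^sup>2 * (cmod (u (Inr (m, k))))\<^sup>2"
  have F: "real K - sqrt K * T\<^sup>2 \<le> forward_energy u" "forward_energy u \<le> real K + sqrt K * T\<^sup>2"
    using good by (auto simp: typical_def abs_le_iff)
  have KK: "real K * (x / sqrt K) = sqrt K * x"
    by (metis mult.commute of_nat_0_le_iff real_div_sqrt times_divide_eq_left times_divide_eq_right)
  have CT': "cb\<^sup>2 * (sqrt K * T\<^sup>2) \<le> sqrt K * x"
    using mult_left_mono[OF CT, of "sqrt K"] by (simp add: mult_ac)
  have "?B \<le> cb\<^sup>2 * forward_energy u"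
    unfolding forward_energy_def sum_distrib_left using c by (intro sum_mono mult_right_mono power_mono) (auto intro: order_trans)
  also have "\<dots> \<le> cb\<^sup>2 * (real K + sqrt K * T\<^sup>2)"
    using F by (intro mult_left_mono) auto
  finally show "?B \<le> real K * (cb\<^sup>2 + x / sqrt K)"
    using CT' by (simp only: distrib_left KK) (simp add: mult_ac)
  have "cl\<^sup>2 * (sqrt K * T\<^sup>2) \<le> cb\<^sup>2 * (sqrt K * T\<^sup>2)"
    using c by (intro mult_right_mono power_mono) auto
  moreover have "cl\<^sup>2 * (real K - sqrt K * T\<^sup>2) \<le> cl\<^sup>2 * forward_energy u"
    using F by (intro mult_left_mono) auto
  moreover have "cl\<^sup>2 * forward_energy u \<le> ?B"
    unfolding forward_energy_def sum_distrib_left using c by (intro sum_mono mult_right_mono power_mono) auto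
  ultimately show "real K * (cl\<^sup>2 - x / sqrt K) \<le> ?B"
    using CT' by (simp only: right_diff_distrib KK) (simp add: mult_ac)
qed

end

section \<open>The normalization constants and the theorem\<close>

text \<open>The factor \<open>sqrt K\<close> cancels the \<open>K\<close> inside the power
  normalization; what remains depends only on the mean backward energy of relay \<open>k\<close>,
  which lies between \<open>Elo\<close> and \<open>Ehi\<close>.\<close>

lemma sqrt_K_d_P1:
  assumes "0 < K" "0 < (\<Sum>m=1..M. E k m) / real M + \<sigma>\<^sup>2"
  shows "sqrt (real K) * d_P1 K M Prel \<sigma> E k = sqrt (Prel / ((\<Sum>m=1..M. E k m) / real M + \<sigma>\<^sup>2))"
proof -
  let ?v = "(\<Sum>m=1..M. E k m) / real M + \<sigma>\<^sup>2"
  have "real K / real M * (\<Sum>m=1..M. E k m) + real K * \<sigma>\<^sup>2 = real K * ?v"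
    by (simp add: distrib_left)
  moreover have "(real K * ?v) powr (- 1 / 2) = 1 / sqrt (real K * ?v)"
    using assms by (simp add: powr_minus_divide powr_half_sqrt mult_pos_pos less_imp_le)
  ultimately show ?thesis
    using assms by (simp add: d_P1_def real_sqrt_mult real_sqrt_divide)
qed

lemma mean_bounds:
  fixes e :: "nat \<Rightarrow> real"
  assumes M: "0 < M" and e: "\<And>m. m \<in> {1..M} \<Longrightarrow> e m \<in> {lo..hi}"
  shows "lo \<le> (\<Sum>m=1..M. e m) / real M" "(\<Sum>m=1..M. e m) / real M \<le> hi"
proof -
  have "(\<Sum>m=1..M. lo) \<le> (\<Sum>m=1..M. e m)" "(\<Sum>m=1..M. e m) \<le> (\<Sum>m=1..M. hi)"
    by (intro sum_mono; use e in force)+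
  then show "lo \<le> (\<Sum>m=1..M. e m) / real M" "(\<Sum>m=1..M. e m) / real M \<le> hi"
    using M by (simp_all add: field_simps)
qed

lemma c_P1_bounds:
  assumes "0 < Elo" "0 \<le> Plo" "0 < Prel" "0 < K" "0 < M"
    and E: "\<And>m. m \<in> {1..M} \<Longrightarrow> E k m \<in> {Elo..Ehi}" and P: "P m k \<in> {Plo..Phi}"
  shows "c_bound Plo Ehi Prel \<sigma> \<le> c_P1 K M Prel \<sigma> E P m k" "c_P1 K M Prel \<sigma> E P m k \<le> c_bound Phi Elo Prel \<sigma>"
proof -
  let ?v = "(\<Sum>m=1..M. E k m) / real M + \<sigma>\<^sup>2"
  note mean = mean_bounds[where e="E k", OF assms(5) E]
  have v: "0 < ?v" "0 < Elo + \<sigma>\<^sup>2" "Elo + \<sigma>\<^sup>2 \<le> ?v" "?v \<le> Ehi + \<sigma>\<^sup>2"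
    using mean assms(1) by (auto intro: add_pos_nonneg)
  have c: "c_P1 K M Prel \<sigma> E P m k = sqrt (P m k * Prel / ?v)"
    unfolding c_P1_def sqrt_K_d_P1[where E=E and k=k, OF assms(4) v(1)] by (simp add: mult.commute flip: real_sqrt_mult)
  show "c_bound Plo Ehi Prel \<sigma> \<le> c_P1 K M Prel \<sigma> E P m k"
    unfolding c c_bound_def using v P assms by (intro real_sqrt_le_mono frac_le mult_right_mono mult_nonneg_nonneg) auto
  show "c_P1 K M Prel \<sigma> E P m k \<le> c_bound Phi Elo Prel \<sigma>"
    unfolding c c_bound_def using v P assms by (intro real_sqrt_le_mono frac_le mult_right_mono mult_nonneg_nonneg) auto
qed

lemma C_P1_bounds:
  assumes "0 < Elo" "0 \<le> Plo" "0 < Prel" "0 < K" "0 < M" "m' \<in> {1..M}"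
    and E: "\<And>m. m \<in> {1..M} \<Longrightarrow> E k m \<in> {Elo..Ehi}" and P: "P m k \<in> {Plo..Phi}"
  shows "C_bound Plo Elo Ehi Prel \<sigma> \<le> C_P1 K M Prel \<sigma> E P m m' k" "C_P1 K M Prel \<sigma> E P m m' k \<le> C_bound Phi Ehi Elo Prel \<sigma>"
proof -
  let ?v = "(\<Sum>m=1..M. E k m) / real M + \<sigma>\<^sup>2"
  note mean = mean_bounds[where e="E k", OF assms(5) E]
  have v: "0 < ?v" "0 < Elo + \<sigma>\<^sup>2" "Elo + \<sigma>\<^sup>2 \<le> ?v" "?v \<le> Ehi + \<sigma>\<^sup>2"
    using mean assms(1) by (auto intro: add_pos_nonneg)
  have PE: "Plo * Elo \<le> P m k * E k m'" "P m k * E k m' \<le> Phi * Ehi" "0 \<le> P m k * E k m'"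
  proof -
    have "Elo \<le> E k m'" "E k m' \<le> Ehi" "Plo \<le> P m k" "P m k \<le> Phi"
      using E[OF assms(6)] P by auto
    then show "Plo * Elo \<le> P m k * E k m'" "P m k * E k m' \<le> Phi * Ehi" "0 \<le> P m k * E k m'"
      using assms(1,2) by (auto intro!: mult_mono)
  qed
  have c: "C_P1 K M Prel \<sigma> E P m m' k = sqrt (P m k * E k m' * Prel / ?v)"
    unfolding C_P1_def sqrt_K_d_P1[where E=E and k=k, OF assms(4) v(1)] by (simp add: mult.commute flip: real_sqrt_mult)
  have pos: "0 \<le> Phi * Ehi * Prel" "0 \<le> P m k * E k m' * Prel"
    using PE assms by (auto intro!: mult_nonneg_nonneg order_trans[OF PE(3) PE(2)])
  show "C_bound Plo Elo Ehi Prel \<sigma> \<le> C_P1 K M Prel \<sigma> E P m m' k"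
    unfolding c C_bound_def using v PE assms pos by (intro real_sqrt_le_mono frac_le mult_right_mono) auto
  show "C_P1 K M Prel \<sigma> E P m m' k \<le> C_bound Phi Ehi Elo Prel \<sigma>"
    unfolding c C_bound_def using v PE assms pos by (intro real_sqrt_le_mono frac_le mult_right_mono) auto
qed

text \<open>Replaces the fractional powers of 2 in the minimum by simpler bounds:
  \<open>2 powr (- 10 / 21)\<close> is at most 1 and \<open>2 powr (31 / 21)\<close> is at least
  2.\<close>

lemma Delta_P1_bounds:
  assumes Chi: "0 < C_bound Phi Ehi Elo Prel \<sigma>" and chi: "0 < c_bound Phi Elo Prel \<sigma>"
  defines "\<Delta> \<equiv> Delta_P1 Elo Ehi Phi Prel \<sigma>"
  shows "0 < \<Delta>" "\<Delta> \<le> 1" "\<Delta> * (C_bound Phi Ehi Elo Prel \<sigma>)\<^sup>2 \<le> 1 / 2"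
    "\<Delta> * C_bound Phi Ehi Elo Prel \<sigma> ^ 4 \<le> 1 / 8" "\<Delta> * c_bound Phi Elo Prel \<sigma> ^ 4 \<le> 1 / 4"
proof -
  let ?C = "C_bound Phi Ehi Elo Prel \<sigma>" and ?c = "c_bound Phi Elo Prel \<sigma>"
  let ?S = "{2 powr (- 10 / 21), 1 / (2 powr (31 / 21) * ?C\<^sup>2), 1 / (8 * ?C ^ 4), 1 / (4 * ?c ^ 4)} :: real set"
  have \<Delta>: "\<Delta> = Min ?S" by (simp add: \<Delta>_def Delta_P1_def Let_def)
  show "0 < \<Delta>" unfolding \<Delta> using Chi chi by (subst Min_gr_iff) auto
  have le: "\<Delta> \<le> y" if "y \<in> ?S" for y
    unfolding \<Delta> using that by (intro Min_le) auto
  have "\<Delta> \<le> 2 powr (- 10 / 21)" by (rule le) simp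
  also have "\<dots> \<le> 2 powr 0" by (intro powr_mono) auto
  finally show "\<Delta> \<le> 1" by simp
  have "(2::real) powr 1 \<le> 2 powr (31 / 21)" by (intro powr_mono) auto
  then have "1 / (2 powr (31 / 21) * ?C\<^sup>2) \<le> 1 / (2 * ?C\<^sup>2)"
    using Chi by (intro divide_left_mono mult_right_mono mult_pos_pos) auto
  moreover have "\<Delta> \<le> 1 / (2 powr (31 / 21) * ?C\<^sup>2)" by (rule le) simp
  ultimately have "\<Delta> \<le> 1 / (2 * ?C\<^sup>2)" by linarith
  then show "\<Delta> * ?C\<^sup>2 \<le> 1 / 2" using Chi by (simp add: field_simps)
  have "\<Delta> \<le> 1 / (8 * ?C ^ 4)" by (rule le) simp
  then show "\<Delta> * ?C ^ 4 \<le> 1 / 8" using Chi by (simp add: field_simps)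
  have "\<Delta> \<le> 1 / (4 * ?c ^ 4)" by (rule le) simp
  then show "\<Delta> * ?c ^ 4 \<le> 1 / 4" using chi by (simp add: field_simps)
qed

text \<open>With \<open>q = x powr (2 / 7)\<close>, the square of \<open>x\<close> is
  \<open>q ^ 7\<close> and \<open>T\<close> is at most \<open>q\<close>. In each product one factor
  \<open>T\<close> is spent on cancelling the power of \<open>Cb\<close> or \<open>cb\<close>
  through the bounds on \<open>\<Delta>\<close>, leaving a power of \<open>q\<close>; since
  \<open>q\<close> is at least 7, higher powers of \<open>q\<close> absorb the constants.\<close>

lemma scale_conditions:
  fixes \<Delta> Cb cb x :: real
  assumes x: "1 \<le> x" and D: "0 < \<Delta>" "\<Delta> \<le> 1" "\<Delta> * Cb\<^sup>2 \<le> 1 / 2" "\<Delta> * Cb ^ 4 \<le> 1 / 8" "\<Delta> * cb ^ 4 \<le> 1 / 4"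
    and T: "T = \<Delta> * x powr (2 / 7)" "7 \<le> T"
    and pos: "0 < Cb"
  shows "200 * Cb ^ 4 * T ^ 5 \<le> x\<^sup>2" "Cb * T\<^sup>2 \<le> x / 2" "Cb\<^sup>2 * T\<^sup>2 \<le> x / 14" "cb\<^sup>2 * T\<^sup>2 \<le> x"
proof -
  define q where "q = x powr (2 / 7)"
  have q0: "0 \<le> q" by (simp add: q_def)
  have Tq: "T \<le> q" using D q0 mult_right_mono[of \<Delta> 1 q] by (simp add: T(1) q_def)
  have q: "7 \<le> q" using Tq T(2) by linarith
  have x2: "x\<^sup>2 = q ^ 7"
  proof -
    have "q ^ 7 = q powr 7" using q by (simp add: powr_numeral)
    also have "\<dots> = x powr (2 / 7 * 7)" unfolding q_def by (rule powr_powr)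
    finally show ?thesis using x by (simp add: powr_numeral)
  qed
  have qx: "q ^ 3 \<le> x"
  proof (rule power2_le_imp_le)
    have "q ^ 6 \<le> q ^ 7" using q by (intro power_increasing) auto
    then show "(q ^ 3)\<^sup>2 \<le> x\<^sup>2" by (simp add: x2 flip: power_mult)
  qed (use x in simp)
  have T0: "0 \<le> T" using T(2) by linarith
  have TC: "T * Cb\<^sup>2 \<le> q / 2" "T * Cb ^ 4 \<le> q / 8" "T * cb ^ 4 \<le> q / 4"
    using mult_right_mono[OF D(3) q0] mult_right_mono[OF D(4) q0] mult_right_mono[OF D(5) q0]
    by (simp_all add: T(1) q_def mult_ac)
  have step: "7 * q ^ n \<le> q ^ Suc n" for n
    using q q0 by (simp add: mult_right_mono)
  have q5: "0 \<le> q ^ 5" "7 * q ^ 4 \<le> q ^ 5" "7 * q ^ 5 \<le> q ^ 6" "7 * q ^ 6 \<le> q ^ 7"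
    using q0 step[of 4] step[of 5] step[of 6] by (simp_all del: power_Suc)
  have pw: "T ^ n \<le> q ^ n" for n using Tq T0 by (intro power_mono)
  have "Cb ^ 4 * T ^ 5 = (T * Cb ^ 4) * T ^ 4" by (simp add: eval_nat_numeral)
  also have "\<dots> \<le> (q / 8) * q ^ 4" using pw T0 q0 TC by (intro mult_mono) auto
  also have "\<dots> = q ^ 5 / 8" by (simp add: eval_nat_numeral)
  finally have "200 * Cb ^ 4 * T ^ 5 \<le> 25 * q ^ 5" by simp
  \<comment> \<open>Two steps from \<open>q ^ 5\<close> to \<open>q ^ 7\<close> gain a factor 49,
    more than the required 25.\<close>
  also have "\<dots> \<le> q ^ 7" using q5 by linarith
  finally show "200 * Cb ^ 4 * T ^ 5 \<le> x\<^sup>2" by (simp only: x2)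
  have "(Cb * T\<^sup>2)\<^sup>2 = (T * Cb\<^sup>2) * T ^ 3" by (simp add: eval_nat_numeral)
  also have "\<dots> \<le> (q / 2) * q ^ 3" using pw T0 q0 TC by (intro mult_mono) auto
  also have "\<dots> = q ^ 4 / 2" by (simp add: eval_nat_numeral)
  also have "\<dots> \<le> q ^ 7 / 4" using q5 by linarith
  also have "\<dots> = (x / 2)\<^sup>2" by (simp add: power_divide x2)
  finally show "Cb * T\<^sup>2 \<le> x / 2" by (rule power2_le_imp_le) (use x in simp)
  have "Cb\<^sup>2 * T\<^sup>2 = (T * Cb\<^sup>2) * T" by (simp add: power2_eq_square)
  also have "\<dots> \<le> (q / 2) * q" using Tq T0 q0 TC by (intro mult_mono) auto
  also have "\<dots> = q\<^sup>2 / 2" by (simp add: power2_eq_square)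
  \<comment> \<open>The 14 is twice the factor 7 gained by one more power of
    \<open>q\<close>.\<close>
  also have "\<dots> \<le> q ^ 3 / 14" using step[of 2] by (simp add: eval_nat_numeral)
  also have "\<dots> \<le> x / 14" using qx by simp
  finally show "Cb\<^sup>2 * T\<^sup>2 \<le> x / 14" .
  have "(cb\<^sup>2 * T\<^sup>2)\<^sup>2 = (T * cb ^ 4) * T ^ 3" by (simp add: eval_nat_numeral)
  also have "\<dots> \<le> (q / 4) * q ^ 3" using pw T0 q0 TC by (intro mult_mono) auto
  also have "\<dots> = q ^ 4 / 4" by (simp add: eval_nat_numeral)
  also have "\<dots> \<le> q ^ 7" using q5 by linarith
  finally show "cb\<^sup>2 * T\<^sup>2 \<le> x" unfolding x2[symmetric] by (rule power2_le_imp_le) (use x in simp)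
qed

theorem theorem1:
  fixes W :: "'w measure"
    and h f :: "nat \<Rightarrow> nat \<Rightarrow> 'w \<Rightarrow> complex"
    and E P :: "nat \<Rightarrow> nat \<Rightarrow> real"
    and p :: "nat \<Rightarrow> nat"
    and Elo Ehi Plo Phi Prel \<sigma> x :: real
    and K M m :: nat
  assumes "0 < Elo" and "Elo \<le> Ehi"
    and "0 < Plo" and "Plo \<le> Phi"
    and "0 < Prel" and "0 < \<sigma>\<^sup>2"
    and "2 \<le> K" and "2 \<le> M" and "M dvd K"
    and "\<And>k m. k \<in> {1..K} \<Longrightarrow> m \<in> {1..M} \<Longrightarrow> E k m \<in> {Elo..Ehi}"
    and "\<And>k m. k \<in> {1..K} \<Longrightarrow> m \<in> {1..M} \<Longrightarrow> P m k \<in> {Plo..Phi}"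
    and "prob_space W"
    and "\<And>k m. k \<in> {1..K} \<Longrightarrow> m \<in> {1..M} \<Longrightarrow> distributed W lborel (h k m) cn_density"
    and "\<And>k m. k \<in> {1..K} \<Longrightarrow> m \<in> {1..M} \<Longrightarrow> distributed W lborel (f m k) cn_density"
    and "prob_space.indep_vars W (\<lambda>_. borel) (gain_family h f) (gain_index K M)"
    and "p \<in> {1..K} \<rightarrow> {1..M}"
    and "\<And>m. m \<in> {1..M} \<Longrightarrow> card {k \<in> {1..K}. p k = m} = K div M"
    and "1 \<le> x"
    and "m \<in> {1..M}"
  shows "measure W {w \<in> space W.
             SINR_P1 K M Prel \<sigma> E P p (\<lambda>k m. h k m w) (\<lambda>m k. f m k w) m
               \<notin> {L_P1 Elo Ehi Plo Phi Prel \<sigma> K M x..U_P1 Elo Ehi Plo Phi Prel \<sigma> K M x}}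
         \<le> 302 * (real K)\<^sup>2 * real M * exp (- Delta_P1 Elo Ehi Phi Prel \<sigma> * x powr (2 / 7))"
proof -
  let ?Clo = "C_bound Plo Elo Ehi Prel \<sigma>" and ?Chi = "C_bound Phi Ehi Elo Prel \<sigma>"
  let ?clo = "c_bound Plo Ehi Prel \<sigma>" and ?chi = "c_bound Phi Elo Prel \<sigma>"
  let ?\<Delta> = "Delta_P1 Elo Ehi Phi Prel \<sigma>"
  note E = assms(10) and P = assms(11)
  interpret prob_space W by (rule assms(12))
  have K: "0 < K" and M: "0 < M" using assms(7,8) by auto
  have Clo: "0 < ?Clo" and Chi: "0 < ?Chi" and clo: "0 < ?clo" and chi: "0 < ?chi"
    using assms(1-6) by (auto simp: C_bound_def c_bound_def intro!: mult_pos_pos add_pos_pos divide_pos_pos)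
  have C_le: "?Clo \<le> C_P1 K M Prel \<sigma> E P m m' k" "C_P1 K M Prel \<sigma> E P m m' k \<le> ?Chi"
    if "m' \<in> {1..M}" "k \<in> {1..K}" for m' k
    by (rule C_P1_bounds[where Plo=Plo and Phi=Phi and Elo=Elo and Ehi=Ehi];
      use assms(1-5) K M that E P assms(19) in simp)+
  have c_le: "?clo \<le> c_P1 K M Prel \<sigma> E P m k" "c_P1 K M Prel \<sigma> E P m k \<le> ?chi" if "k \<in> {1..K}" for k
    by (rule c_P1_bounds[where Plo=Plo and Phi=Phi and Elo=Elo and Ehi=Ehi];
      use assms(1-5) K M that E P assms(19) in simp)+
  define T where "T = ?\<Delta> * x powr (2 / 7)"
  let ?bad = "{w \<in> space W. SINR_P1 K M Prel \<sigma> E P p (\<lambda>k m. h k m w) (\<lambda>m k. f m k w) m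
      \<notin> {L_P1 Elo Ehi Plo Phi Prel \<sigma> K M x..U_P1 Elo Ehi Plo Phi Prel \<sigma> K M x}}"
  have K2M: "1 \<le> (real K)\<^sup>2 * real M" "real K \<le> (real K)\<^sup>2 * real M" "real M \<le> (real K)\<^sup>2 * real M"
    "8 \<le> (real K)\<^sup>2 * real M"
  proof -
    have KM: "2 \<le> real K" "2 \<le> real M" using assms(7,8) by auto
    have KK: "4 \<le> (real K)\<^sup>2" "real K \<le> (real K)\<^sup>2"
      using power_mono[OF KM(1), of 2] self_le_power[of "real K" 2] KM by auto
    show "8 \<le> (real K)\<^sup>2 * real M" using mult_mono[of 4 "(real K)\<^sup>2" 2 "real M"] KK KM by simp
    then show "1 \<le> (real K)\<^sup>2 * real M" by linarith
    show "real K \<le> (real K)\<^sup>2 * real M" using mult_mono[of "real K" "(real K)\<^sup>2" 1 "real M"] KK KM by simp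
    show "real M \<le> (real K)\<^sup>2 * real M" using mult_mono[of 1 "(real K)\<^sup>2" "real M" "real M"] KK KM by simp
  qed
  show ?thesis
  proof (cases "T < 7")
    case True
    \<comment> \<open>For small \<open>T\<close> the bound is trivial: \<open>exp T\<close> is at
      most the seventh power of 3, which is 2187, while \<open>302 * K^2 * M\<close> is at least 302
      times 8, which is 2416.\<close>
    have "exp 7 = exp (1::real) ^ 7" by (simp flip: exp_of_nat_mult)
    also have "\<dots> \<le> 3 ^ 7" by (intro power_mono exp_le) simp
    finally have "exp 7 \<le> (2187 :: real)" by simp
    moreover have "exp T \<le> exp 7" using True by simp
    ultimately have "exp T \<le> 2187" by linarith
    also have "\<dots> \<le> 302 * ((real K)\<^sup>2 * real M)" using K2M(4) by simp
    finally have "1 \<le> 302 * (real K)\<^sup>2 * real M * exp (- T)"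
      by (simp add: exp_minus field_simps)
    then have "prob ?bad \<le> 302 * (real K)\<^sup>2 * real M * exp (- T)"
      using prob_le_1[of ?bad] by linarith
    then show ?thesis by (simp only: T_def minus_mult_left)
  next
    case False
    then have T: "7 \<le> T" by simp
    note scale = scale_conditions[OF assms(18) Delta_P1_bounds[OF Chi chi] T_def T Chi]
    interpret relay_gains W "gain_family h f" K M m p "C_P1 K M Prel \<sigma> E P m" ?Chi T x
    proof
      show "0 < K" "2 \<le> M" "m \<in> {1..M}" "0 < ?Chi" "7 \<le> T" "0 < x" "200 * ?Chi ^ 4 * T ^ 5 \<le> x\<^sup>2"
        using K assms(8,18,19) Chi T scale(1) by auto
      show "p k \<in> {1..M}" if "k \<in> {1..K}" for k
        using assms(16) that by auto
      show "real (card {k \<in> {1..K}. p k = m'}) = real K / real M" if "m' \<in> {1..M}" for m'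
        unfolding assms(17)[OF that] using assms(9) by (rule real_of_nat_div)
      show "indep_vars (\<lambda>_. borel) (gain_family h f) (gain_index K M)"
        by (rule assms(15))
      show "distributed W lborel (gain_family h f i) cn_density" if "i \<in> gain_index K M" for i
        using that assms(13,14) by (auto simp: gain_index_def gain_family_def)
      show "0 \<le> C_P1 K M Prel \<sigma> E P m m' k \<and> C_P1 K M Prel \<sigma> E P m m' k \<le> ?Chi"
        if "m' \<in> {1..M}" "k \<in> {1..K}" for m' k
        using C_le[OF that] Clo by auto
    qed
    have subset: "?bad \<subseteq> {w \<in> space W. \<not> typical (\<lambda>i. gain_family h f i w)}"
    proof (rule subsetI, rule ccontr)
      fix w
      define u where "u = (\<lambda>i. gain_family h f i w)"
      assume bad: "w \<in> ?bad" and "w \<notin> {w \<in> space W. \<not> typical (\<lambda>i. gain_family h f i w)}"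
      then have good: "typical u" by (simp add: u_def)
      \<comment> \<open>Splitting the relays by whether they belong to group \<open>m'\<close> turns
        the channel sum into its aligned and scattered parts.\<close>
      have a: "(\<Sum>k=1..K. a_P1 K M Prel \<sigma> E P p (\<lambda>k m. h k m w) (\<lambda>m k. f m k w) m m' k) =
          aligned u m' + scattered u m'" for m'
      proof -
        have "(\<Sum>k=1..K. a_P1 K M Prel \<sigma> E P p (\<lambda>k m. h k m w) (\<lambda>m k. f m k w) m m' k) =
            (\<Sum>k\<in>{k. k \<in> {1..K} \<and> p k = m'} \<union> {k. k \<in> {1..K} \<and> p k \<noteq> m'}.
              of_real (C_P1 K M Prel \<sigma> E P m m' k) * rotated u k * u (Inl (k, m')))"
          by (intro sum.cong) (auto simp: a_P1_def rotated_def u_def gain_family_def mult_ac)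
        also have "\<dots> = aligned u m' + scattered u m'"
          unfolding aligned_def scattered_def by (rule sum.union_disjoint) auto
        finally show ?thesis .
      qed
      define B where "B = (\<Sum>k=1..K. (c_P1 K M Prel \<sigma> E P m k)\<^sup>2 * (cmod (u (Inr (m, k))))\<^sup>2)"
      have b: "(\<Sum>k=1..K. (cmod (b_P1 K M Prel \<sigma> E P p (\<lambda>k m. h k m w) (\<lambda>m k. f m k w) m k))\<^sup>2) = B"
        unfolding B_def by (intro sum.cong) (simp_all add: b_P1_def u_def gain_family_def norm_mult power_mult_distrib)
      define s where "s = cmod (aligned u m + scattered u m)"
      have sinr: "SINR_P1 K M Prel \<sigma> E P p (\<lambda>k m. h k m w) (\<lambda>m k. f m k w) m =
          s\<^sup>2 / (interference u + \<sigma>\<^sup>2 * real M * B + real K * real M * \<sigma>\<^sup>2)"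
        unfolding SINR_P1_def a b interference_def s_def ..
      \<comment> \<open>Chaining the two-sided coefficient bounds at relay 1 yields
        \<open>?Clo \<le> ?Chi\<close> and \<open>?clo \<le> ?chi\<close>.\<close>
      have one: "1 \<in> {1..K}" using K by simp
      note Clo_le = order_trans[OF C_le(1)[OF assms(19) one] C_le(2)[OF assms(19) one]]
      note clo_le = order_trans[OF c_le(1)[OF one] c_le(2)[OF one]]
      have sig: "?Clo * (real K / real M * (pi / 4)) - 2 * x * sqrt K \<le> s"
        "s \<le> ?Chi * (real K / real M * (pi / 4)) + 2 * x * sqrt K"
        unfolding s_def by (rule signal_bounds[OF good scale(2) less_imp_le[OF Clo] C_le(1)[OF assms(19)] Clo_le]; assumption)+
      note int = interference_upper[OF good scale(3)]
        interference_lower[OF good scale(3) less_imp_le[OF Clo] C_le(1) Clo_le]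
      have noise: "B \<le> real K * (?chi\<^sup>2 + x / sqrt K)" "real K * (?clo\<^sup>2 - x / sqrt K) \<le> B"
        unfolding B_def by (rule noise_bounds[OF good scale(4) less_imp_le[OF clo] clo_le]; intro conjI c_le; assumption)+
      have pos: "0 < real K" "0 < real M" "0 \<le> x" "0 \<le> s" "0 \<le> interference u" "0 \<le> B"
        using K M assms(18) by (auto simp: s_def interference_def B_def intro!: sum_nonneg)
      have SN: "0 < (C_SN c1 c2 \<sigma>)\<^sup>2" for c1 c2
      proof -
        have "0 < c1\<^sup>2 + \<sigma>\<^sup>2 * (c2\<^sup>2 + 1)"
          using assms(6) by (intro add_nonneg_pos mult_pos_pos) (auto intro: add_nonneg_pos)
        then show ?thesis by (simp add: C_SN_def)
      qed
      have "L_P1 Elo Ehi Plo Phi Prel \<sigma> K M x \<le> s\<^sup>2 / (interference u + \<sigma>\<^sup>2 * real M * B + real K * real M * \<sigma>\<^sup>2)"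
        unfolding L_P1_def Let_def
        by (rule lower_bound_algebra[OF pos(1,2) SN Clo assms(6) pos(3-6) sig(1) int(1) noise(1)])
      moreover have "s\<^sup>2 / (interference u + \<sigma>\<^sup>2 * real M * B + real K * real M * \<sigma>\<^sup>2) \<le> U_P1 Elo Ehi Plo Phi Prel \<sigma> K M x"
        unfolding U_P1_def Let_def
        by (rule upper_bound_algebra[OF pos(1,2) SN Chi assms(6) pos(3-6) sig(2) int(2) noise(2)])
      ultimately show False
        using bad unfolding mem_Collect_eq sinr by simp
    qed
    have "prob ?bad \<le> prob {w \<in> space W. \<not> typical (\<lambda>i. gain_family h f i w)}"
      by (rule finite_measure_mono[OF subset not_typical_event])
    also have "\<dots> \<le> (2 * real K + 8 * real M + 6) * exp (- T)"
      by (rule prob_not_typical)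
    \<comment> \<open>Each of \<open>K\<close>, \<open>M\<close> and 1 is at most
      \<open>K^2 * M\<close>, so the prefactor is at most 2 + 8 + 6 = 16 times
      \<open>K^2 * M\<close>.\<close>
    also have "\<dots> \<le> (302 * (real K)\<^sup>2 * real M) * exp (- T)"
      using K2M by (intro mult_right_mono) auto
    finally show ?thesis by (simp only: T_def minus_mult_left)
  qed
qed

end
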